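(* Let $\iota\colon\mathbb{S}^n\hookrightarrow\mathbb{S}^{n+1}$ denote set inclusion, and let $\mathscr{H}$ be the space of all immersions $\mathbb{S}^n\to\mathbb{S}^{n+1}$ whose Gauss maps (duals) have image contained in some open hemisphere depending upon the immersion. Then $$\bar\Psi\colon\mathrm{SO}_{n+2}\times_{\mathrm{SO}_{n+1}}\mathrm{Diff}_+(\mathbb{S}^n)\to\mathscr{H},\qquad[Q,g]\mapsto Q\circ\iota\circ g$$ is a homotopy equivalence. In fact, given $f\in\mathscr{H}$, let $c_f\in\mathbb{S}^{n+1}$ be the center of the image of its dual. Choose any $Q_f\in\mathrm{SO}_{n+2}$ with $Q_f(-e_{n+2})=c_f$ and set $g_f=\tau\circ Q_f^{-1}\circ f$. A homotopy inverse of $\bar\Psi$ is defined by $$\bar\Phi\colon\mathscr{H}\to\mathrm{SO}_{n+2}\times_{\mathrm{SO}_{n+1}}\mathrm{Diff}_+(\mathbb{S}^n),\qquad f\mapsto[Q_f,g_f].$$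
   Context: Throughout, $n\ge2$ is an integer, manifolds are connected, oriented and smooth, maps between manifolds are smooth, and spaces of such maps (in particular $\mathscr{H}$ and $\mathrm{Diff}_+(\mathbb{S}^n)$) carry the $C^\infty$-topology. $\mathbb{S}^{n+1}\subset\mathbb{R}^{n+2}$ is the unit sphere with the round metric; $\mathbb{S}^n\subset\mathbb{R}^{n+1}=\mathbb{R}^{n+1}\times\{0\}\subset\mathbb{R}^{n+2}$; $e_{n+2}$ is the last vector of the standard basis. $(u_1,\dots,u_{n+1})$ is positively oriented in $T\mathbb{S}^{n+1}_p$ iff $(u_1,\dots,u_{n+1},p)$ is positively oriented in $\mathbb{R}^{n+2}$ (analogously for $\mathbb{S}^n\subset\mathbb{R}^{n+1}$). The Gauss map $\nu_f$ of an immersion $f\colon N^n\to\mathbb{S}^{n+1}$ is the unit normal such that $(df(u_1),\dots,df(u_n),\nu_f)$ is a positively oriented orthonormal frame whenever $(u_1,\dots,u_n)$ is a positively oriented orthonormal frame of $N$. The dual $f^\star$ is $\nu_f$ regarded as a map into $\mathbb{S}^{n+1}$. The center of a set contained in an open hemisphere of $\mathbb{S}^{n+1}$ (and compact) is the center of the unique smallest closed metric ball containing it (circumcenter). The map $\tau$ is $$\tau\colon\mathbb{S}^{n+1}\smallsetminus\{\pm e_{n+2}\}\to\mathbb{S}^n,\qquad p\mapsto\frac{p-\langle p,e_{n+2}\rangle e_{n+2}}{|p-\langle p,e_{n+2}\rangle e_{n+2}|}.$$ $\mathrm{Diff}_+(\mathbb{S}^n)$ is the group of orientation-preserving diffeomorphisms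 of $\mathbb{S}^n$. $\mathrm{SO}_{n+1}$ is regarded as the subgroup of $\mathrm{SO}_{n+2}$ fixing $e_{n+2}$. The twisted product $\mathrm{SO}_{n+2}\times_{\mathrm{SO}_{n+1}}\mathrm{Diff}_+(\mathbb{S}^n)$ is the quotient of $\mathrm{SO}_{n+2}\times\mathrm{Diff}_+(\mathbb{S}^n)$ by the equivalence relation identifying $(Q,g)$ with $(QP,P^{-1}g)$ for $P\in\mathrm{SO}_{n+1}$; classes are denoted $[Q,g]$. *)

theory Defs
  imports "HOL-Analysis.Analysis"
begin

text \<open>
  The ambient space \<open>real^'n\<close> is Euclidean space of dimension \<open>CARD('n) = n + 2\<close>; the wellorder on
  \<open>'n\<close> orders the coordinates, and the maximal index is the last one. The hyperplane of vectors with
  vanishing last coordinate is $(n+1)$-dimensional space, and \<open>equator\<close> is its unit sphere.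
\<close>

type_synonym 'n pt = "(real, 'n) vec"
type_synonym 'n mat = "((real, 'n) vec, 'n) vec"

abbreviation usphere :: "(('n::finite) pt) set"
  where "usphere \<equiv> sphere 0 1"

definition e_last :: "('n::{finite,wellorder}) pt"
  where "e_last = axis (Max UNIV) 1"

definition equator :: "(('n::{finite,wellorder}) pt) set"
  where "equator = {x \<in> usphere. x \<bullet> e_last = 0}"

text \<open>Off the line spanned by \<open>e_last\<close>, the following is the retraction onto \<open>equator\<close>.\<close>

definition tau :: "'n pt \<Rightarrow> ('n::{finite,wellorder}) pt"
  where "tau p = (p - (p \<bullet> e_last) *\<^sub>R e_last) /\<^sub>R norm (p - (p \<bullet> e_last) *\<^sub>R e_last)"

definition tangent_usphere :: "('n::finite) pt \<Rightarrow> ('n pt) set"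
  where "tangent_usphere q = {v. v \<bullet> q = 0}"

definition tangent_equator :: "'n pt \<Rightarrow> (('n::{finite,wellorder}) pt) set"
  where "tangent_equator p = {u. u \<bullet> p = 0 \<and> u \<bullet> e_last = 0}"


section \<open>Orientations\<close>

text \<open>\<open>card {j. j < i}\<close> is the position of the coordinate \<open>i\<close>, counted from 0.\<close>

definition pos_oriented :: "(('n::{finite,wellorder}) pt) list \<Rightarrow> bool"
  where "pos_oriented vs \<longleftrightarrow> length vs = CARD('n) \<and> det (\<chi> i. vs ! card {j. j < i}) > 0"

definition orthonormal_list :: "'a::real_inner list \<Rightarrow> bool"
  where "orthonormal_list vs \<longleftrightarrow>
    (\<forall>i<length vs. \<forall>j<length vs. vs ! i \<bullet> vs ! j = (if i = j then 1 else 0))"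

definition pos_frame_usphere :: "('n::{finite,wellorder}) pt \<Rightarrow> ('n pt) list \<Rightarrow> bool"
  where "pos_frame_usphere q vs \<longleftrightarrow> set vs \<subseteq> tangent_usphere q \<and> pos_oriented (vs @ [q])"

text \<open>
  A basis of the hyperplane orthogonal to \<open>e_last\<close> is positively oriented there iff it becomes a
  positively oriented basis of the ambient space when \<open>e_last\<close> is appended.
\<close>

definition pos_frame_equator :: "('n::{finite,wellorder}) pt \<Rightarrow> ('n pt) list \<Rightarrow> bool"
  where "pos_frame_equator p us \<longleftrightarrow> set us \<subseteq> tangent_equator p \<and> pos_oriented (us @ [p, e_last])"


section \<open>Smooth maps and the smooth topology\<close>

fun iter_deriv :: "'a list \<Rightarrow> ('a::real_normed_vector \<Rightarrow> 'b::real_normed_vector) \<Rightarrow> 'a \<Rightarrow> 'b"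
  where
    "iter_deriv [] F = F"
  | "iter_deriv (v # vs) F = (\<lambda>x. frechet_derivative (iter_deriv vs F) (at x) v)"

text \<open>Meant for open \<open>U\<close>.\<close>

definition smooth_on_open ::
    "'a::real_normed_vector set \<Rightarrow> ('a \<Rightarrow> 'b::real_normed_vector) \<Rightarrow> bool"
  where "smooth_on_open U F \<longleftrightarrow> (\<forall>vs. \<forall>x\<in>U. iter_deriv vs F differentiable (at x))"

text \<open>Smoothness on a submanifold: existence of local smooth extensions to the ambient space.\<close>

definition smooth_map_on ::
    "'a::real_normed_vector set \<Rightarrow> ('a \<Rightarrow> 'b::real_normed_vector) \<Rightarrow> bool"
  where "smooth_map_on S f \<longleftrightarrow>
    (\<forall>x\<in>S. \<exists>U F. open U \<and> x \<in> U \<and> smooth_on_open U F \<and> (\<forall>y\<in>U \<inter> S. F y = f y))"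

text \<open>Maps defined on \<open>equator\<close> are represented by extensional functions.\<close>

definition smooth_maps :: "('n pt) set \<Rightarrow> ('n pt \<Rightarrow> ('n::{finite,wellorder}) pt) set"
  where "smooth_maps Y = {f \<in> equator \<rightarrow>\<^sub>E Y. smooth_map_on equator f}"

text \<open>
  For a smooth map \<open>f\<close> on \<open>equator\<close>, the function \<open>f \<circ> tau\<close> is a smooth extension of \<open>f\<close> to the
  complement of the line spanned by \<open>e_last\<close>. Hence its derivative at a point \<open>p\<close> of \<open>equator\<close>
  restricts to the differential of \<open>f\<close> on \<open>tangent_equator p\<close>.
\<close>

definition diff_map ::
    "('n pt \<Rightarrow> 'n pt) \<Rightarrow> 'n pt \<Rightarrow> 'n pt \<Rightarrow> ('n::{finite,wellorder}) pt"
  where "diff_map f p u = frechet_derivative (f \<circ> tau) (at p) u"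

text \<open>
  Uniform convergence of all derivatives: on \<open>equator\<close>, the ambient derivatives of \<open>f \<circ> tau\<close> of
  order at most \<open>k\<close> and the derivatives of \<open>f\<close> of order at most \<open>k\<close> (in charts of the compact
  manifold \<open>equator\<close>) determine each other linearly with smooth coefficients, so they define the
  same topology.
\<close>

definition smooth_topology ::
    "('n pt) set \<Rightarrow> ('n pt \<Rightarrow> ('n::{finite,wellorder}) pt) topology"
  where "smooth_topology Y = topology_generated_by
    {{h \<in> smooth_maps Y. \<forall>x\<in>equator.
        norm (iter_deriv vs (h \<circ> tau) x - iter_deriv vs (f \<circ> tau) x) < e} | f vs e.
      f \<in> smooth_maps Y \<and> (e::real) > 0}"


section \<open>Immersions, Gauss maps and the space of immersions with hemispherical dual\<close>

definition immersions :: "('n pt \<Rightarrow> ('n::{finite,wellorder}) pt) set"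
  where "immersions =
    {f \<in> smooth_maps usphere. \<forall>p\<in>equator. inj_on (diff_map f p) (tangent_equator p)}"

text \<open>
  Orthonormality of a frame \<open>us\<close> of \<open>equator\<close> refers to the metric induced by \<open>f\<close>, that is, to
  orthonormality of its image under the differential of \<open>f\<close>.
\<close>

definition gauss_map ::
    "('n pt \<Rightarrow> 'n pt) \<Rightarrow> 'n pt \<Rightarrow> ('n::{finite,wellorder}) pt"
  where "gauss_map f p = (THE \<nu>.
    \<forall>us. pos_frame_equator p us \<and> orthonormal_list (map (diff_map f p) us) \<longrightarrow>
      pos_frame_usphere (f p) (map (diff_map f p) us @ [\<nu>]) \<and>
      orthonormal_list (map (diff_map f p) us @ [\<nu>]))"

definition dual_image :: "('n pt \<Rightarrow> 'n pt) \<Rightarrow> (('n::{finite,wellorder}) pt) set"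
  where "dual_image f = gauss_map f ` equator"

definition open_hemisphere :: "('n::finite) pt \<Rightarrow> ('n pt) set"
  where "open_hemisphere a = {x \<in> usphere. x \<bullet> a > 0}"

definition hemi_immersions :: "('n pt \<Rightarrow> ('n::{finite,wellorder}) pt) set"
  where "hemi_immersions =
    {f \<in> immersions. \<exists>a\<in>usphere. dual_image f \<subseteq> open_hemisphere a}"

definition hemi_top :: "('n pt \<Rightarrow> ('n::{finite,wellorder}) pt) topology"
  where "hemi_top = subtopology (smooth_topology usphere) hemi_immersions"

text \<open>Closed balls of \<open>usphere\<close> are taken with respect to the geodesic distance.\<close>

definition sphere_cball :: "('n::finite) pt \<Rightarrow> real \<Rightarrow> ('n pt) set"
  where "sphere_cball c r = {x \<in> usphere. arccos (c \<bullet> x) \<le> r}"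

definition circumcenter :: "(('n::finite) pt) set \<Rightarrow> 'n pt"
  where "circumcenter A = (THE c. c \<in> usphere \<and>
    (\<exists>r. A \<subseteq> sphere_cball c r \<and> (\<forall>c'\<in>usphere. \<forall>r'. A \<subseteq> sphere_cball c' r' \<longrightarrow> r \<le> r')))"


section \<open>Diffeomorphisms and the twisted product\<close>

definition diff_plus :: "('n pt \<Rightarrow> ('n::{finite,wellorder}) pt) set"
  where "diff_plus =
    {g \<in> smooth_maps equator. bij_betw g equator equator \<and>
       smooth_map_on equator (inv_into equator g) \<and>
       (\<forall>p\<in>equator. \<forall>us. pos_frame_equator p us \<longrightarrow>
          pos_frame_equator (g p) (map (diff_map g p) us))}"

definition diff_plus_top :: "('n pt \<Rightarrow> ('n::{finite,wellorder}) pt) topology"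
  where "diff_plus_top = subtopology (smooth_topology equator) diff_plus"

definition SO :: "(('n::finite) mat) set"
  where "SO = {Q. orthogonal_matrix Q \<and> det Q = 1}"

definition SO_sub :: "(('n::{finite,wellorder}) mat) set"
  where "SO_sub = {P \<in> SO. P *v e_last = e_last}"

definition quotient_topology :: "'a topology \<Rightarrow> ('a \<times> 'a) set \<Rightarrow> 'a set topology"
  where "quotient_topology X R =
    topology (\<lambda>U. U \<subseteq> topspace X // R \<and> openin X {x \<in> topspace X. R `` {x} \<in> U})"

lemma openin_quotient_topology:
  "openin (quotient_topology X R) U \<longleftrightarrow>
     U \<subseteq> topspace X // R \<and> openin X {x \<in> topspace X. R `` {x} \<in> U}"
proof -
  have "istopology (\<lambda>U. U \<subseteq> topspace X // R \<and> openin X {x \<in> topspace X. R `` {x} \<in> U})"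
    unfolding istopology_def
  proof (intro conjI allI impI)
    fix S T
    assume S: "S \<subseteq> topspace X // R \<and> openin X {x \<in> topspace X. R `` {x} \<in> S}"
      and T: "T \<subseteq> topspace X // R \<and> openin X {x \<in> topspace X. R `` {x} \<in> T}"
    show "S \<inter> T \<subseteq> topspace X // R" using S by blast
    have "{x \<in> topspace X. R `` {x} \<in> S \<inter> T} =
        {x \<in> topspace X. R `` {x} \<in> S} \<inter> {x \<in> topspace X. R `` {x} \<in> T}" by blast
    then show "openin X {x \<in> topspace X. R `` {x} \<in> S \<inter> T}" using S T by auto
  next
    fix K
    assume K: "\<forall>S\<in>K. S \<subseteq> topspace X // R \<and> openin X {x \<in> topspace X. R `` {x} \<in> S}"
    show "\<Union>K \<subseteq> topspace X // R" using K by blast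
    have "{x \<in> topspace X. R `` {x} \<in> \<Union>K} = (\<Union>S\<in>K. {x \<in> topspace X. R `` {x} \<in> S})" by blast
    then show "openin X {x \<in> topspace X. R `` {x} \<in> \<Union>K}" using K by auto
  qed
  then show ?thesis by (simp add: quotient_topology_def)
qed

lemma topspace_quotient_topology: "topspace (quotient_topology X R) = topspace X // R"
proof -
  have "{x \<in> topspace X. R `` {x} \<in> topspace X // R} = topspace X"
    by (auto simp: quotientI)
  then have "openin (quotient_topology X R) (topspace X // R)"
    by (simp add: openin_quotient_topology)
  then show ?thesis
    by (metis openin_quotient_topology openin_subset openin_topspace subset_antisym)
qed

lemma quotient_map_quotient_topology:
  "quotient_map X (quotient_topology X R) (\<lambda>x. R `` {x})"
  unfolding quotient_map_def
  by (auto simp: topspace_quotient_topology openin_quotient_topology quotient_def)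

definition twisted_rel ::
    "(('n mat \<times> ('n pt \<Rightarrow> 'n pt)) \<times>
      ('n mat \<times> ('n pt \<Rightarrow> ('n::{finite,wellorder}) pt))) set"
  where "twisted_rel =
    {((Q, g), (Q', g')). Q \<in> SO \<and> g \<in> diff_plus \<and> Q' \<in> SO \<and> g' \<in> diff_plus \<and>
       (\<exists>P\<in>SO_sub. Q' = Q ** P \<and> g' = compose equator ((*v) (matrix_inv P)) g)}"

definition twisted_class ::
    "'n mat \<Rightarrow> ('n pt \<Rightarrow> 'n pt) \<Rightarrow> ('n mat \<times> ('n pt \<Rightarrow> ('n::{finite,wellorder}) pt)) set"
  where "twisted_class Q g = twisted_rel `` {(Q, g)}"

definition twisted_top :: "('n mat \<times> ('n pt \<Rightarrow> ('n::{finite,wellorder}) pt)) set topology"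
  where "twisted_top =
    quotient_topology (prod_topology (top_of_set SO) diff_plus_top) twisted_rel"


section \<open>The two maps\<close>

text \<open>
  The inclusion of \<open>equator\<close> into \<open>usphere\<close> is the identity on vectors and therefore invisible.
  \<open>the_elem\<close> extracts the common value over all representatives, respectively over all choices
  of \<open>Q\<close>.
\<close>

definition Psi_bar ::
    "('n mat \<times> ('n pt \<Rightarrow> 'n pt)) set \<Rightarrow> 'n pt \<Rightarrow> ('n::{finite,wellorder}) pt"
  where "Psi_bar C = the_elem ((\<lambda>(Q, g). compose equator ((*v) Q) g) ` C)"

definition center_rotations :: "('n pt \<Rightarrow> 'n pt) \<Rightarrow> (('n::{finite,wellorder}) mat) set"
  where "center_rotations f = {Q \<in> SO. Q *v (- e_last) = circumcenter (dual_image f)}"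

definition projected_map ::
    "'n mat \<Rightarrow> ('n pt \<Rightarrow> 'n pt) \<Rightarrow> 'n pt \<Rightarrow> ('n::{finite,wellorder}) pt"
  where "projected_map Q f = restrict (tau \<circ> (*v) (matrix_inv Q) \<circ> f) equator"

definition Phi_bar ::
    "('n pt \<Rightarrow> 'n pt) \<Rightarrow> ('n mat \<times> ('n pt \<Rightarrow> ('n::{finite,wellorder}) pt)) set"
  where "Phi_bar f = the_elem ((\<lambda>Q. twisted_class Q (projected_map Q f)) ` center_rotations f)"

definition homotopy_inverse ::
    "'a topology \<Rightarrow> 'b topology \<Rightarrow> ('a \<Rightarrow> 'b) \<Rightarrow> ('b \<Rightarrow> 'a) \<Rightarrow> bool"
  where "homotopy_inverse X Y f g \<longleftrightarrow>
    continuous_map X Y f \<and> continuous_map Y X g \<and>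
    homotopic_with (\<lambda>_. True) X X (g \<circ> f) id \<and> homotopic_with (\<lambda>_. True) Y Y (f \<circ> g) id"

definition homotopy_equivalence_map :: "'a topology \<Rightarrow> 'b topology \<Rightarrow> ('a \<Rightarrow> 'b) \<Rightarrow> bool"
  where "homotopy_equivalence_map X Y f \<longleftrightarrow> (\<exists>g. homotopy_inverse X Y f g)"

end

theory Submission
  imports Defs
begin

text \<open>
  Let \<open>c\<close> be the center of the dual image of \<open>f\<close>. The center maximizes, over the unit sphere, the
  minimum of the inner products with the dual image; since this minimum is positive for some unit
  vector, it is positive at the maximizer, which is unique by convexity and depends continuously
  on \<open>f\<close>. As the dual is never orthogonal to \<open>c\<close>, removing the fraction \<open>t\<close> of the component of \<open>f\<close>
  along \<open>c\<close> and normalizing yields immersions \<open>f\<^sub>t\<close> whose duals remain in the open hemisphere around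
  \<open>c\<close>. They join \<open>f = f\<^sub>0\<close> to \<open>f\<^sub>1\<close>, which takes values in the great sphere orthogonal to \<open>c\<close>, and
  the projected map of \<open>f\<close> is \<open>Q\<^sup>-\<^sup>1 \<circ> f\<^sub>1\<close>. It is a local diffeomorphism of a simply connected closed
  manifold, hence a covering and a diffeomorphism. So \<open>Psi_bar \<circ> Phi_bar\<close> maps \<open>f\<close> to \<open>f\<^sub>1\<close> and is
  homotopic to the identity, while \<open>Phi_bar \<circ> Psi_bar\<close> is the identity.
\<close>

section \<open>Families of smooth maps\<close>

text \<open>Immersions and Gauss maps are tracked by one number, \<open>map_det f p x\<close>, the
  determinant of the frame formed by the differential of \<open>f\<close>, the position
  \<open>f p\<close> and the vector \<open>x\<close>. It is linear in \<open>x\<close>, and the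
  vector representing it is a multiple of the normal. Hence \<open>map_det f p (- c) > 0\<close> for
  all \<open>p\<close> says at once that \<open>f\<close> is an immersion and that its dual lies in
  the open hemisphere around \<open>c\<close>. Flattening changes this frame by a triangular
  transformation with positive diagonal, so the condition survives. The minus sign is one of
  convention: frames of the sphere end with (normal, position), here the order is (position,
  vector). For the same reason the inclusion has Gauss map \<open>- e_last\<close>, the vector that
  is matched with the center. The analytic obstacle is that continuity concerns all derivatives at
  once. It is handled by parametrized families with jointly continuous derivatives, closed under the
  operations that occur; compactness of the equator makes the estimates uniform. The rotation for
  the center is chosen continuously only near a given map, which is enough for continuity into the
  quotient.\<close>

definition dir_deriv :: "'a \<Rightarrow> ('a::real_normed_vector \<Rightarrow> 'b::real_normed_vector) \<Rightarrow> 'a \<Rightarrow> 'b"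
  where "dir_deriv v F x = frechet_derivative F (at x) v"

text \<open>For compact \<open>K\<close> the tube lemma turns this into closeness uniform on
  \<open>K\<close>, see \<open>jointly_cont_uniform\<close>; continuity into the smooth topology is
  proved in this way.\<close>

definition jointly_cont ::
    "'x topology \<Rightarrow> 'a::topological_space set \<Rightarrow> ('x \<Rightarrow> 'a \<Rightarrow> 'b::topological_space) \<Rightarrow> bool"
  where "jointly_cont X K \<phi> \<longleftrightarrow>
    continuous_map (prod_topology X (top_of_set K)) euclidean (\<lambda>z. \<phi> (fst z) (snd z))"

text \<open>
  Continuity of the derivatives is only demanded on \<open>K \<subseteq> U\<close>: the smooth topology controls the
  derivatives on the equator only, which has empty interior.
\<close>

primrec Ck_family :: "nat \<Rightarrow> 'x topology \<Rightarrow> 'a::real_normed_vector set \<Rightarrow> 'a set \<Rightarrow>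
    ('x \<Rightarrow> 'a \<Rightarrow> 'b::real_normed_vector) \<Rightarrow> bool"
  where
    "Ck_family 0 X U K \<phi> \<longleftrightarrow> jointly_cont X K \<phi>"
  | "Ck_family (Suc k) X U K \<phi> \<longleftrightarrow> jointly_cont X K \<phi> \<and>
      (\<forall>x\<in>topspace X. \<forall>p\<in>U. \<phi> x differentiable at p) \<and>
      (\<forall>v. Ck_family k X U K (\<lambda>x. dir_deriv v (\<phi> x)))"

lemma has_derivative_dir_deriv:
  assumes "F differentiable at x"
  shows "(F has_derivative (\<lambda>v. dir_deriv v F x)) (at x)"
  using assms by (simp add: dir_deriv_def frechet_derivative_works eta_contract_eq)

lemma dir_deriv_eq: "(F has_derivative F') (at x) \<Longrightarrow> dir_deriv v F x = F' v"
  unfolding dir_deriv_def using frechet_derivative_at by metis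

lemma has_derivative_transform_open:
  assumes "(F has_derivative F') (at x)" "open U" "x \<in> U" "\<And>y. y \<in> U \<Longrightarrow> F y = G y"
  shows "(G has_derivative F') (at x)"
  using has_derivative_transform_within_open[OF assms(1,2,3)] assms(4) by blast

lemma dir_deriv_cong_open:
  assumes "open U" "x \<in> U" "\<And>y. y \<in> U \<Longrightarrow> F y = G y"
  shows "dir_deriv v F x = dir_deriv v G x"
proof -
  have "(F has_derivative F') (at x) \<longleftrightarrow> (G has_derivative F') (at x)" for F'
    using has_derivative_transform_open[OF _ assms(1,2)] assms(3) by metis
  then show ?thesis by (simp add: dir_deriv_def frechet_derivative_def)
qed

lemma differentiable_cong_open:
  assumes "open U" "x \<in> U" "\<And>y. y \<in> U \<Longrightarrow> F y = G y"
  shows "F differentiable at x \<longleftrightarrow> G differentiable at x"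
  unfolding differentiable_def
  using has_derivative_transform_open[OF _ assms(1,2)] assms(3) by metis

lemma jointly_cont_cong:
  assumes "\<And>x p. x \<in> topspace X \<Longrightarrow> p \<in> K \<Longrightarrow> \<phi> x p = \<psi> x p"
  shows "jointly_cont X K \<phi> \<longleftrightarrow> jointly_cont X K \<psi>"
  unfolding jointly_cont_def by (rule iffI; erule continuous_map_eq) (use assms in auto)

lemma Ck_family_jointly_cont: "Ck_family k X U K \<phi> \<Longrightarrow> jointly_cont X K \<phi>"
  by (cases k) auto

lemma Ck_family_Suc_lower: "Ck_family (Suc k) X U K \<phi> \<Longrightarrow> Ck_family k X U K \<phi>"
proof (induction k arbitrary: \<phi>)
  case (Suc k)
  then show ?case by (metis Ck_family.simps(2))
qed auto

lemma Ck_family_cong: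
  assumes "open U" "K \<subseteq> U" "\<And>x p. x \<in> topspace X \<Longrightarrow> p \<in> U \<Longrightarrow> \<phi> x p = \<psi> x p"
  shows "Ck_family k X U K \<phi> \<longleftrightarrow> Ck_family k X U K \<psi>"
  using assms(3)
proof (induction k arbitrary: \<phi> \<psi>)
  case 0
  then show ?case using assms(2) by (auto intro!: jointly_cont_cong)
next
  case (Suc k)
  have "jointly_cont X K \<phi> \<longleftrightarrow> jointly_cont X K \<psi>"
    using Suc.prems assms(2) by (auto intro!: jointly_cont_cong)
  moreover have "\<phi> x differentiable at p \<longleftrightarrow> \<psi> x differentiable at p"
    if "x \<in> topspace X" "p \<in> U" for x p
    using differentiable_cong_open[OF assms(1)] that Suc.prems by blast
  moreover have "Ck_family k X U K (\<lambda>x. dir_deriv v (\<phi> x)) \<longleftrightarrow>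
      Ck_family k X U K (\<lambda>x. dir_deriv v (\<psi> x))" for v
    by (rule Suc.IH) (use dir_deriv_cong_open[OF assms(1)] Suc.prems in blast)
  ultimately show ?case by auto
qed

lemma continuous_map_euclidean_compose:
  assumes "continuous_map Z euclidean f" "continuous_on S h" "\<And>z. z \<in> topspace Z \<Longrightarrow> f z \<in> S"
  shows "continuous_map Z euclidean (\<lambda>z. h (f z))"
proof -
  have "continuous_map Z (top_of_set S) f"
    using assms by (simp add: continuous_map_into_subtopology Pi_I)
  then show ?thesis
    using continuous_map_compose[of Z "top_of_set S" f euclidean h] assms(2)
    by (simp add: o_def)
qed

lemma continuous_map_euclidean_Pair:
  assumes "continuous_map Z euclidean f" "continuous_map Z euclidean g"
  shows "continuous_map Z euclidean (\<lambda>z. (f z, g z))"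
  using continuous_map_pairedI[OF assms] by (simp add: euclidean_product_topology)

lemma continuous_map_bilinear:
  assumes "bounded_bilinear B" "continuous_map Z euclidean f" "continuous_map Z euclidean g"
  shows "continuous_map Z euclidean (\<lambda>z. B (f z) (g z))"
proof -
  have "continuous_on UNIV (\<lambda>w. B (fst w) (snd w))"
    by (intro bounded_bilinear.continuous_on[OF assms(1)] continuous_intros)
  from continuous_map_euclidean_compose[OF continuous_map_euclidean_Pair[OF assms(2,3)] this]
  show ?thesis by simp
qed

lemma jointly_cont_compose:
  assumes "jointly_cont X K \<phi>" "continuous_on S h"
    and "\<And>x p. x \<in> topspace X \<Longrightarrow> p \<in> K \<Longrightarrow> \<phi> x p \<in> S"
  shows "jointly_cont X K (\<lambda>x p. h (\<phi> x p))"
  unfolding jointly_cont_def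
  by (rule continuous_map_euclidean_compose[OF assms(1)[unfolded jointly_cont_def] assms(2)])
    (use assms(3) in auto)

lemma jointly_cont_bilinear:
  assumes "bounded_bilinear B" "jointly_cont X K \<phi>" "jointly_cont X K \<psi>"
  shows "jointly_cont X K (\<lambda>x p. B (\<phi> x p) (\<psi> x p))"
  using continuous_map_bilinear[OF assms(1)] assms(2,3) unfolding jointly_cont_def by blast

lemma jointly_cont_add:
  fixes \<phi> \<psi> :: "'x \<Rightarrow> 'a::topological_space \<Rightarrow> 'b::real_normed_vector"
  assumes "jointly_cont X K \<phi>" "jointly_cont X K \<psi>"
  shows "jointly_cont X K (\<lambda>x p. \<phi> x p + \<psi> x p)"
  using continuous_map_add assms unfolding jointly_cont_def by blast

lemma jointly_cont_of_fst:
  assumes "continuous_map X euclidean c"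
  shows "jointly_cont X K (\<lambda>x p. c x)"
  unfolding jointly_cont_def
  using continuous_map_of_fst assms by (auto simp: o_def)

lemma jointly_cont_of_snd: "continuous_on K h \<Longrightarrow> jointly_cont X K (\<lambda>x. h)"
  unfolding jointly_cont_def
  using continuous_map_of_snd[of X "top_of_set K" euclidean h] by (auto simp: o_def)

section \<open>Closure of C^k families under the operations of calculus\<close>

lemma Ck_family_of_fst:
  fixes c :: "'x \<Rightarrow> 'b::real_normed_vector" and U :: "'a::real_normed_vector set"
  assumes "open U" "K \<subseteq> U"
  shows "continuous_map X euclidean c \<Longrightarrow> Ck_family k X U K (\<lambda>x p. c x)"
proof (induction k arbitrary: c)
  case (Suc k)
  have "dir_deriv v (\<lambda>p. c x) = (\<lambda>p. 0)" for v :: 'a and x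
    by (rule ext) (simp add: dir_deriv_eq[OF has_derivative_const])
  then show ?case using Suc.IH[of "\<lambda>x. 0"] Suc.prems by (auto intro: jointly_cont_of_fst)
qed (simp add: jointly_cont_of_fst)

lemma Ck_family_linear_snd:
  assumes "bounded_linear h" "open U" "K \<subseteq> U"
  shows "Ck_family k X U K (\<lambda>x. h)"
proof (cases k)
  case 0
  then show ?thesis
    by (simp add: assms(1) jointly_cont_of_snd linear_continuous_on)
next
  case (Suc j)
  have "dir_deriv v h = (\<lambda>p. h v)" for v
    by (rule ext) (simp add: dir_deriv_eq[OF bounded_linear_imp_has_derivative[OF assms(1)]])
  then show ?thesis using Suc Ck_family_of_fst[OF assms(2,3), of X "\<lambda>x. h _" j] assms(1)
    by (auto simp: jointly_cont_of_snd linear_continuous_on bounded_linear_imp_differentiable)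
qed

text \<open>The closure rules share one induction: the directional derivative is rewritten on all of
  \<open>U\<close> by the corresponding rule of calculus, and the resulting expression is built from
  families of order \<open>k\<close>.\<close>

lemma Ck_family_add:
  assumes "open U" "K \<subseteq> U"
  shows "Ck_family k X U K \<phi> \<Longrightarrow> Ck_family k X U K \<psi> \<Longrightarrow>
    Ck_family k X U K (\<lambda>x p. \<phi> x p + \<psi> x p)"
proof (induction k arbitrary: \<phi> \<psi>)
  case (Suc k)
  have "dir_deriv v (\<lambda>p. \<phi> x p + \<psi> x p) p = dir_deriv v (\<phi> x) p + dir_deriv v (\<psi> x) p"
    if "x \<in> topspace X" "p \<in> U" for x p v
    using Suc.prems that
    by (intro dir_deriv_eq has_derivative_add has_derivative_dir_deriv) auto
  then have "Ck_family k X U K (\<lambda>x. dir_deriv v (\<lambda>p. \<phi> x p + \<psi> x p)) \<longleftrightarrow>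
      Ck_family k X U K (\<lambda>x p. dir_deriv v (\<phi> x) p + dir_deriv v (\<psi> x) p)" for v
    by (intro Ck_family_cong assms)
  then show ?case using Suc by (auto intro: jointly_cont_add)
qed (simp add: jointly_cont_add)

text \<open>An arbitrary bounded bilinear map covers products, scalar multiples, inner products and
  the action of matrices on vectors. The product rule leaves one factor undifferentiated, hence the
  passage to order \<open>k\<close> by \<open>Ck_family_Suc_lower\<close>.\<close>

lemma Ck_family_bilinear:
  assumes "bounded_bilinear B" "open U" "K \<subseteq> U"
  shows "Ck_family k X U K \<phi> \<Longrightarrow> Ck_family k X U K \<psi> \<Longrightarrow>
    Ck_family k X U K (\<lambda>x p. B (\<phi> x p) (\<psi> x p))"
proof (induction k arbitrary: \<phi> \<psi>)
  case 0
  then show ?case using jointly_cont_bilinear[OF assms(1)] by auto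
next
  case (Suc k)
  have *: "((\<lambda>p. B (\<phi> x p) (\<psi> x p)) has_derivative
      (\<lambda>v. B (\<phi> x p) (dir_deriv v (\<psi> x) p) + B (dir_deriv v (\<phi> x) p) (\<psi> x p))) (at p)"
    if "x \<in> topspace X" "p \<in> U" for x p
    using Suc.prems that
    by (intro bounded_bilinear.FDERIV[OF assms(1)] has_derivative_dir_deriv) auto
  have "Ck_family k X U K (\<lambda>x. dir_deriv v (\<lambda>p. B (\<phi> x p) (\<psi> x p))) \<longleftrightarrow>
      Ck_family k X U K
        (\<lambda>x p. B (\<phi> x p) (dir_deriv v (\<psi> x) p) + B (dir_deriv v (\<phi> x) p) (\<psi> x p))" for v
    by (intro Ck_family_cong assms) (simp add: dir_deriv_eq[OF *])
  moreover have "Ck_family k X U K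
      (\<lambda>x p. B (\<phi> x p) (dir_deriv v (\<psi> x) p) + B (dir_deriv v (\<phi> x) p) (\<psi> x p))" for v
    using Suc.prems Ck_family_Suc_lower[OF Suc.prems(1)] Ck_family_Suc_lower[OF Suc.prems(2)]
    by (intro Ck_family_add Suc.IH assms) auto
  moreover have "jointly_cont X K (\<lambda>x p. B (\<phi> x p) (\<psi> x p))"
    using Suc.prems by (intro jointly_cont_bilinear[OF assms(1)]) auto
  ultimately show ?case using differentiableI[OF *] by auto
qed

lemma Ck_family_linear:
  assumes "bounded_linear h" "open U" "K \<subseteq> U"
  shows "Ck_family k X U K \<phi> \<Longrightarrow> Ck_family k X U K (\<lambda>x p. h (\<phi> x p))"
proof (induction k arbitrary: \<phi>)
  case 0
  then show ?case
    using jointly_cont_compose[of X K \<phi> UNIV h] assms(1) by (simp add: linear_continuous_on)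
next
  case (Suc k)
  have *: "((\<lambda>p. h (\<phi> x p)) has_derivative (\<lambda>v. h (dir_deriv v (\<phi> x) p))) (at p)"
    if "x \<in> topspace X" "p \<in> U" for x p
    using Suc.prems that
    by (intro bounded_linear.has_derivative[OF assms(1)] has_derivative_dir_deriv) auto
  have "Ck_family k X U K (\<lambda>x. dir_deriv v (\<lambda>p. h (\<phi> x p))) \<longleftrightarrow>
      Ck_family k X U K (\<lambda>x p. h (dir_deriv v (\<phi> x) p))" for v
    by (intro Ck_family_cong assms) (simp add: dir_deriv_eq[OF *])
  moreover have "jointly_cont X K (\<lambda>x p. h (\<phi> x p))"
    using Suc.prems jointly_cont_compose[of X K \<phi> UNIV h] assms(1)
    by (simp add: linear_continuous_on)
  ultimately show ?case using differentiableI[OF *] Suc by auto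
qed

lemma Ck_family_sum:
  assumes "open U" "K \<subseteq> U" "finite I" "\<And>i. i \<in> I \<Longrightarrow> Ck_family k X U K (\<phi> i)"
  shows "Ck_family k X U K (\<lambda>x p. \<Sum>i\<in>I. \<phi> i x p)"
  using assms(3,4)
proof (induction I)
  case empty
  then show ?case using Ck_family_of_fst[OF assms(1,2), of X "\<lambda>x. 0"] by simp
next
  case (insert i I)
  then show ?case
    using Ck_family_add[OF assms(1,2), of k X "\<phi> i" "\<lambda>x p. \<Sum>i\<in>I. \<phi> i x p"] by simp
qed

lemma Ck_family_prod:
  fixes \<phi> :: "'i \<Rightarrow> 'x \<Rightarrow> 'a::real_normed_vector \<Rightarrow> real"
  assumes "open U" "K \<subseteq> U" "finite I" "\<And>i. i \<in> I \<Longrightarrow> Ck_family k X U K (\<phi> i)"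
  shows "Ck_family k X U K (\<lambda>x p. \<Prod>i\<in>I. \<phi> i x p)"
  using assms(3,4)
proof (induction I)
  case empty
  then show ?case using Ck_family_of_fst[OF assms(1,2), of X "\<lambda>x. 1"] by simp
next
  case (insert i I)
  then show ?case
    using Ck_family_bilinear[OF bounded_bilinear_mult assms(1,2), of k X "\<phi> i" "\<lambda>x p. \<Prod>i\<in>I. \<phi> i x p"]
    by simp
qed

text \<open>The derivative is again a product containing the reciprocal itself, to which the
  induction hypothesis applies at the lower order.\<close>

lemma Ck_family_inverse:
  fixes \<phi> :: "'x \<Rightarrow> 'a::real_normed_vector \<Rightarrow> real"
  assumes "open U" "K \<subseteq> U" "\<And>x p. x \<in> topspace X \<Longrightarrow> p \<in> U \<Longrightarrow> \<phi> x p \<noteq> 0"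
  shows "Ck_family k X U K \<phi> \<Longrightarrow> Ck_family k X U K (\<lambda>x p. inverse (\<phi> x p))"
proof (induction k)
  case 0
  then show ?case using assms
    by (auto intro!: jointly_cont_compose[where S = "-{0}" and h = inverse] continuous_intros)
next
  case (Suc k)
  have *: "((\<lambda>p. inverse (\<phi> x p)) has_derivative
      (\<lambda>v. - (inverse (\<phi> x p) * dir_deriv v (\<phi> x) p * inverse (\<phi> x p)))) (at p)"
    if "x \<in> topspace X" "p \<in> U" for x p
    using Suc.prems that assms(3)
    by (intro Deriv.has_derivative_inverse has_derivative_dir_deriv) auto
  have "Ck_family k X U K (\<lambda>x. dir_deriv v (\<lambda>p. inverse (\<phi> x p))) \<longleftrightarrow>
      Ck_family k X U K (\<lambda>x p. - (inverse (\<phi> x p) * dir_deriv v (\<phi> x) p * inverse (\<phi> x p)))" for v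
    by (intro Ck_family_cong assms) (simp add: dir_deriv_eq[OF *])
  moreover have "Ck_family k X U K
      (\<lambda>x p. - (inverse (\<phi> x p) * dir_deriv v (\<phi> x) p * inverse (\<phi> x p)))" for v
    using Suc.prems Suc.IH[OF Ck_family_Suc_lower[OF Suc.prems]]
    by (intro Ck_family_linear[OF bounded_linear_minus[OF bounded_linear_ident]]
        Ck_family_bilinear[OF bounded_bilinear_mult] assms(1,2)) auto
  moreover have "jointly_cont X K (\<lambda>x p. inverse (\<phi> x p))"
    using Suc.prems assms
    by (auto intro!: jointly_cont_compose[where S = "-{0}" and h = inverse] continuous_intros)
  ultimately show ?case using differentiableI[OF *] by auto
qed

text \<open>The derivative contains the reciprocal of the root, so the induction hypothesis is
  combined with \<open>Ck_family_inverse\<close>; positivity keeps the root away from 0.\<close>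

lemma Ck_family_sqrt:
  fixes \<phi> :: "'x \<Rightarrow> 'a::real_normed_vector \<Rightarrow> real"
  assumes "open U" "K \<subseteq> U" "\<And>x p. x \<in> topspace X \<Longrightarrow> p \<in> U \<Longrightarrow> \<phi> x p > 0"
  shows "Ck_family k X U K \<phi> \<Longrightarrow> Ck_family k X U K (\<lambda>x p. sqrt (\<phi> x p))"
proof (induction k)
  case 0
  then show ?case
    by (auto intro!: jointly_cont_compose[where S = UNIV and h = sqrt] continuous_intros)
next
  case (Suc k)
  have *: "((\<lambda>p. sqrt (\<phi> x p)) has_derivative
      (\<lambda>v. dir_deriv v (\<phi> x) p * (inverse (sqrt (\<phi> x p)) / 2))) (at p)"
    if "x \<in> topspace X" "p \<in> U" for x p
    using Suc.prems that assms(3)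
    by (intro has_derivative_real_sqrt has_derivative_dir_deriv) auto
  have "Ck_family k X U K (\<lambda>x. dir_deriv v (\<lambda>p. sqrt (\<phi> x p))) \<longleftrightarrow>
      Ck_family k X U K (\<lambda>x p. dir_deriv v (\<phi> x) p * (inverse (sqrt (\<phi> x p)) / 2))" for v
    by (intro Ck_family_cong assms) (simp add: dir_deriv_eq[OF *])
  moreover have "Ck_family k X U K (\<lambda>x p. dir_deriv v (\<phi> x) p * (inverse (sqrt (\<phi> x p)) / 2))" for v
    using Suc.prems Suc.IH[OF Ck_family_Suc_lower[OF Suc.prems]] assms(3)
    by (intro Ck_family_linear[OF bounded_linear_divide[of 2]] Ck_family_inverse
        Ck_family_bilinear[OF bounded_bilinear_mult] assms(1,2)) (auto simp: less_imp_neq[THEN not_sym])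
  moreover have "jointly_cont X K (\<lambda>x p. sqrt (\<phi> x p))"
    using Suc.prems
    by (auto intro!: jointly_cont_compose[where S = UNIV and h = sqrt] continuous_intros)
  ultimately show ?case using differentiableI[OF *] by auto
qed

section \<open>Composition, change of parameters and restriction\<close>

lemma jointly_cont_compose_family:
  assumes "jointly_cont X K' \<phi>" "jointly_cont X K \<psi>"
    and "\<And>x p. x \<in> topspace X \<Longrightarrow> p \<in> K \<Longrightarrow> \<psi> x p \<in> K'"
  shows "jointly_cont X K (\<lambda>x p. \<phi> x (\<psi> x p))"
proof -
  have "continuous_map (prod_topology X (top_of_set K)) (prod_topology X (top_of_set K'))
      (\<lambda>z. (fst z, \<psi> (fst z) (snd z)))"
    using assms unfolding jointly_cont_def
    by (intro continuous_map_pairedI continuous_map_fst continuous_map_into_subtopology) auto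
  from continuous_map_compose[OF this assms(1)[unfolded jointly_cont_def]]
  show ?thesis by (simp add: jointly_cont_def o_def)
qed

text \<open>By the chain rule, differentiating produces derivatives of the outer family composed
  with the same \<open>\<psi>\<close>; this is why the induction generalizes over
  \<open>\<phi>\<close> only.\<close>

lemma Ck_family_compose:
  fixes \<phi> :: "'x \<Rightarrow> 'b::euclidean_space \<Rightarrow> 'c::real_normed_vector"
    and \<psi> :: "'x \<Rightarrow> 'a::real_normed_vector \<Rightarrow> 'b"
  assumes "open U" "K \<subseteq> U"
    and U': "\<And>x p. x \<in> topspace X \<Longrightarrow> p \<in> U \<Longrightarrow> \<psi> x p \<in> U'"
    and K': "\<And>x p. x \<in> topspace X \<Longrightarrow> p \<in> K \<Longrightarrow> \<psi> x p \<in> K'"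
  shows "Ck_family k X U' K' \<phi> \<Longrightarrow> Ck_family k X U K \<psi> \<Longrightarrow>
    Ck_family k X U K (\<lambda>x p. \<phi> x (\<psi> x p))"
proof (induction k arbitrary: \<phi>)
  case 0
  then show ?case using jointly_cont_compose_family[of X K' \<phi> K \<psi>] K' by auto
next
  case (Suc k)
  have *: "((\<lambda>p. \<phi> x (\<psi> x p)) has_derivative
      (\<lambda>v. dir_deriv (dir_deriv v (\<psi> x) p) (\<phi> x) (\<psi> x p))) (at p)"
    if "x \<in> topspace X" "p \<in> U" for x p
    using Suc.prems that U'
    by (intro has_derivative_compose[of "\<psi> x" _ p UNIV "\<phi> x" "\<lambda>w. dir_deriv w (\<phi> x) (\<psi> x p)"] has_derivative_dir_deriv) auto
  \<comment> \<open>The chain rule differentiates \<phi> in a direction that depends on the point,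
    whereas the induction hypothesis speaks of fixed directions. Expanding in the basis leaves fixed
    directions, with coefficients that are families themselves.\<close>
  have **: "dir_deriv v (\<lambda>p. \<phi> x (\<psi> x p)) p =
      (\<Sum>b\<in>Basis. (dir_deriv v (\<psi> x) p \<bullet> b) *\<^sub>R dir_deriv b (\<phi> x) (\<psi> x p))"
    if "x \<in> topspace X" "p \<in> U" for x p v
  proof -
    have "linear (\<lambda>w. dir_deriv w (\<phi> x) (\<psi> x p))"
      using Suc.prems that U'
      by (intro has_derivative_linear[OF has_derivative_dir_deriv]) auto
    from linear_sum[OF this, of "\<lambda>b. (dir_deriv v (\<psi> x) p \<bullet> b) *\<^sub>R b" Basis]
      linear_scale[OF this]
    show ?thesis
      by (simp add: dir_deriv_eq[OF *[OF that]] euclidean_representation)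
  qed
  have "Ck_family k X U K (\<lambda>x. dir_deriv v (\<lambda>p. \<phi> x (\<psi> x p))) \<longleftrightarrow> Ck_family k X U K
      (\<lambda>x p. \<Sum>b\<in>Basis. (dir_deriv v (\<psi> x) p \<bullet> b) *\<^sub>R dir_deriv b (\<phi> x) (\<psi> x p))" for v
    by (intro Ck_family_cong assms) (simp add: **)
  moreover have "Ck_family k X U K
      (\<lambda>x p. \<Sum>b\<in>Basis. (dir_deriv v (\<psi> x) p \<bullet> b) *\<^sub>R dir_deriv b (\<phi> x) (\<psi> x p))" for v
    using Suc.prems Ck_family_Suc_lower[OF Suc.prems(2)]
    by (intro Ck_family_sum Ck_family_bilinear[OF bounded_bilinear_scaleR]
        Ck_family_linear[OF bounded_linear_inner_left] assms(1,2) Suc.IH) auto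
  moreover have "jointly_cont X K (\<lambda>x p. \<phi> x (\<psi> x p))"
    using Suc.prems jointly_cont_compose_family[of X K' \<phi> K \<psi>] K' by auto
  ultimately show ?case using differentiableI[OF *] by auto
qed

lemma jointly_cont_reparam:
  assumes "jointly_cont Y K \<phi>" "continuous_map X Y h"
  shows "jointly_cont X K (\<lambda>x. \<phi> (h x))"
proof -
  have "continuous_map (prod_topology X (top_of_set K)) (prod_topology Y (top_of_set K))
      (\<lambda>z. (h (fst z), snd z))"
    using assms continuous_map_of_fst[of X "top_of_set K" Y h]
    by (intro continuous_map_pairedI continuous_map_snd) (auto simp: o_def)
  from continuous_map_compose[OF this assms(1)[unfolded jointly_cont_def]]
  show ?thesis by (simp add: jointly_cont_def o_def)
qed

lemma Ck_family_reparam: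
  assumes "continuous_map X Y h"
  shows "Ck_family k Y U K \<phi> \<Longrightarrow> Ck_family k X U K (\<lambda>x. \<phi> (h x))"
proof (induction k arbitrary: \<phi>)
  case (Suc k)
  have "h x \<in> topspace Y" if "x \<in> topspace X" for x
    using assms that by (auto simp: continuous_map_def)
  then show ?case
    using Suc.prems Suc.IH[of "\<lambda>y. dir_deriv _ (\<phi> y)"] jointly_cont_reparam[of Y K \<phi>] assms
    by auto
qed (use assms jointly_cont_reparam in auto)

lemma jointly_cont_subset:
  assumes "jointly_cont X K \<phi>" "K' \<subseteq> K"
  shows "jointly_cont X K' \<phi>"
proof (rule jointly_cont_compose_family[OF assms(1), where \<psi> = "\<lambda>x p. p"])
  show "jointly_cont X K' (\<lambda>x p. p)" by (intro jointly_cont_of_snd continuous_on_id)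
qed (use assms(2) in blast)

lemma Ck_family_subset:
  "Ck_family k X U K \<phi> \<Longrightarrow> U' \<subseteq> U \<Longrightarrow> K' \<subseteq> K \<Longrightarrow> Ck_family k X U' K' \<phi>"
  by (induction k arbitrary: \<phi>) (auto intro: jointly_cont_subset)

text \<open>\<open>iter_deriv\<close> takes the head of the list as its outermost derivative,
  whereas \<open>Ck_family\<close> peels off the innermost one; this exchange makes the two
  comparable.\<close>

lemma iter_deriv_append1: "iter_deriv (vs @ [v]) F = iter_deriv vs (dir_deriv v F)"
proof (induction vs)
  case Nil
  show ?case by (rule ext) (simp add: dir_deriv_def)
qed simp

lemma Ck_family_iff_iter_deriv:
  "Ck_family k X U K \<phi> \<longleftrightarrow>
    (\<forall>vs. length vs \<le> k \<longrightarrow> jointly_cont X K (\<lambda>x. iter_deriv vs (\<phi> x))) \<and>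
    (\<forall>vs. length vs < k \<longrightarrow> (\<forall>x\<in>topspace X. \<forall>p\<in>U. iter_deriv vs (\<phi> x) differentiable at p))"
proof (induction k arbitrary: \<phi>)
  case (Suc k)
  have all: "(\<forall>vs. Q vs) \<longleftrightarrow> Q [] \<and> (\<forall>v vs. Q (vs @ [v]))" for Q :: "'b list \<Rightarrow> bool"
    by (metis rev_exhaust)
  show ?case
    by (subst (1 2) all) (simp add: Suc.IH iter_deriv_append1 all_conj_distrib, blast)
qed simp

section \<open>Families that are smooth to all orders\<close>

definition smooth_family :: "'x topology \<Rightarrow> 'a::real_normed_vector set \<Rightarrow> 'a set \<Rightarrow>
    ('x \<Rightarrow> 'a \<Rightarrow> 'b::real_normed_vector) \<Rightarrow> bool"
  where "smooth_family X U K \<phi> \<longleftrightarrow> (\<forall>k. Ck_family k X U K \<phi>)"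

lemma smooth_family_iff_iter_deriv:
  fixes \<phi> :: "'x \<Rightarrow> 'a::real_normed_vector \<Rightarrow> 'b::real_normed_vector"
  shows
  "smooth_family X U K \<phi> \<longleftrightarrow>
    (\<forall>vs. jointly_cont X K (\<lambda>x. iter_deriv vs (\<phi> x)) \<and>
      (\<forall>x\<in>topspace X. \<forall>p\<in>U. iter_deriv vs (\<phi> x) differentiable at p))"
proof
  assume "smooth_family X U K \<phi>"
  then have *: "Ck_family (Suc (length vs)) X U K \<phi>" for vs :: "'a list"
    by (simp add: smooth_family_def)
  show "\<forall>vs. jointly_cont X K (\<lambda>x. iter_deriv vs (\<phi> x)) \<and>
      (\<forall>x\<in>topspace X. \<forall>p\<in>U. iter_deriv vs (\<phi> x) differentiable at p)"
  proof
    fix vs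
    show "jointly_cont X K (\<lambda>x. iter_deriv vs (\<phi> x)) \<and>
      (\<forall>x\<in>topspace X. \<forall>p\<in>U. iter_deriv vs (\<phi> x) differentiable at p)"
      using *[of vs, unfolded Ck_family_iff_iter_deriv] by simp
  qed
qed (simp add: smooth_family_def Ck_family_iff_iter_deriv)

lemma smooth_family_imp_smooth_on_open:
  assumes "smooth_family X U K \<phi>" "x \<in> topspace X"
  shows "smooth_on_open U (\<phi> x)"
  using assms unfolding smooth_family_iff_iter_deriv smooth_on_open_def by blast

lemma smooth_on_open_iter_deriv_continuous_on:
  assumes "smooth_on_open U F" "K \<subseteq> U"
  shows "continuous_on K (iter_deriv vs F)"
proof -
  have "iter_deriv vs F differentiable at x within K" if "x \<in> K" for x
    using assms that unfolding smooth_on_open_def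
    by (blast intro: differentiable_at_withinI)
  then show ?thesis
    by (intro differentiable_imp_continuous_on) (simp add: differentiable_on_def)
qed

text \<open>A single smooth map is a constant family, so the closure rules for families also prove
  smoothness of single maps. The parameter space is then a dummy such as
  \<open>top_of_set {0::real}\<close>.\<close>

lemma smooth_on_open_imp_smooth_family:
  assumes "smooth_on_open U F" "K \<subseteq> U"
  shows "smooth_family X U K (\<lambda>_. F)"
  unfolding smooth_family_iff_iter_deriv
  using jointly_cont_of_snd[OF smooth_on_open_iter_deriv_continuous_on[OF assms]] assms(1)
  unfolding smooth_on_open_def by blast

lemma smooth_family_cong:
  assumes "open U" "K \<subseteq> U" "\<And>x p. x \<in> topspace X \<Longrightarrow> p \<in> U \<Longrightarrow> \<phi> x p = \<psi> x p"
  shows "smooth_family X U K \<phi> \<longleftrightarrow> smooth_family X U K \<psi>"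
  unfolding smooth_family_def using Ck_family_cong[OF assms(1,2)] assms(3) by metis

lemma smooth_family_compose:
  fixes \<phi> :: "'x \<Rightarrow> 'b::euclidean_space \<Rightarrow> 'c::real_normed_vector"
    and \<psi> :: "'x \<Rightarrow> 'a::real_normed_vector \<Rightarrow> 'b"
  assumes "smooth_family X U' K' \<phi>" "smooth_family X U K \<psi>" "open U" "K \<subseteq> U"
    and "\<And>x p. x \<in> topspace X \<Longrightarrow> p \<in> U \<Longrightarrow> \<psi> x p \<in> U'"
    and "\<And>x p. x \<in> topspace X \<Longrightarrow> p \<in> K \<Longrightarrow> \<psi> x p \<in> K'"
  shows "smooth_family X U K (\<lambda>x p. \<phi> x (\<psi> x p))"
  unfolding smooth_family_def
proof
  fix k
  show "Ck_family k X U K (\<lambda>x p. \<phi> x (\<psi> x p))"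
    by (rule Ck_family_compose[OF assms(3,4), where \<psi> = \<psi> and \<phi> = \<phi> and U' = U' and K' = K'])
      (use assms in \<open>auto simp: smooth_family_def\<close>)
qed

lemma smooth_family_bilinear:
  assumes "bounded_bilinear B" "open U" "K \<subseteq> U" "smooth_family X U K \<phi>" "smooth_family X U K \<psi>"
  shows "smooth_family X U K (\<lambda>x p. B (\<phi> x p) (\<psi> x p))"
  using assms(4,5) Ck_family_bilinear[OF assms(1-3)] unfolding smooth_family_def by blast

lemma smooth_family_linear:
  assumes "bounded_linear h" "open U" "K \<subseteq> U" "smooth_family X U K \<phi>"
  shows "smooth_family X U K (\<lambda>x p. h (\<phi> x p))"
  using assms(4) Ck_family_linear[OF assms(1-3)] unfolding smooth_family_def by blast

lemma smooth_family_linear_snd: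
  assumes "bounded_linear h" "open U" "K \<subseteq> U"
  shows "smooth_family X U K (\<lambda>x. h)"
  using Ck_family_linear_snd[OF assms] unfolding smooth_family_def by blast

lemma smooth_family_of_fst:
  fixes c :: "'x \<Rightarrow> 'b::real_normed_vector"
  assumes "open U" "K \<subseteq> U" "continuous_map X euclidean c"
  shows "smooth_family X U K (\<lambda>x p. c x)"
  using Ck_family_of_fst[OF assms] unfolding smooth_family_def by blast

lemma smooth_family_diff:
  assumes "open U" "K \<subseteq> U" "smooth_family X U K \<phi>" "smooth_family X U K \<psi>"
  shows "smooth_family X U K (\<lambda>x p. \<phi> x p - \<psi> x p)"
proof -
  have "smooth_family X U K (\<lambda>x p. - \<psi> x p)"
    by (rule smooth_family_linear[OF bounded_linear_minus[OF bounded_linear_ident] assms(1,2,4)])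
  then have "smooth_family X U K (\<lambda>x p. \<phi> x p + - \<psi> x p)"
    using Ck_family_add[OF assms(1,2)] assms(3) unfolding smooth_family_def by blast
  then show ?thesis by simp
qed

lemma smooth_family_add:
  assumes "open U" "K \<subseteq> U" "smooth_family X U K \<phi>" "smooth_family X U K \<psi>"
  shows "smooth_family X U K (\<lambda>x p. \<phi> x p + \<psi> x p)"
  using assms(3,4) Ck_family_add[OF assms(1,2)] unfolding smooth_family_def by blast

lemma smooth_family_norm:
  fixes \<phi> :: "'x \<Rightarrow> 'a::real_normed_vector \<Rightarrow> 'b::real_inner"
  assumes "open U" "K \<subseteq> U" "smooth_family X U K \<phi>"
    and "\<And>x p. x \<in> topspace X \<Longrightarrow> p \<in> U \<Longrightarrow> \<phi> x p \<noteq> 0"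
  shows "smooth_family X U K (\<lambda>x p. norm (\<phi> x p))"
proof -
  have "smooth_family X U K (\<lambda>x p. \<phi> x p \<bullet> \<phi> x p)"
    by (rule smooth_family_bilinear[OF bounded_bilinear_inner assms(1,2,3,3)])
  then have "smooth_family X U K (\<lambda>x p. sqrt (\<phi> x p \<bullet> \<phi> x p))"
    unfolding smooth_family_def using assms(4)
    by (intro allI Ck_family_sqrt assms(1,2)) auto
  then show ?thesis by (simp add: norm_eq_sqrt_inner)
qed

lemma smooth_family_normalize:
  fixes \<phi> :: "'x \<Rightarrow> 'a::real_normed_vector \<Rightarrow> 'b::real_inner"
  assumes "open U" "K \<subseteq> U" "smooth_family X U K \<phi>"
    and "\<And>x p. x \<in> topspace X \<Longrightarrow> p \<in> U \<Longrightarrow> \<phi> x p \<noteq> 0"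
  shows "smooth_family X U K (\<lambda>x p. \<phi> x p /\<^sub>R norm (\<phi> x p))"
proof -
  have "smooth_family X U K (\<lambda>x p. inverse (norm (\<phi> x p)))"
    unfolding smooth_family_def using smooth_family_norm[OF assms] assms(4)
    by (intro allI Ck_family_inverse assms(1,2)) (auto simp: smooth_family_def)
  from smooth_family_bilinear[OF bounded_bilinear_scaleR assms(1,2) this assms(3)]
  show ?thesis .
qed

lemma smooth_family_reparam:
  assumes "smooth_family Y U K \<phi>" "continuous_map X Y h"
  shows "smooth_family X U K (\<lambda>x. \<phi> (h x))"
  using assms Ck_family_reparam unfolding smooth_family_def by blast

lemma smooth_family_subset:
  assumes "smooth_family X U K \<phi>" "U' \<subseteq> U" "K' \<subseteq> K"
  shows "smooth_family X U' K' \<phi>"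
  using assms Ck_family_subset unfolding smooth_family_def by blast

section \<open>The equator and the smooth topology\<close>

definition horizontal :: "'n pt \<Rightarrow> ('n::{finite,wellorder}) pt"
  where "horizontal p = p - (p \<bullet> e_last) *\<^sub>R e_last"

text \<open>The complement of the line spanned by \<open>e_last\<close>: the open set on which
  \<open>tau\<close> is smooth and to which maps of the equator are extended.\<close>

definition off_axis :: "(('n::{finite,wellorder}) pt) set"
  where "off_axis = {p. horizontal p \<noteq> 0}"

lemma e_last_inner_self [simp]: "e_last \<bullet> e_last = 1"
  by (simp add: e_last_def inner_axis_axis)

lemma norm_e_last [simp]: "norm e_last = 1"
  by (simp add: e_last_def)

lemma e_last_nonzero [simp]: "e_last \<noteq> 0"
  by (metis norm_e_last norm_zero zero_neq_one)

lemma tau_horizontal: "tau p = horizontal p /\<^sub>R norm (horizontal p)"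
  by (simp add: tau_def horizontal_def)

lemma bounded_linear_horizontal: "bounded_linear horizontal"
  unfolding horizontal_def[abs_def] 
  by (intro bounded_linear_sub bounded_linear_ident bounded_linear_scaleR_const bounded_linear_inner_left)

lemma horizontal_inner_e_last [simp]: "horizontal p \<bullet> e_last = 0"
  by (simp add: horizontal_def inner_diff_left)

lemma open_off_axis [simp]: "open off_axis"
proof -
  have "open (horizontal -` (- {0}))"
    by (intro open_vimage linear_continuous_on bounded_linear_horizontal) auto
  then show ?thesis by (simp add: off_axis_def vimage_def)
qed

lemma equatorD: "p \<in> equator \<Longrightarrow> norm p = 1" "p \<in> equator \<Longrightarrow> p \<bullet> p = 1"
  "p \<in> equator \<Longrightarrow> p \<bullet> e_last = 0" "p \<in> equator \<Longrightarrow> e_last \<bullet> p = 0"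
  by (auto simp: equator_def inner_commute norm_eq_1)

lemma horizontal_equator: "p \<in> equator \<Longrightarrow> horizontal p = p"
  by (simp add: horizontal_def equatorD)

lemma equator_subset_off_axis: "equator \<subseteq> off_axis"
  using equatorD(1) by (fastforce simp: off_axis_def horizontal_equator)

lemma tau_equator: "p \<in> equator \<Longrightarrow> tau p = p"
  by (simp add: tau_horizontal horizontal_equator equatorD)

lemma tau_in_equator: "p \<in> off_axis \<Longrightarrow> tau p \<in> equator"
  by (simp add: equator_def tau_horizontal off_axis_def)

lemma compact_equator: "compact (equator :: (('n::{finite,wellorder}) pt) set)"
proof -
  have "(equator :: ('n pt) set) = sphere 0 1 \<inter> {x. e_last \<bullet> x = 0}"
    by (auto simp: equator_def inner_commute)
  also have "compact \<dots>" by (intro compact_Int_closed compact_sphere closed_hyperplane)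
  finally show ?thesis .
qed

lemma smooth_family_tau: "K \<subseteq> off_axis \<Longrightarrow> smooth_family X off_axis K (\<lambda>_. tau)"
  unfolding tau_horizontal[abs_def]
  by (intro smooth_family_normalize smooth_family_linear_snd bounded_linear_horizontal open_off_axis)
    (auto simp: off_axis_def)

lemma continuous_on_tau: "continuous_on off_axis tau"
  using bounded_linear_horizontal unfolding tau_horizontal[abs_def]
  by (intro continuous_intros linear_continuous_on) (auto simp: off_axis_def)

lemma iter_deriv_cong_open:
  assumes "open U" "\<And>y. y \<in> U \<Longrightarrow> F y = G y" "x \<in> U"
  shows "iter_deriv vs F x = iter_deriv vs G x"
  using assms(3)
proof (induction vs arbitrary: x)
  case (Cons v vs)
  then show ?case
    using dir_deriv_cong_open[OF assms(1) Cons.prems, of "iter_deriv vs F" "iter_deriv vs G" v]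
    by (simp add: dir_deriv_def)
qed (simp add: assms(2))

text \<open>The retraction replaces the unspecified local extensions by the single extension
  \<open>f \<circ> tau\<close>: any local extension, composed with \<open>tau\<close>, agrees with
  it.\<close>

lemma smooth_map_on_equator_iff:
  fixes f :: "('n::{finite,wellorder}) pt \<Rightarrow> 'b::euclidean_space"
  shows "smooth_map_on equator f \<longleftrightarrow> smooth_on_open off_axis (f \<circ> tau)"
proof
  assume L: "smooth_map_on equator f"
  show "smooth_on_open off_axis (f \<circ> tau)"
    unfolding smooth_on_open_def
  proof (intro allI ballI)
    fix vs and x :: "'n pt" assume x: "x \<in> off_axis"
    obtain U F where U: "open U" "tau x \<in> U" "smooth_on_open U F" "\<forall>y\<in>U \<inter> equator. F y = f y"
      using L tau_in_equator[OF x] unfolding smooth_map_on_def by metis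
    \<comment> \<open>On this neighbourhood \<open>tau\<close> takes values in \<open>U\<close>,
      where the local extension is smooth.\<close>
    define V where "V = off_axis \<inter> tau -` U"
    have V: "open V" "x \<in> V" "V \<subseteq> off_axis"
      using continuous_open_preimage[OF continuous_on_tau open_off_axis U(1)] U(2) x
      by (auto simp: V_def)
    have "smooth_family euclideanreal V V (\<lambda>_ p. F (tau p))"
      by (rule smooth_family_compose[OF smooth_on_open_imp_smooth_family[OF U(3) order_refl]
          smooth_family_subset[OF smooth_family_tau[OF order_refl]]]) (use V in \<open>auto simp: V_def\<close>)
    then have "smooth_on_open V (\<lambda>p. F (tau p))"
      by (rule smooth_family_imp_smooth_on_open[of _ _ _ _ 0]) simp
    then have D: "iter_deriv vs (\<lambda>p. F (tau p)) differentiable at x"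
      using V by (simp add: smooth_on_open_def)
    have eq: "F (tau y) = (f \<circ> tau) y" if "y \<in> V" for y
    proof -
      have "tau y \<in> U \<inter> equator" using that V(3) tau_in_equator[of y] by (auto simp: V_def)
      then show ?thesis using U(4) by simp
    qed
    have "iter_deriv vs (\<lambda>p. F (tau p)) y = iter_deriv vs (f \<circ> tau) y" if "y \<in> V" for y
      by (rule iter_deriv_cong_open[OF V(1) _ that]) (rule eq)
    then have "iter_deriv vs (\<lambda>p. F (tau p)) differentiable at x \<longleftrightarrow>
        iter_deriv vs (f \<circ> tau) differentiable at x"
      by (rule differentiable_cong_open[OF V(1,2)])
    then show "iter_deriv vs (f \<circ> tau) differentiable at x" using D by simp
  qed
next
  assume R: "smooth_on_open off_axis (f \<circ> tau)"
  show "smooth_map_on equator f"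
    unfolding smooth_map_on_def
  proof (intro ballI exI conjI)
    show "smooth_on_open off_axis (f \<circ> tau)" by (rule R)
  qed (auto simp: tau_equator intro: subsetD[OF equator_subset_off_axis])
qed

lemma smooth_maps_iff:
  "f \<in> smooth_maps Y \<longleftrightarrow> f \<in> equator \<rightarrow>\<^sub>E Y \<and> smooth_on_open off_axis (f \<circ> tau)"
  by (simp add: smooth_maps_def smooth_map_on_equator_iff)

lemma openin_smooth_topology_ball:
  assumes "f \<in> smooth_maps Y" "e > 0"
  shows "openin (smooth_topology Y) {h \<in> smooth_maps Y. \<forall>x\<in>equator.
    norm (iter_deriv vs (h \<circ> tau) x - iter_deriv vs (f \<circ> tau) x) < e}"
  unfolding smooth_topology_def by (rule topology_generated_by_Basis) (use assms in blast)

lemma topspace_smooth_topology [simp]: "topspace (smooth_topology Y) = smooth_maps Y"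
proof -
  have "openin (smooth_topology Y) {h \<in> smooth_maps Y. \<forall>x\<in>equator.
      norm (iter_deriv [] (h \<circ> tau) x - iter_deriv [] (f \<circ> tau) x) < 1}" if "f \<in> smooth_maps Y" for f
    by (rule openin_smooth_topology_ball[OF that]) simp
  note subsetD[OF openin_subset[OF this], simplified]
  then have "f \<in> topspace (smooth_topology Y)" if "f \<in> smooth_maps Y" for f
    using that by simp
  then show ?thesis
    unfolding smooth_topology_def topology_generated_by_topspace by auto
qed

section \<open>Continuity into and out of the smooth topology\<close>

lemma continuous_map_to_real_normedI:
  fixes f :: "'x \<Rightarrow> 'b::real_normed_vector"
  assumes "\<And>x e. x \<in> topspace X \<Longrightarrow> e > 0 \<Longrightarrow>
    \<exists>W. openin X W \<and> x \<in> W \<and> (\<forall>y\<in>W. norm (f y - f x) < e)"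
  shows "continuous_map X euclidean f"
  unfolding continuous_map_def
proof (intro conjI allI impI)
  fix U :: "'b set" assume "openin euclidean U"
  then have U: "open U" by simp
  show "openin X {x \<in> topspace X. f x \<in> U}"
  proof (subst openin_subopen, intro ballI)
    fix x assume "x \<in> {x \<in> topspace X. f x \<in> U}"
    then obtain e where e: "e > 0" "ball (f x) e \<subseteq> U" and x: "x \<in> topspace X"
      using U open_contains_ball by blast
    from assms[OF x e(1)] obtain W where "openin X W" "x \<in> W" "\<forall>y\<in>W. norm (f y - f x) < e"
      by blast
    then show "\<exists>T. openin X T \<and> x \<in> T \<and> T \<subseteq> {x \<in> topspace X. f x \<in> U}"
      using e(2) openin_subset[of X W]
      by (intro exI[of _ W]) (auto simp: dist_norm norm_minus_commute subset_iff)
  qed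
qed auto

lemma continuous_map_to_real_normedD:
  fixes f :: "'x \<Rightarrow> 'b::real_normed_vector"
  assumes "continuous_map X euclidean f" "x \<in> topspace X" "e > 0"
  shows "\<exists>W. openin X W \<and> x \<in> W \<and> (\<forall>y\<in>W. norm (f y - f x) < e)"
proof (intro exI conjI ballI)
  show "openin X {y \<in> topspace X. f y \<in> ball (f x) e}"
    using assms(1) unfolding continuous_map_def by auto
qed (use assms in \<open>auto simp: dist_norm norm_minus_commute\<close>)

text \<open>The tautological family: all derivatives of \<open>f \<circ> tau\<close> depend
  continuously on the pair of map and point. The topology gives this on the equator, and idempotence
  of \<open>tau\<close> carries it to all of \<open>off_axis\<close>.\<close>

lemma smooth_family_smooth_topology:
  fixes Y :: "(('n::{finite,wellorder}) pt) set"
  shows "smooth_family (smooth_topology Y) off_axis off_axis (\<lambda>f. f \<circ> tau)"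
proof -
  have "jointly_cont (smooth_topology Y) equator (\<lambda>f. iter_deriv vs (f \<circ> tau))" for vs
    unfolding jointly_cont_def
  proof (rule continuous_map_to_real_normedI)
    fix z :: "('n pt \<Rightarrow> 'n pt) \<times> 'n pt" and e :: real
    assume "z \<in> topspace (prod_topology (smooth_topology Y) (top_of_set equator))" "e > 0"
    then obtain f p where z: "z = (f, p)" "f \<in> smooth_maps Y" "p \<in> equator" by auto
    define F where "F = iter_deriv vs (f \<circ> tau)"
    have "continuous_on off_axis F"
      using z(2) smooth_on_open_iter_deriv_continuous_on[OF _ order_refl]
      unfolding F_def smooth_maps_iff by blast
    then have "isCont F p"
      using z equator_subset_off_axis continuous_on_eq_continuous_at[OF open_off_axis] by blast
    \<comment> \<open>Half of \<open>e\<close> pays for moving the point, the other half for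
      changing the map, which is controlled uniformly over the equator.\<close>
    then obtain d where d: "d > 0" "\<And>q. dist q p < d \<Longrightarrow> dist (F q) (F p) < e / 2"
      using \<open>e > 0\<close> unfolding continuous_at_eps_delta by (metis half_gt_zero)
    define B where "B = {h \<in> smooth_maps Y. \<forall>x\<in>equator. norm (iter_deriv vs (h \<circ> tau) x - F x) < e / 2}"
    have "openin (smooth_topology Y) B"
      unfolding B_def F_def using openin_smooth_topology_ball[OF z(2), of "e / 2" vs] \<open>e > 0\<close> by simp
    moreover have "openin (top_of_set equator) (equator \<inter> ball p d)"
      by (simp add: openin_open_Int)
    ultimately have "openin (prod_topology (smooth_topology Y) (top_of_set equator))
        (B \<times> (equator \<inter> ball p d))"
      by (simp add: openin_prod_Times_iff)
    moreover have "z \<in> B \<times> (equator \<inter> ball p d)"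
      using z d(1) \<open>e > 0\<close> by (auto simp: B_def F_def)
    moreover have "norm (iter_deriv vs (fst w \<circ> tau) (snd w) - iter_deriv vs (fst z \<circ> tau) (snd z)) < e"
      if w: "w \<in> B \<times> (equator \<inter> ball p d)" for w
    proof -
      have "norm (iter_deriv vs (fst w \<circ> tau) (snd w) - F (snd w)) < e / 2"
        using w by (auto simp: B_def)
      moreover have "norm (F (snd w) - F p) < e / 2"
        using d(2)[of "snd w"] w by (auto simp: dist_norm norm_minus_commute)
      ultimately show ?thesis
        unfolding z(1) fst_conv snd_conv F_def[symmetric] by norm
    qed
    ultimately show "\<exists>W. openin (prod_topology (smooth_topology Y) (top_of_set equator)) W \<and> z \<in> W \<and>
        (\<forall>w\<in>W. norm (iter_deriv vs (fst w \<circ> tau) (snd w) - iter_deriv vs (fst z \<circ> tau) (snd z)) < e)"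
      by blast
  qed
  then have eq: "smooth_family (smooth_topology Y) off_axis equator (\<lambda>f. f \<circ> tau)"
    unfolding smooth_family_iff_iter_deriv by (auto simp: smooth_maps_iff smooth_on_open_def)
  have "smooth_family (smooth_topology Y) off_axis off_axis (\<lambda>f p. (f \<circ> tau) (tau p))"
    by (rule smooth_family_compose[OF eq smooth_family_tau[OF order_refl]])
      (auto simp: tau_in_equator intro: subsetD[OF equator_subset_off_axis])
  moreover have "(f \<circ> tau) (tau p) = (f \<circ> tau) p" if "p \<in> off_axis" for f :: "'n pt \<Rightarrow> 'n pt" and p
    using that by (simp add: tau_equator tau_in_equator)
  ultimately show ?thesis
    using smooth_family_cong[OF open_off_axis order_refl, of "smooth_topology Y"
        "\<lambda>f p. (f \<circ> tau) (tau p)" "\<lambda>f. f \<circ> tau"] by simp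
qed

lemma tube_pointwise:
  assumes "compactin Y K" "openin (prod_topology X (subtopology Y K)) W" "x \<in> topspace X" "{x} \<times> K \<subseteq> W"
  obtains V where "openin X V" "x \<in> V" "V \<times> K \<subseteq> W"
proof -
  have "compactin (subtopology Y K) K" using assms(1) by (simp add: compactin_subtopology)
  from tube_lemma_right[OF assms(2) this assms(3,4)] show ?thesis using that by blast
qed

text \<open>The pairs that satisfy the strict bound form an open set containing {x} x K, so by the
  tube lemma it contains some V x K.\<close>

lemma jointly_cont_uniform:
  fixes \<phi> :: "'x \<Rightarrow> 'a::topological_space \<Rightarrow> 'b::real_normed_vector"
  assumes "jointly_cont X K \<phi>" "compact K" "x \<in> topspace X" "continuous_on K h"
    and "\<And>p. p \<in> K \<Longrightarrow> norm (\<phi> x p - h p) < e"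
  obtains V where "openin X V" "x \<in> V" "\<And>y p. y \<in> V \<Longrightarrow> p \<in> K \<Longrightarrow> norm (\<phi> y p - h p) < e"
proof -
  let ?Z = "prod_topology X (top_of_set K)"
  have "jointly_cont X K (\<lambda>x. h)" by (rule jointly_cont_of_snd[OF assms(4)])
  then have "continuous_map ?Z euclidean (\<lambda>z. norm (\<phi> (fst z) (snd z) - h (snd z)))"
    using assms(1) unfolding jointly_cont_def
    by (intro continuous_map_norm continuous_map_diff)
  from openin_continuous_map_preimage[OF this, of "{..<e}"]
  have "openin ?Z {z \<in> topspace ?Z. norm (\<phi> (fst z) (snd z) - h (snd z)) \<in> {..<e}}"
    by simp
  moreover have "{x} \<times> K \<subseteq> {z \<in> topspace ?Z. norm (\<phi> (fst z) (snd z) - h (snd z)) \<in> {..<e}}"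
    using assms(3,5) by auto
  ultimately obtain V where V: "openin X V" "x \<in> V"
    "V \<times> K \<subseteq> {z \<in> topspace ?Z. norm (\<phi> (fst z) (snd z) - h (snd z)) \<in> {..<e}}"
    using tube_pointwise[of euclidean K X _ x] assms(2,3) by (metis (no_types, lifting) compactin_euclidean_iff)
  show ?thesis
  proof (rule that[OF V(1,2)])
    fix y p assume "y \<in> V" "p \<in> K"
    then have "(y, p) \<in> V \<times> K" by simp
    then show "norm (\<phi> y p - h p) < e" using V(3) by auto
  qed
qed

text \<open>A generator of the topology bounds one derivative uniformly on the equator, around an
  arbitrary map \<open>f\<close>; compactness makes each such bound an open condition on the
  parameter.\<close>

lemma continuous_map_smooth_topologyI:
  fixes Y :: "(('n::{finite,wellorder}) pt) set"
  assumes F: "\<And>x. x \<in> topspace X \<Longrightarrow> F x \<in> smooth_maps Y"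
    and sm: "smooth_family X off_axis equator (\<lambda>x. F x \<circ> tau)"
  shows "continuous_map X (smooth_topology Y) F"
  unfolding smooth_topology_def
proof (rule continuous_on_generated_topo)
  fix U
  assume "U \<in> {{h \<in> smooth_maps Y. \<forall>x\<in>equator.
      norm (iter_deriv vs (h \<circ> tau) x - iter_deriv vs (f \<circ> tau) x) < e} | f vs e.
    f \<in> smooth_maps Y \<and> (e::real) > 0}"
  then obtain f vs e where U: "U = {h \<in> smooth_maps Y. \<forall>x\<in>equator.
      norm (iter_deriv vs (h \<circ> tau) x - iter_deriv vs (f \<circ> tau) x) < e}"
    and f: "f \<in> smooth_maps Y" and e: "e > 0" by blast
  have cont: "continuous_on equator (iter_deriv vs (f \<circ> tau))"
    using f smooth_on_open_iter_deriv_continuous_on[OF _ equator_subset_off_axis]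
    unfolding smooth_maps_iff by blast
  have jc: "jointly_cont X equator (\<lambda>x. iter_deriv vs (F x \<circ> tau))"
    using sm unfolding smooth_family_iff_iter_deriv by blast
  show "openin X (F -` U \<inter> topspace X)"
  proof (subst openin_subopen, intro ballI)
    fix x assume x: "x \<in> F -` U \<inter> topspace X"
    then have xX: "x \<in> topspace X" and near: "\<And>p. p \<in> equator \<Longrightarrow>
        norm (iter_deriv vs (F x \<circ> tau) p - iter_deriv vs (f \<circ> tau) p) < e"
      by (auto simp: U)
    obtain V where V: "openin X V" "x \<in> V"
      "\<And>y p. y \<in> V \<Longrightarrow> p \<in> equator \<Longrightarrow>
        norm (iter_deriv vs (F y \<circ> tau) p - iter_deriv vs (f \<circ> tau) p) < e"
      using jointly_cont_uniform[OF jc compact_equator xX cont near] by blast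
    have "V \<subseteq> F -` U \<inter> topspace X"
      using V(3) openin_subset[OF V(1)] F by (auto simp: U)
    then show "\<exists>T. openin X T \<and> x \<in> T \<and> T \<subseteq> F -` U \<inter> topspace X" using V by blast
  qed
next
  show "F ` topspace X \<subseteq> \<Union> {{h \<in> smooth_maps Y. \<forall>x\<in>equator.
      norm (iter_deriv vs (h \<circ> tau) x - iter_deriv vs (f \<circ> tau) x) < e} | f vs e.
    f \<in> smooth_maps Y \<and> (e::real) > 0}"
    unfolding topology_generated_by_topspace[symmetric] smooth_topology_def[symmetric]
    using F by auto
qed

section \<open>Frames and orientations\<close>

definition index_of :: "'n::{finite,wellorder} \<Rightarrow> nat"
  where "index_of i = card {j. j < i}"

definition rows_mat :: "(('n::{finite,wellorder}) pt) list \<Rightarrow> 'n mat"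
  where "rows_mat vs = (\<chi> i. vs ! index_of i)"

lemma pos_oriented_iff:
  fixes vs :: "(('n::{finite,wellorder}) pt) list"
  shows "pos_oriented vs \<longleftrightarrow> length vs = CARD('n) \<and> det (rows_mat vs) > 0"
  by (simp add: pos_oriented_def rows_mat_def index_of_def)

lemma index_of_strict_mono: "i < j \<Longrightarrow> index_of i < index_of j"
  unfolding index_of_def by (rule psubset_card_mono) auto

lemma inj_index_of: "inj index_of"
  by (rule injI) (metis index_of_strict_mono less_irrefl linorder_neq_iff)

lemma bij_index_of: "bij_betw index_of (UNIV :: ('n::{finite,wellorder}) set) {..<CARD('n)}"
proof -
  have "index_of i < CARD('n)" for i :: 'n
    unfolding index_of_def by (rule psubset_card_mono) auto
  then have "index_of ` (UNIV :: 'n set) \<subseteq> {..<CARD('n)}" by auto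
  moreover have "card (index_of ` (UNIV :: 'n set)) = card {..<CARD('n)}"
    using card_image[OF inj_index_of] by auto
  ultimately have "index_of ` (UNIV :: 'n set) = {..<CARD('n)}"
    by (intro card_subset_eq) auto
  then show ?thesis by (simp add: bij_betw_def inj_index_of)
qed

lemma index_of_less: "index_of (i :: 'n::{finite,wellorder}) < CARD('n)"
  using bij_betwE[OF bij_index_of] by blast

lemma index_of_surj:
  assumes "k < CARD('n::{finite,wellorder})"
  obtains i :: "'n::{finite,wellorder}" where "index_of i = k"
proof -
  have "k \<in> index_of ` (UNIV :: 'n set)"
    using bij_index_of[where 'n='n] assms unfolding bij_betw_def by simp
  then show ?thesis using that by blast
qed

lemma rows_mat_map:
  fixes vs :: "(('n::{finite,wellorder}) pt) list"
  assumes "linear L" "length vs = CARD('n)"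
  shows "rows_mat (map L vs) = rows_mat vs ** transpose (matrix L)"
proof -
  have "rows_mat (map L vs) $ i = (rows_mat vs ** transpose (matrix L)) $ i" for i
  proof -
    have "rows_mat (map L vs) $ i = matrix L *v (vs ! index_of i)"
      using assms index_of_less[of i] by (simp add: rows_mat_def matrix_works)
    then show ?thesis
      by (simp add: vec_eq_iff rows_mat_def matrix_matrix_mult_def matrix_vector_mult_def
          transpose_def mult.commute)
  qed
  then show ?thesis by (simp add: vec_eq_iff)
qed

lemma det_rows_mat_map:
  fixes vs :: "(('n::{finite,wellorder}) pt) list"
  assumes "linear L" "length vs = CARD('n)"
  shows "det (rows_mat (map L vs)) = det (matrix L) * det (rows_mat vs)"
  by (simp add: rows_mat_map[OF assms] det_mul)

text \<open>The origin of the minus signs: frames of the sphere list the normal before the position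
  vector, while images of frames of the equator list the position vector first.\<close>

lemma det_rows_mat_swap:
  fixes us :: "(('n::{finite,wellorder}) pt) list"
  assumes "length us + 2 = CARD('n)"
  shows "det (rows_mat (us @ [a, b])) = - det (rows_mat (us @ [b, a]))"
proof -
  have "length us < CARD('n)" "length us + 1 < CARD('n)" using assms by auto
  then obtain i j :: 'n where i: "index_of i = length us" and j: "index_of j = length us + 1"
    using index_of_surj[where 'n = 'n] by metis
  have ij: "i \<noteq> j" using i j by auto
  have "rows_mat (us @ [a, b]) $ k = rows_mat (us @ [b, a]) $ Transposition.transpose i j k" for k
  proof (cases "k = i \<or> k = j")
    case True
    then show ?thesis using ij i j by (auto simp: rows_mat_def nth_append)
  next
    case False
    then have "index_of k \<noteq> index_of i" "index_of k \<noteq> index_of j"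
      using inj_index_of by (auto dest: injD)
    then have "index_of k < length us" using index_of_less[of k] i j assms by linarith
    then show ?thesis using False by (simp add: rows_mat_def nth_append)
  qed
  then have "rows_mat (us @ [a, b]) = (\<chi> k. rows_mat (us @ [b, a]) $ Transposition.transpose i j k)"
    by (simp add: vec_eq_iff)
  also have "det \<dots> = of_int (sign (Transposition.transpose i j)) * det (rows_mat (us @ [b, a]))"
    by (rule det_permute_rows) (rule permutes_swap_id, auto)
  finally show ?thesis using ij by (simp add: sign_swap_id)
qed

text \<open>Serves to correct the orientation of an orthonormal frame without losing
  orthonormality.\<close>

lemma det_rows_mat_negate_hd:
  fixes us :: "(('n::{finite,wellorder}) pt) list"
  shows "det (rows_mat ((- u) # us)) = - det (rows_mat (u # us))"
proof -
  obtain i :: 'n where i: "index_of i = 0"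
    using index_of_surj[of 0] by (metis zero_less_card_finite)
  have *: "index_of k = 0 \<longleftrightarrow> k = i" for k using i inj_index_of by (metis injD)
  have "rows_mat ((- u) # us) = (\<chi> k. if k = i then (-1) *s u else rows_mat (u # us) $ k)"
    "rows_mat (u # us) = (\<chi> k. if k = i then u else rows_mat (u # us) $ k)"
    using * by (auto simp: vec_eq_iff rows_mat_def nth_Cons' i)
  then show ?thesis using det_row_mul[of i "-1" "\<lambda>_. u" "\<lambda>k. rows_mat (u # us) $ k"] by simp
qed

lemma rows_mat_kernel:
  fixes vs :: "(('n::{finite,wellorder}) pt) list"
  assumes "length vs = CARD('n)" "det (rows_mat vs) \<noteq> 0" "\<And>v. v \<in> set vs \<Longrightarrow> v \<bullet> z = 0"
  shows "z = 0"
proof -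
  have "rows_mat vs *v z = 0"
    using assms(1,3) by (simp add: vec_eq_iff matrix_vector_mul_component rows_mat_def index_of_less)
  moreover have "inj ((*v) (rows_mat vs))"
    using assms(2) by (metis inj_matrix_vector_mult invertible_det_nz)
  ultimately show ?thesis by (metis injD matrix_vector_mult_0_right)
qed

lemma det_orthonormal_list:
  fixes vs :: "(('n::{finite,wellorder}) pt) list"
  assumes "length vs = CARD('n)" "orthonormal_list vs"
  shows "det (rows_mat vs) \<noteq> 0"
proof -
  have "vs ! index_of i \<bullet> vs ! index_of j = (if i = j then 1 else 0)" for i j :: 'n
    using assms(2) index_of_less[of i] index_of_less[of j] inj_eq[OF inj_index_of, of i j]
    by (simp add: orthonormal_list_def assms(1))
  then have "rows_mat vs ** transpose (rows_mat vs) = mat 1"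
    by (simp add: vec_eq_iff matrix_matrix_mult_def transpose_def rows_mat_def mat_def inner_vec_def)
  then have "det (rows_mat vs) * det (rows_mat vs) = 1"
    by (metis det_I det_mul det_transpose)
  then show ?thesis by auto
qed

lemma orthonormal_list_append1:
  "orthonormal_list (vs @ [v]) \<longleftrightarrow> orthonormal_list vs \<and> norm v = 1 \<and> (\<forall>w\<in>set vs. w \<bullet> v = 0)"
  unfolding orthonormal_list_def norm_eq_1
  by (auto simp: nth_append all_set_conv_all_nth less_Suc_eq inner_commute)

lemma orthonormal_list_negate_hd:
  assumes "orthonormal_list (v # vs)"
  shows "orthonormal_list ((- v) # vs)"
  unfolding orthonormal_list_def
proof (intro allI impI)
  fix i j assume ij: "i < length ((- v) # vs)" "j < length ((- v) # vs)"
  define c :: "nat \<Rightarrow> real" where "c k = (if k = 0 then -1 else 1)" for k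
  have "((- v) # vs) ! k = c k *\<^sub>R ((v # vs) ! k)" for k by (simp add: c_def nth_Cons')
  then show "((- v) # vs) ! i \<bullet> ((- v) # vs) ! j = (if i = j then 1 else 0)"
    using assms ij unfolding orthonormal_list_def by (simp add: c_def)
qed

lemma orthonormal_listI_pairwise:
  assumes "distinct vs" "pairwise orthogonal (set vs)" "\<And>v. v \<in> set vs \<Longrightarrow> norm v = 1"
  shows "orthonormal_list vs"
  unfolding orthonormal_list_def
proof (intro allI impI)
  fix i j assume "i < length vs" "j < length vs"
  then show "vs ! i \<bullet> vs ! j = (if i = j then 1 else 0)"
    using assms by (auto simp: pairwise_def orthogonal_def nth_eq_iff_index_eq norm_eq_1)
qed

section \<open>Signs of determinants and the generalized cross product\<close>

lemma continuous_on_det: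
  fixes A :: "'a::topological_space \<Rightarrow> real^'n^'n"
  assumes "\<And>i j. continuous_on S (\<lambda>x. A x $ i $ j)"
  shows "continuous_on S (\<lambda>x. det (A x))"
  unfolding det_def by (intro continuous_intros assms)

text \<open>The determinant is continuous along the segment from \<open>A\<close> to
  \<open>B\<close> and cannot vanish there, since every map on it is injective. Questions of
  orientation are thereby reduced to the triviality of kernels.\<close>

lemma det_pos_path:
  fixes A B :: "real^'n \<Rightarrow> real^'n"
  assumes "linear A" "linear B" "det (matrix A) > 0"
    and inj: "\<And>t w. t \<in> {0..1} \<Longrightarrow> (1 - t) *\<^sub>R A w + t *\<^sub>R B w = 0 \<Longrightarrow> w = 0"
  shows "det (matrix B) > 0"
proof (rule ccontr)
  define L where "L t w = (1 - t) *\<^sub>R A w + t *\<^sub>R B w" for t w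
  define d where "d t = det (matrix (L t))" for t
  assume "\<not> det (matrix B) > 0"
  moreover have "L 0 = A" "L 1 = B" by (auto simp: L_def)
  ultimately have "d 1 \<le> 0" "0 \<le> d 0" using assms(3) by (auto simp: d_def)
  moreover have "continuous_on {0..1} d"
    unfolding d_def[abs_def]
    by (rule continuous_on_det) (simp add: matrix_def L_def, intro continuous_intros)
  ultimately obtain t where t: "0 \<le> t" "t \<le> 1" "d t = 0"
    using IVT2'[of d 1 0 0] by auto
  have "linear (L t)"
    by (rule linearI) (simp_all add: L_def linear_add[OF assms(1)] linear_add[OF assms(2)]
        linear_scale[OF assms(1)] linear_scale[OF assms(2)] algebra_simps)
  moreover have "w = 0" if "L t w = 0" for w
    using inj[of t w] t that by (simp add: L_def)
  ultimately have "inj (L t)" using linear_injective_0 by blast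
  then show False using t(3) det_nz_iff_inj[OF \<open>linear (L t)\<close>] by (simp add: d_def)
qed

text \<open>
  If \<open>D\<close> is the differential at \<open>p\<close> of a map into the sphere, extended by zero to the normal space of
  the equator, then \<open>frame_map D p y x\<close> maps a frame \<open>us @ [p, e_last]\<close> to \<open>map D us @ [y, x]\<close>.
\<close>

definition frame_map ::
    "('n pt \<Rightarrow> 'n pt) \<Rightarrow> 'n pt \<Rightarrow> 'n pt \<Rightarrow> 'n pt \<Rightarrow> 'n pt \<Rightarrow> ('n::{finite,wellorder}) pt"
  where "frame_map D p y x w = D w + (w \<bullet> p) *\<^sub>R y + (w \<bullet> e_last) *\<^sub>R x"

definition frame_det ::
    "('n pt \<Rightarrow> 'n pt) \<Rightarrow> 'n pt \<Rightarrow> 'n pt \<Rightarrow> ('n::{finite,wellorder}) pt \<Rightarrow> real"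
  where "frame_det D p y x = det (matrix (frame_map D p y x))"

text \<open>A generalized cross product: the vector representing the linear functional
  \<open>frame_det D p y\<close>, see \<open>frame_det_inner\<close>.\<close>

definition normal_vec ::
    "('n pt \<Rightarrow> 'n pt) \<Rightarrow> 'n pt \<Rightarrow> 'n pt \<Rightarrow> ('n::{finite,wellorder}) pt"
  where "normal_vec D p y = (\<chi> k. frame_det D p y (axis k 1))"

text \<open>The linear algebra of a differential at one point: \<open>D\<close> kills the normal
  directions \<open>p\<close> and \<open>e_last\<close> because \<open>tau\<close> is constant along
  them, and its values are tangent to the sphere at \<open>y\<close>.\<close>

definition tangent_map :: "('n pt \<Rightarrow> 'n pt) \<Rightarrow> 'n pt \<Rightarrow> ('n::{finite,wellorder}) pt \<Rightarrow> bool"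
  where "tangent_map D p y \<longleftrightarrow> p \<in> equator \<and> norm y = 1 \<and> linear D \<and> D p = 0 \<and> D e_last = 0 \<and>
    (\<forall>w. D w \<bullet> y = 0)"

lemma tangent_mapD:
  assumes "tangent_map D p y"
  shows "p \<in> equator" "norm y = 1" "y \<bullet> y = 1" "linear D" "D p = 0" "D e_last = 0"
    "D w \<bullet> y = 0" "y \<bullet> D w = 0"
  using assms by (auto simp: tangent_map_def norm_eq_1 inner_commute)

lemma linear_frame_map: "linear D \<Longrightarrow> linear (frame_map D p y x)"
  by (rule linearI) (simp_all add: frame_map_def linear_add linear_scale algebra_simps)

lemma frame_map_p: "tangent_map D p y \<Longrightarrow> frame_map D p y x p = y"
  by (auto simp: frame_map_def tangent_map_def equatorD)

lemma frame_map_e_last: "tangent_map D p y \<Longrightarrow> frame_map D p y x e_last = x"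
  by (auto simp: frame_map_def tangent_map_def equatorD)

lemma frame_map_tangent: "u \<in> tangent_equator p \<Longrightarrow> frame_map D p y x u = D u"
  by (simp add: frame_map_def tangent_equator_def)

text \<open>As \<open>e_last\<close> is a coordinate vector, \<open>x\<close> fills exactly one
  column of the matrix, and the determinant is linear in that column.\<close>

lemma frame_det_inner:
  assumes "tangent_map D p y"
  shows "frame_det D p y x = normal_vec D p y \<bullet> x"
proof -
  define m where "m = (Max UNIV :: 'a)"
  define c where "c j = D (axis j 1) + (axis j 1 \<bullet> p) *\<^sub>R y" for j
  have rows: "transpose (matrix (frame_map D p y x)) = (\<chi> j. if j = m then x else c j)" for x
  proof -
    have "frame_map D p y x (axis j 1) = (if j = m then x else c j)" for j
    proof (cases "j = m")
      case True
      then have "axis j 1 = e_last" by (simp add: m_def e_last_def)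
      then show ?thesis using frame_map_e_last[OF assms] True by simp
    next
      case False
      then have "axis j (1::real) \<bullet> e_last = 0" by (simp add: e_last_def m_def inner_axis_axis)
      then show ?thesis using False by (simp add: frame_map_def c_def)
    qed
    then show ?thesis by (simp add: vec_eq_iff transpose_def matrix_def)
  qed
  have eq: "frame_det D p y x = det (\<chi> j. if j = m then x else c j)" for x
    unfolding frame_det_def rows[symmetric] by simp
  have x: "x = (\<Sum>k\<in>UNIV. (x $ k) *s axis k 1)" by (simp add: basis_expansion)
  have "frame_det D p y x = (\<Sum>k\<in>UNIV. det (\<chi> j. if j = m then (x $ k) *s axis k 1 else c j))"
    unfolding eq by (subst x) (rule det_linear_row_sum, simp)
  also have "\<dots> = (\<Sum>k\<in>UNIV. (x $ k) * frame_det D p y (axis k 1))"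
    unfolding eq det_row_mul ..
  finally show ?thesis by (simp add: normal_vec_def inner_vec_def mult.commute)
qed

lemma frame_det_nz_iff:
  assumes "linear D"
  shows "frame_det D p y x \<noteq> 0 \<longleftrightarrow> (\<forall>w. frame_map D p y x w = 0 \<longrightarrow> w = 0)"
  unfolding frame_det_def using det_nz_iff_inj[OF linear_frame_map[OF assms]]
    linear_injective_0[OF linear_frame_map[OF assms]] by metis

lemma det_frame:
  fixes us :: "(('n::{finite,wellorder}) pt) list"
  assumes "tangent_map D p y" "set us \<subseteq> tangent_equator p" "length us + 2 = CARD('n)"
  shows "det (rows_mat (map D us @ [y, x])) = frame_det D p y x * det (rows_mat (us @ [p, e_last]))"
proof -
  have "map D us @ [y, x] = map (frame_map D p y x) (us @ [p, e_last])"
    using assms(2) by (auto simp: frame_map_p[OF assms(1)] frame_map_e_last[OF assms(1)]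
        intro!: frame_map_tangent[symmetric])
  then show ?thesis
    unfolding frame_det_def using assms(3)
    by (simp only:) (intro det_rows_mat_map linear_frame_map tangent_mapD(4)[OF assms(1)], simp)
qed

lemma tangent_decomp:
  fixes w :: "('n::{finite,wellorder}) pt"
  assumes "p \<in> equator"
  defines "u \<equiv> w - (w \<bullet> p) *\<^sub>R p - (w \<bullet> e_last) *\<^sub>R e_last"
  shows "u \<in> tangent_equator p" "w = u + (w \<bullet> p) *\<^sub>R p + (w \<bullet> e_last) *\<^sub>R e_last"
  using equatorD[OF assms(1)] by (auto simp: u_def tangent_equator_def inner_diff_left)

text \<open>For \<open>x = D w\<close> or \<open>x = y\<close> the frame repeats a vector:
  \<open>u - e_last\<close> or \<open>p - e_last\<close> lies in the kernel, so the determinant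
  vanishes.\<close>

lemma normal_vec_orthogonal:
  assumes "tangent_map D p y"
  shows "normal_vec D p y \<bullet> D w = 0" "normal_vec D p y \<bullet> y = 0"
proof -
  note T = tangent_mapD[OF assms]
  have *: "normal_vec D p y \<bullet> x = 0" if "frame_map D p y x v = 0" "v \<noteq> 0" for x v
    unfolding frame_det_inner[OF assms, symmetric]
    using frame_det_nz_iff[OF T(4), of p y x] that by blast
  have "D (w - (w \<bullet> p) *\<^sub>R p - (w \<bullet> e_last) *\<^sub>R e_last) = D w"
    by (simp add: linear_diff[OF T(4)] linear_scale[OF T(4)] T(5,6))
  then obtain u where u: "u \<in> tangent_equator p" "D u = D w"
    using tangent_decomp(1)[OF T(1)] by metis
  have "frame_map D p y (D w) (u - e_last) = 0"
    using u frame_map_tangent[OF u(1)] frame_map_e_last[OF assms]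
    by (simp add: linear_diff[OF linear_frame_map[OF T(4)]])
  moreover have "u - e_last \<noteq> 0"
    using u(1) by (metis (mono_tags, lifting) e_last_inner_self eq_iff_diff_eq_0 mem_Collect_eq tangent_equator_def zero_neq_one)
  ultimately show "normal_vec D p y \<bullet> D w = 0" by (rule *)
  have "frame_map D p y y (p - e_last) = 0"
    using frame_map_p[OF assms] frame_map_e_last[OF assms]
    by (simp add: linear_diff[OF linear_frame_map[OF T(4)]])
  moreover have "p - e_last \<noteq> 0"
    using equatorD(3)[OF T(1)] by auto
  ultimately show "normal_vec D p y \<bullet> y = 0" by (rule *)
qed

text \<open>It suffices to find one \<open>x\<close> with nonzero determinant, and a nonzero vector
  orthogonal to the other frame vectors is one.\<close>

lemma normal_vec_nonzero:
  assumes "tangent_map D p y" "inj_on D (tangent_equator p)"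
  shows "normal_vec D p y \<noteq> 0"
proof -
  note T = tangent_mapD[OF assms(1)]
  \<comment> \<open>With the last vector set to 0 the frame map is singular, so its range is a
    proper subspace and has a nonzero orthogonal vector.\<close>
  define A where "A = frame_map D p y 0"
  have linA: "linear A" unfolding A_def by (rule linear_frame_map[OF T(4)])
  have "A e_last = 0" by (simp add: A_def frame_map_e_last[OF assms(1)])
  then have "\<not> inj A" using linear_injective_0[OF linA] e_last_nonzero by metis
  then have "\<not> surj A" using linear_surjective_imp_injective[OF linA] by blast
  moreover have "span (range A) = range A"
    by (simp only: span_eq_iff linear_subspace_image[OF linA subspace_UNIV])
  ultimately have "span (range A) \<noteq> UNIV" by metis
  then obtain x where x: "x \<noteq> 0" "\<And>v. v \<in> span (range A) \<Longrightarrow> orthogonal x v"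
    using orthogonal_to_subspace_exists_gen[of "range A" UNIV] by (auto simp: psubset_eq)
  have "w = 0" if "frame_map D p y x w = 0" for w
  proof -
    have eq: "A w + (w \<bullet> e_last) *\<^sub>R x = 0" using that by (simp add: A_def frame_map_def)
    have "x \<bullet> A w = 0" using x(2)[OF span_base[of "A w"]] by (simp add: orthogonal_def)
    then have "(w \<bullet> e_last) * (x \<bullet> x) = 0"
      using arg_cong[OF eq, of "\<lambda>z. x \<bullet> z"] by (simp add: inner_add_right)
    then have we: "w \<bullet> e_last = 0" using x(1) by simp
    then have Aw: "D w + (w \<bullet> p) *\<^sub>R y = 0" using eq by (simp add: A_def frame_map_def)
    then have wp: "w \<bullet> p = 0"
    proof -
      have "(D w + (w \<bullet> p) *\<^sub>R y) \<bullet> y = 0" by (simp only: Aw inner_zero_left)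
      then show ?thesis using T(3) T(7)[of w] by (simp add: inner_add_left)
    qed
    then have "D w = D 0" using Aw linear_0[OF T(4)] by simp
    moreover have "w \<in> tangent_equator p" "0 \<in> tangent_equator p"
      using we wp by (auto simp: tangent_equator_def)
    ultimately show ?thesis using assms(2) by (auto dest: inj_onD)
  qed
  then have "frame_det D p y x \<noteq> 0" using frame_det_nz_iff[OF T(4)] by blast
  then show ?thesis using frame_det_inner[OF assms(1)] by auto
qed

lemma frame_det_nonzero_inj:
  assumes "tangent_map D p y" "frame_det D p y x \<noteq> 0"
  shows "inj_on D (tangent_equator p)"
proof (rule inj_onI)
  note T = tangent_mapD[OF assms(1)]
  fix u v assume uv: "u \<in> tangent_equator p" "v \<in> tangent_equator p" "D u = D v"
  then have "u - v \<in> tangent_equator p" by (auto simp: tangent_equator_def inner_diff_left)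
  then have "frame_map D p y x (u - v) = 0"
    using uv(3) by (simp add: frame_map_tangent linear_diff[OF T(4)])
  then show "u = v" using assms(2) frame_det_nz_iff[OF T(4), of p y x] by auto
qed

text \<open>Both \<open>\<nu>\<close> and the cross product are orthogonal to the tangent frame and
  to \<open>y\<close>, hence proportional. The unit norm fixes the factor up to sign, and the
  orientation makes it negative by \<open>det_rows_mat_swap\<close>.\<close>

lemma normal_frame_iff:
  fixes us :: "(('n::{finite,wellorder}) pt) list"
  assumes D: "tangent_map D p y" "inj_on D (tangent_equator p)"
    and us: "pos_frame_equator p us"
    and on: "orthonormal_list (map D us)"
  shows "pos_frame_usphere y (map D us @ [\<nu>]) \<and> orthonormal_list (map D us @ [\<nu>]) \<longleftrightarrow>
    \<nu> = - normal_vec D p y /\<^sub>R norm (normal_vec D p y)"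
proof -
  note T = tangent_mapD[OF D(1)]
  define N where "N = normal_vec D p y"
  have N0: "N \<noteq> 0" unfolding N_def by (rule normal_vec_nonzero[OF D])
  have N: "N \<bullet> D w = 0" "D w \<bullet> N = 0" "N \<bullet> y = 0" "y \<bullet> N = 0" for w
    using normal_vec_orthogonal[OF D(1)] by (auto simp: N_def inner_commute)
  have us': "set us \<subseteq> tangent_equator p" "length us + 2 = CARD('n)"
    "det (rows_mat (us @ [p, e_last])) > 0" (is "?d > 0")
    using us by (auto simp: pos_frame_equator_def pos_oriented_iff)
  have det: "det (rows_mat (map D us @ [x, y])) = - (N \<bullet> x) * ?d" for x
    using det_rows_mat_swap[of "map D us" x y] det_frame[OF D(1) us'(1,2), of x]
      frame_det_inner[OF D(1), of x] us'(2) by (simp add: N_def)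
  show ?thesis
  proof
    assume L: "pos_frame_usphere y (map D us @ [\<nu>]) \<and> orthonormal_list (map D us @ [\<nu>])"
    then have \<nu>: "\<nu> \<bullet> y = 0" "norm \<nu> = 1" "\<And>u. u \<in> set us \<Longrightarrow> D u \<bullet> \<nu> = 0"
      and "0 < det (rows_mat (map D us @ [\<nu>, y]))"
      by (auto simp: pos_frame_usphere_def tangent_usphere_def pos_oriented_iff
          orthonormal_list_append1)
    then have \<nu>pos: "0 < - (N \<bullet> \<nu>) * ?d" using det[of \<nu>] by simp
    \<comment> \<open>The combination of \<open>\<nu>\<close> and \<open>N\<close> that is
      orthogonal to \<open>N\<close>; being orthogonal to a whole basis, it vanishes.\<close>
    define z where "z = (N \<bullet> N) *\<^sub>R \<nu> - (N \<bullet> \<nu>) *\<^sub>R N"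
    have "z = 0"
    proof (rule rows_mat_kernel)
      show "length (map D us @ [N, y]) = CARD('n)" using us'(2) by simp
      show "det (rows_mat (map D us @ [N, y])) \<noteq> 0" using N0 us'(3) by (simp add: det)
      show "v \<bullet> z = 0" if "v \<in> set (map D us @ [N, y])" for v
        using that \<nu>(1,3) N by (auto simp: z_def inner_diff_right inner_commute[of y])
    qed
    then have "(N \<bullet> N) *\<^sub>R \<nu> = (N \<bullet> \<nu>) *\<^sub>R N" by (simp add: z_def)
    then have \<nu>a: "\<nu> = ((N \<bullet> \<nu>) / (N \<bullet> N)) *\<^sub>R N" (is "_ = ?a *\<^sub>R N")
      using N0 by (metis (no_types, lifting) divideR_right inner_eq_zero_iff scaleR_scaleR divide_inverse mult.commute)
    have neg: "N \<bullet> \<nu> < 0" using \<nu>pos us'(3) by (simp add: mult_less_0_iff)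
    then have "?a < 0" using N0 by (simp add: divide_neg_pos)
    moreover have "norm \<nu> = \<bar>?a\<bar> * norm N" by (subst \<nu>a) (rule norm_scaleR)
    ultimately have "norm \<nu> = - ?a * norm N" by (simp only: abs_of_neg)
    then have "- ?a = inverse (norm N)" using \<nu>(2) N0 by (simp add: field_simps)
    then show "\<nu> = - normal_vec D p y /\<^sub>R norm (normal_vec D p y)"
      using \<nu>a unfolding N_def[symmetric] by (metis minus_minus scaleR_minus_left scaleR_minus_right)
  next
    assume "\<nu> = - normal_vec D p y /\<^sub>R norm (normal_vec D p y)"
    then have \<nu>: "\<nu> = - (N /\<^sub>R norm N)" by (simp add: N_def)
    have "- (N \<bullet> \<nu>) = norm N"
      using N0 by (simp add: \<nu> dot_square_norm power2_eq_square)
    then have "det (rows_mat (map D us @ [\<nu>, y])) > 0"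
      using det[of \<nu>] us'(3) N0 by simp
    moreover have "norm \<nu> = 1" using N0 by (simp add: \<nu>)
    ultimately show "pos_frame_usphere y (map D us @ [\<nu>]) \<and> orthonormal_list (map D us @ [\<nu>])"
      using on us'(2) T(7) N
      by (auto simp: pos_frame_usphere_def tangent_usphere_def pos_oriented_iff
          orthonormal_list_append1 \<nu>)
  qed
qed

section \<open>Existence of positive orthonormal frames\<close>

lemma subspace_tangent_equator: "subspace (tangent_equator p)"
  by (auto simp: tangent_equator_def subspace_def inner_add_left)

lemma dim_tangent_equator:
  fixes p :: "('n::{finite,wellorder}) pt"
  assumes "p \<in> equator"
  shows "dim (tangent_equator p) + 2 = CARD('n)"
proof -
  let ?A = "span {p, e_last}"
  have eqT: "tangent_equator p = {y \<in> UNIV. \<forall>x\<in>?A. orthogonal x y}" (is "_ = ?R")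
  proof
    show "tangent_equator p \<subseteq> ?R"
    proof
      fix u assume "u \<in> tangent_equator p"
      then have "orthogonal u x" if "x \<in> {p, e_last}" for x
        using that by (auto simp: tangent_equator_def orthogonal_def)
      then show "u \<in> ?R" using orthogonal_to_span[of _ "{p, e_last}" u] by (auto simp: orthogonal_commute)
    qed
    show "?R \<subseteq> tangent_equator p"
      using span_base[of p "{p, e_last}"] span_base[of e_last "{p, e_last}"]
      by (auto simp: tangent_equator_def orthogonal_def inner_commute)
  qed
  have "p \<noteq> e_last" using equatorD(3)[OF assms] by auto
  have "independent {p, e_last}"
    using equatorD[OF assms] 
    by (intro pairwise_orthogonal_independent) (auto simp: pairwise_def orthogonal_def)
  then have "dim ?A = 2" using \<open>p \<noteq> e_last\<close> by (simp add: dim_eq_card_independent)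
  moreover have "dim ?R + dim ?A = dim (UNIV :: ('n pt) set)"
    by (rule dim_subspace_orthogonal_to_vectors) auto
  ultimately show ?thesis using eqT by (simp add: dim_UNIV)
qed

text \<open>Without such a frame the description defining \<open>gauss_map\<close> would hold
  vacuously and single out no vector. An orthonormal basis of the image is pulled back along
  \<open>D\<close> and reflected if its orientation is wrong.\<close>

lemma orthonormal_pos_frame_exists:
  fixes D :: "'n pt \<Rightarrow> ('n::{finite,wellorder}) pt"
  assumes D: "tangent_map D p y" "inj_on D (tangent_equator p)" and n: "CARD('n) > 2"
  obtains us where "pos_frame_equator p us" "orthonormal_list (map D us)"
proof -
  note T = tangent_mapD[OF D(1)]
  let ?W = "D ` tangent_equator p"
  have subW: "subspace ?W" using linear_subspace_image[OF T(4) subspace_tangent_equator] .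
  have dimW: "dim ?W + 2 = CARD('n)"
    using dim_image_eq[OF T(4), of "tangent_equator p"] D(2) dim_tangent_equator[OF T(1)]
    by (simp add: subspace_tangent_equator span_eq_iff[THEN iffD2])
  obtain B where B: "B \<subseteq> ?W" "pairwise orthogonal B" "\<And>x. x \<in> B \<Longrightarrow> norm x = 1"
    "independent B" "card B = dim ?W"
    using orthonormal_basis_subspace[OF subW] by metis
  have "finite B" using B(4) by (simp add: finiteI_independent)
  then obtain bs where bs: "set bs = B" "distinct bs" using finite_distinct_list by metis
  have len: "length bs + 2 = CARD('n)" using bs B(5) dimW distinct_card by metis
  have on: "orthonormal_list bs" by (rule orthonormal_listI_pairwise) (use bs B in auto)
  define us where "us = map (inv_into (tangent_equator p) D) bs"
  have "D (inv_into (tangent_equator p) D b) = b" if "b \<in> set bs" for b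
    using B(1) bs(1) that by (intro f_inv_into_f) blast
  then have Dus: "map D us = bs"
    by (simp add: us_def map_idI)
  have sub: "set us \<subseteq> tangent_equator p"
    using B(1) bs(1) by (auto simp: us_def intro!: inv_into_into)
  have lenu: "length us + 2 = CARD('n)" using len by (simp add: us_def)
  define N where "N = normal_vec D p y"
  have N0: "N \<noteq> 0" unfolding N_def by (rule normal_vec_nonzero[OF D])
  \<comment> \<open>Completing the image frame to an orthonormal basis makes its determinant
    nonzero, and \<open>det_frame\<close> transfers this to the frame of the equator.\<close>
  have "orthonormal_list ((bs @ [y]) @ [N /\<^sub>R norm N])"
    unfolding orthonormal_list_append1
    using on N0 T B(1) bs(1) normal_vec_orthogonal[OF D(1)]
    by (auto simp: N_def inner_commute)
  then have "det (rows_mat (map D us @ [y, N /\<^sub>R norm N])) \<noteq> 0"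
    using len Dus by (intro det_orthonormal_list) auto
  then have nz: "det (rows_mat (us @ [p, e_last])) \<noteq> 0"
    using det_frame[OF D(1) sub lenu, of "N /\<^sub>R norm N"] by auto
  \<comment> \<open>\<open>CARD('n) > 2\<close> means that the frame is nonempty, so there is a
    vector to negate.\<close>
  obtain u us' where us': "us = u # us'" using lenu n by (cases us) auto
  show ?thesis
  proof (cases "det (rows_mat (us @ [p, e_last])) > 0")
    case True
    then show ?thesis using that[of us] sub lenu on Dus
      by (simp add: pos_frame_equator_def pos_oriented_iff)
  next
    case False
    have "det (rows_mat ((- u) # us' @ [p, e_last])) > 0"
      using False nz us' by (simp add: det_rows_mat_negate_hd)
    moreover have "set ((- u) # us') \<subseteq> tangent_equator p"
      using sub us' subspace_neg[OF subspace_tangent_equator] by auto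
    moreover have "orthonormal_list (map D ((- u) # us'))"
      using on orthonormal_list_negate_hd unfolding Dus[symmetric] us'
      by (simp add: linear_neg[OF T(4)])
    ultimately show ?thesis using that[of "(- u) # us'"] lenu us'
      by (simp add: pos_frame_equator_def pos_oriented_iff)
  qed
qed

text \<open>Relative to the frame (image of \<open>D\<close>, \<open>y\<close>, \<open>x\<close>)
  the new frame is triangular with positive diagonal entries \<open>s\<close>, \<open>a\<close> and
  1, and the same holds along the segment joining the two. Solving the triangular system, beginning
  with the tangent part, shows that the kernel is trivial.\<close>

lemma frame_det_pos_shear:
  assumes D: "linear D" "D p = 0" "D e_last = 0" "frame_det D p y x > 0" and p: "p \<in> equator"
    and D': "linear D'" "D' p = 0" "D' e_last = 0"
    and eq: "\<And>w. D' w = s *\<^sub>R D w + \<alpha> w *\<^sub>R y + \<beta> w *\<^sub>R x" "s > 0"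
    and y': "y' = a *\<^sub>R y + b *\<^sub>R x" "a > 0"
  shows "frame_det D' p y' x > 0"
  unfolding frame_det_def
proof (rule det_pos_path[OF linear_frame_map[OF D(1)] linear_frame_map[OF D'(1)] D(4)[unfolded frame_det_def]])
  fix t :: real and w
  assume t: "t \<in> {0..1}" and 0: "(1 - t) *\<^sub>R frame_map D p y x w + t *\<^sub>R frame_map D' p y' x w = 0"
  have pos: "(1 - t) + t * r > 0" if "r > 0" for r :: real
    using t that by (cases "t = 1") (auto intro!: add_pos_nonneg)
  note lin = linear_frame_map[OF D(1), of p y x]
  have inj: "v = 0" if "frame_map D p y x v = 0" for v
    using frame_det_nz_iff[OF D(1), of p y x] D(4) that by auto
  \<comment> \<open>The coefficients of the image of \<open>w\<close> with respect to the image of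
    \<open>D\<close>, \<open>y\<close> and \<open>x\<close>; injectivity of the old frame map makes
    all three parts vanish.\<close>
  define \<sigma> where "\<sigma> = (1 - t) + t * s"
  define c1 where "c1 = (1 - t) * (w \<bullet> p) + t * (\<alpha> w + (w \<bullet> p) * a)"
  define c2 where "c2 = (1 - t) * (w \<bullet> e_last) + t * (\<beta> w + (w \<bullet> p) * b + (w \<bullet> e_last))"
  have "\<sigma> *\<^sub>R D w + c1 *\<^sub>R y + c2 *\<^sub>R x = 0"
    using 0 unfolding frame_map_def eq(1) y'(1) \<sigma>_def c1_def c2_def
    by (simp add: algebra_simps)
  then have "frame_map D p y x (\<sigma> *\<^sub>R (w - (w \<bullet> p) *\<^sub>R p - (w \<bullet> e_last) *\<^sub>R e_last) + c1 *\<^sub>R p + c2 *\<^sub>R e_last) = 0"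
    using equatorD[OF p] D
    by (simp add: frame_map_def linear_add[OF D(1)] linear_diff[OF D(1)] linear_scale[OF D(1)]
        inner_add_left inner_diff_left)
  from inj[OF this] have z: "\<sigma> *\<^sub>R (w - (w \<bullet> p) *\<^sub>R p - (w \<bullet> e_last) *\<^sub>R e_last) + c1 *\<^sub>R p + c2 *\<^sub>R e_last = 0"
    (is "?z = 0") .
  have "?z \<bullet> p = c1" "?z \<bullet> e_last = c2"
    using equatorD[OF p] by (simp_all add: inner_add_left inner_diff_left)
  then have c: "c1 = 0" "c2 = 0" using z by auto
  moreover have "\<sigma> \<noteq> 0" using pos[OF eq(2)] by (simp add: \<sigma>_def)
  ultimately have "w - (w \<bullet> p) *\<^sub>R p - (w \<bullet> e_last) *\<^sub>R e_last = 0"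
    using z by simp
  then have w: "w = (w \<bullet> p) *\<^sub>R p + (w \<bullet> e_last) *\<^sub>R e_last"
    by (simp add: diff_diff_eq)
  \<comment> \<open>Now \<open>w\<close> lies in the plane of \<open>p\<close> and
    \<open>e_last\<close>, on which both differentials vanish; only the contributions of
    \<open>y\<close>, \<open>y'\<close> and \<open>x\<close> are left.\<close>
  have "D w = 0"
    by (subst w) (simp add: linear_add[OF D(1)] linear_scale[OF D(1)] D)
  have "D' w = 0"
    by (subst w) (simp add: linear_add[OF D'(1)] linear_scale[OF D'(1)] D')
  define \<kappa> where "\<kappa> = (1 - t) + t * a"
  define c3 where "c3 = t * (w \<bullet> p) * b + (w \<bullet> e_last)"
  have "((w \<bullet> p) * \<kappa>) *\<^sub>R y + c3 *\<^sub>R x = 0"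
    using 0 unfolding frame_map_def \<open>D w = 0\<close> \<open>D' w = 0\<close> y'(1) \<kappa>_def c3_def
    by (simp add: algebra_simps)
  then have "frame_map D p y x (((w \<bullet> p) * \<kappa>) *\<^sub>R p + c3 *\<^sub>R e_last) = 0"
    using equatorD[OF p] D
    by (simp add: frame_map_def linear_add[OF D(1)] linear_scale[OF D(1)] inner_add_left)
  from inj[OF this] have z: "((w \<bullet> p) * \<kappa>) *\<^sub>R p + c3 *\<^sub>R e_last = 0" (is "?z = 0") .
  have "?z \<bullet> p = (w \<bullet> p) * \<kappa>" "?z \<bullet> e_last = c3"
    using equatorD[OF p] by (simp_all add: inner_add_left)
  then have "w \<bullet> p = 0" "c3 = 0" using z pos[OF y'(2)] by (auto simp: \<kappa>_def)
  then show "w = 0" using w by (simp add: c3_def)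
qed


section \<open>Circumcenters\<close>

definition hemi_set :: "(('n::finite) pt) set \<Rightarrow> bool"
  where "hemi_set A \<longleftrightarrow> A \<noteq> {} \<and> compact A \<and> A \<subseteq> usphere \<and> (\<exists>a\<in>usphere. A \<subseteq> open_hemisphere a)"

lemma unit_inner_bounds:
  assumes "norm x = 1" "norm y = 1"
  shows "- 1 \<le> x \<bullet> y" "x \<bullet> y \<le> 1"
  using Cauchy_Schwarz_ineq2[of x y] assms by (auto simp: abs_le_iff)

text \<open>The minimal inner product with a set of unit vectors is 1-Lipschitz in \<open>c\<close>,
  so it attains a maximum on a compact set. With \<open>K\<close> the whole sphere this yields the
  center, with \<open>K\<close> the sphere minus a ball its stability.\<close>

lemma sphere_maximin:
  fixes A :: "('a::euclidean_space) set"
  assumes A: "compact A" "A \<noteq> {}" "A \<subseteq> sphere 0 1" and K: "compact K" "K \<noteq> {}"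
  obtains c a where "c \<in> K" "a \<in> A" "\<And>b. b \<in> A \<Longrightarrow> c \<bullet> a \<le> c \<bullet> b"
    "\<And>c'. c' \<in> K \<Longrightarrow> \<exists>b\<in>A. c' \<bullet> b \<le> c \<bullet> a"
proof -
  obtain \<alpha> where \<alpha>: "\<And>c. \<alpha> c \<in> A" "\<And>c b. b \<in> A \<Longrightarrow> c \<bullet> \<alpha> c \<le> c \<bullet> b"
  proof -
    have "\<exists>a\<in>A. \<forall>b\<in>A. c \<bullet> a \<le> c \<bullet> b" for c
      by (rule continuous_attains_inf[OF A(1,2)]) (intro continuous_intros)
    then show ?thesis using that by metis
  qed
  have lip: "c \<bullet> \<alpha> c \<le> c' \<bullet> \<alpha> c' + norm (c - c')" for c c'
  proof -
    have "c \<bullet> \<alpha> c \<le> c \<bullet> \<alpha> c'" by (rule \<alpha>(2)[OF \<alpha>(1)])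
    also have "\<dots> = c' \<bullet> \<alpha> c' + (c - c') \<bullet> \<alpha> c'" by (simp add: inner_diff_left)
    also have "(c - c') \<bullet> \<alpha> c' \<le> norm (c - c') * norm (\<alpha> c')" by (rule norm_cauchy_schwarz)
    also have "norm (\<alpha> c') = 1" using \<alpha>(1)[of c'] A(3) by auto
    finally show ?thesis by simp
  qed
  have "continuous_on K (\<lambda>c. c \<bullet> \<alpha> c)"
    unfolding continuous_on_iff
  proof (intro ballI allI impI)
    fix c e assume "c \<in> K" "(e::real) > 0"
    have "dist (c' \<bullet> \<alpha> c') (c \<bullet> \<alpha> c) \<le> dist c' c" for c'
      using lip[of c c'] lip[of c' c] by (auto simp: dist_norm norm_minus_commute abs_le_iff)
    then show "\<exists>d>0. \<forall>c'\<in>K. dist c' c < d \<longrightarrow> dist (c' \<bullet> \<alpha> c') (c \<bullet> \<alpha> c) < e"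
      using \<open>e > 0\<close> by (meson le_less_trans)
  qed
  from continuous_attains_sup[OF K this] obtain c where "c \<in> K"
    "\<And>c'. c' \<in> K \<Longrightarrow> c' \<bullet> \<alpha> c' \<le> c \<bullet> \<alpha> c" by blast
  then show ?thesis using that[of c "\<alpha> c"] \<alpha> by blast
qed

text \<open>The cosine is strictly decreasing between 0 and pi, so a geodesic ball is a cap cut out
  by a bound on inner products.\<close>

lemma sphere_cball_iff:
  assumes "norm c = 1" "A \<subseteq> usphere" "0 \<le> r" "r \<le> pi"
  shows "A \<subseteq> sphere_cball c r \<longleftrightarrow> (\<forall>a\<in>A. cos r \<le> c \<bullet> a)"
proof -
  have "arccos (c \<bullet> a) \<le> r \<longleftrightarrow> cos r \<le> c \<bullet> a" if "a \<in> A" for a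
  proof -
    have b: "- 1 \<le> c \<bullet> a" "c \<bullet> a \<le> 1"
      using unit_inner_bounds[of c a] assms that by auto
    show ?thesis
      using cos_mono_le_eq[of r "arccos (c \<bullet> a)"] b assms(3,4)
      by (simp add: arccos_lbound arccos_ubound cos_arccos)
  qed
  then show ?thesis using assms(2) by (auto simp: sphere_cball_def)
qed

text \<open>The smallest ball corresponds to the largest minimal inner product \<open>m\<close>, the
  cosine of its radius. Lying in an open hemisphere forces \<open>m > 0\<close>, and this positivity
  is what makes the center unique.\<close>

lemma circumcenter_props:
  fixes A :: "(('n::finite) pt) set"
  assumes "hemi_set A"
  shows "\<exists>m>0. circumcenter A \<in> usphere \<and> (\<forall>a\<in>A. m \<le> circumcenter A \<bullet> a) \<and>
    (\<forall>c'\<in>usphere. (\<forall>a\<in>A. m \<le> c' \<bullet> a) \<longrightarrow> c' = circumcenter A) \<and>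
    (\<forall>c'\<in>usphere. \<exists>a\<in>A. c' \<bullet> a \<le> m)"
proof -
  obtain h where A: "A \<noteq> {}" "compact A" "A \<subseteq> usphere" and h: "h \<in> usphere" "A \<subseteq> open_hemisphere h"
    using assms by (auto simp: hemi_set_def)
  have ne: "(usphere :: ('n pt) set) \<noteq> {}" using h by blast
  obtain c a0 where c: "c \<in> usphere" "a0 \<in> A" "\<And>b. b \<in> A \<Longrightarrow> c \<bullet> a0 \<le> c \<bullet> b"
    and mx: "\<And>c'. c' \<in> usphere \<Longrightarrow> \<exists>b\<in>A. c' \<bullet> b \<le> c \<bullet> a0"
    using sphere_maximin[OF A(2,1,3) compact_sphere ne] by blast
  define m where "m = c \<bullet> a0"
  have m0: "m > 0"
  proof -
    obtain b where b: "b \<in> A" "h \<bullet> b \<le> c \<bullet> a0" using mx[OF h(1)] by blast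
    have "0 < b \<bullet> h" using h(2) b(1) by (auto simp: open_hemisphere_def)
    then show ?thesis using b(2) by (simp add: m_def inner_commute)
  qed
  have m1: "m \<le> 1" using unit_inner_bounds[of c a0] c A(3) by (auto simp: m_def)
  have uniq: "c' = c" if c': "c' \<in> usphere" "\<And>a. a \<in> A \<Longrightarrow> m \<le> c' \<bullet> a" for c'
  proof (rule ccontr)
    assume ne: "c' \<noteq> c"
    \<comment> \<open>The sum of two distinct optimal unit vectors has inner products at least
      \<open>2 * m\<close> but norm below 2, so its normalization would beat
      \<open>m\<close>.\<close>
    define s where "s = c + c'"
    have sa: "2 * m \<le> s \<bullet> a" if "a \<in> A" for a
      using c(3)[OF that] c'(2)[OF that] by (simp add: s_def m_def inner_add_left)
    have "s \<noteq> 0" using sa[OF c(2)] m0 by auto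
    have "c \<bullet> c' \<noteq> 1"
    proof
      assume "c \<bullet> c' = 1"
      then have "(c - c') \<bullet> (c - c') = 0"
        using c(1) c'(1) by (simp add: inner_diff_left inner_diff_right inner_commute norm_eq_1)
      then show False using ne by simp
    qed
    then have "c \<bullet> c' < 1" using unit_inner_bounds[of c c'] c(1) c'(1) by auto
    moreover have "norm s ^ 2 = 2 + 2 * (c \<bullet> c')"
      unfolding power2_norm_eq_inner s_def
      using c(1) c'(1) by (simp add: inner_add_left inner_add_right inner_commute norm_eq_1)
    ultimately have "norm s ^ 2 < 2 ^ 2" by simp
    then have s2: "norm s < 2" by (rule power2_less_imp_less) simp
    have "s /\<^sub>R norm s \<in> usphere" using \<open>s \<noteq> 0\<close> by simp
    from mx[OF this] obtain b where b: "b \<in> A" "(s /\<^sub>R norm s) \<bullet> b \<le> m"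
      by (auto simp: m_def)
    then have "s \<bullet> b \<le> m * norm s" using \<open>s \<noteq> 0\<close> by (simp add: field_simps)
    also have "\<dots> < m * 2" using s2 m0 by simp
    finally show False using sa[OF b(1)] by simp
  qed
  have r: "0 \<le> arccos m" "arccos m \<le> pi" "cos (arccos m) = m"
    using m0 m1 by (auto simp: arccos_lbound arccos_ubound cos_arccos)
  have "circumcenter A = c"
    unfolding circumcenter_def
  proof (rule the_equality)
    have min: "arccos m \<le> r'" if cr: "c' \<in> usphere" "A \<subseteq> sphere_cball c' r'" for c' r'
    proof -
      obtain b where b: "b \<in> A" "c' \<bullet> b \<le> m" using mx[OF cr(1)] by (auto simp: m_def)
      have "- 1 \<le> c' \<bullet> b" using unit_inner_bounds[of c' b] cr(1) b(1) A(3) by auto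
      then have "arccos m \<le> arccos (c' \<bullet> b)" using b(2) m1 by (intro arccos_le_arccos) auto
      also have "\<dots> \<le> r'" using cr(2) b(1) by (auto simp: sphere_cball_def)
      finally show ?thesis .
    qed
    have "A \<subseteq> sphere_cball c (arccos m)"
      using sphere_cball_iff[of c A "arccos m"] c A(3) r by (simp add: m_def)
    then show "c \<in> usphere \<and> (\<exists>r. A \<subseteq> sphere_cball c r \<and>
        (\<forall>c'\<in>usphere. \<forall>r'. A \<subseteq> sphere_cball c' r' \<longrightarrow> r \<le> r'))"
      using c(1) min by blast
    fix c' assume "c' \<in> usphere \<and> (\<exists>r. A \<subseteq> sphere_cball c' r \<and>
        (\<forall>c''\<in>usphere. \<forall>r'. A \<subseteq> sphere_cball c'' r' \<longrightarrow> r \<le> r'))"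
    then obtain r where c': "c' \<in> usphere" "A \<subseteq> sphere_cball c' r" "r \<le> arccos m"
      using \<open>A \<subseteq> sphere_cball c (arccos m)\<close> c(1) by blast
    then have "A \<subseteq> sphere_cball c' (arccos m)" by (auto simp: sphere_cball_def)
    then have "\<forall>a\<in>A. m \<le> c' \<bullet> a"
      using sphere_cball_iff[of c' A "arccos m"] c'(1) A(3) r by simp
    then show "c' = c" using uniq c'(1) by blast
  qed
  moreover have "\<forall>a\<in>A. m \<le> c \<bullet> a" "\<forall>c'\<in>usphere. \<exists>a\<in>A. c' \<bullet> a \<le> m"
    using c(3) mx by (auto simp: m_def)
  ultimately show ?thesis using m0 c(1) uniq by blast
qed

lemma circumcenter_singleton:
  assumes "norm a = 1"
  shows "circumcenter {a} = a"
proof -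
  have "{a} \<subseteq> open_hemisphere a"
    using assms by (simp add: open_hemisphere_def norm_eq_1)
  moreover have "a \<in> usphere" using assms by simp
  ultimately have "hemi_set {a}"
    unfolding hemi_set_def by (intro conjI compact_sing bexI[of _ a]) simp_all
  from circumcenter_props[OF this] obtain m where m: "circumcenter {a} \<in> usphere"
    "m \<le> circumcenter {a} \<bullet> a"
    "\<And>c'. c' \<in> usphere \<Longrightarrow> m \<le> c' \<bullet> a \<Longrightarrow> c' = circumcenter {a}"
    by blast
  have "m \<le> a \<bullet> a"
    using unit_inner_bounds(2)[of "circumcenter {a}" a] m(1,2) assms by (simp add: norm_eq_1)
  then show ?thesis using m(3)[of a] assms by simp
qed

text \<open>The conditions on \<open>A'\<close> express closeness in Hausdorff distance. Outside a
  ball around the center the optimal value of the maximin problem is strictly smaller than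
  \<open>m\<close>, and a small perturbation cannot close this gap.\<close>

lemma circumcenter_continuous:
  fixes A :: "(('n::finite) pt) set"
  assumes "hemi_set A" "e > 0"
  obtains \<delta> where "\<delta> > 0"
    "\<And>A'. hemi_set A' \<Longrightarrow> (\<And>a. a \<in> A \<Longrightarrow> \<exists>a'\<in>A'. norm (a - a') < \<delta>) \<Longrightarrow>
      (\<And>a'. a' \<in> A' \<Longrightarrow> \<exists>a\<in>A. norm (a - a') < \<delta>) \<Longrightarrow>
      norm (circumcenter A' - circumcenter A) < e"
proof -
  define c where "c = circumcenter A"
  obtain m where m: "m > 0" "c \<in> usphere" "\<And>a. a \<in> A \<Longrightarrow> m \<le> c \<bullet> a"
    "\<And>c'. c' \<in> usphere \<Longrightarrow> (\<And>a. a \<in> A \<Longrightarrow> m \<le> c' \<bullet> a) \<Longrightarrow> c' = c"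
    using circumcenter_props[OF assms(1)] unfolding c_def by blast
  \<comment> \<open>The positions to be excluded for the new center, a compact set; if it is empty,
    any \<open>\<delta>\<close> will do.\<close>
  define K where "K = usphere - ball c e"
  have "compact K" unfolding K_def by (intro compact_diff compact_sphere open_ball)
  have close: "x \<bullet> b \<le> x \<bullet> a + d" if "norm x = 1" "norm (a - b) < d" for x a b :: "'n pt" and d
  proof -
    have "x \<bullet> (b - a) \<le> norm x * norm (b - a)" by (rule norm_cauchy_schwarz)
    then show ?thesis using that by (simp add: inner_diff_right norm_minus_commute)
  qed
  show ?thesis
  proof (cases "K = {}")
    case True
    show ?thesis
    proof (rule that[of 1])
      fix A' :: "('n pt) set" assume "hemi_set A'"
      then have "circumcenter A' \<in> usphere" using circumcenter_props by blast
      then have "circumcenter A' \<in> ball c e" using True by (auto simp: K_def)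
      then show "norm (circumcenter A' - circumcenter A) < e"
        by (simp add: c_def dist_norm norm_minus_commute)
    qed simp
  next
    case False
    have A: "compact A" "A \<noteq> {}" "A \<subseteq> usphere" using assms(1) by (auto simp: hemi_set_def)
    obtain k a0 where k: "k \<in> K" "a0 \<in> A" "\<And>b. b \<in> A \<Longrightarrow> k \<bullet> a0 \<le> k \<bullet> b"
      and kmax: "\<And>c'. c' \<in> K \<Longrightarrow> \<exists>b\<in>A. c' \<bullet> b \<le> k \<bullet> a0"
      using sphere_maximin[OF A \<open>compact K\<close> False] by blast
    have "k \<noteq> c" using k(1) assms(2) by (auto simp: K_def)
    have Mm: "k \<bullet> a0 < m"
    proof (rule ccontr)
      assume "\<not> k \<bullet> a0 < m"
      then have "m \<le> k \<bullet> b" if "b \<in> A" for b using k(3)[OF that] by simp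
      then show False using m(4)[of k] k(1) \<open>k \<noteq> c\<close> by (auto simp: K_def)
    qed
    \<comment> \<open>One third of the gap: passing between the two sets costs
      \<open>\<delta>\<close> for the old center and \<open>\<delta>\<close> for the new one, and
      the remaining third gives the contradiction.\<close>
    define \<delta> where "\<delta> = (m - k \<bullet> a0) / 3"
    show ?thesis
    proof (rule that[of \<delta>])
      show "\<delta> > 0" using Mm by (simp add: \<delta>_def)
      fix A' :: "('n pt) set"
      assume A': "hemi_set A'" "\<And>a. a \<in> A \<Longrightarrow> \<exists>a'\<in>A'. norm (a - a') < \<delta>"
        "\<And>a'. a' \<in> A' \<Longrightarrow> \<exists>a\<in>A. norm (a - a') < \<delta>"
      define c' where "c' = circumcenter A'"
      from circumcenter_props[OF A'(1)] obtain m' where m': "c' \<in> usphere" "\<forall>a\<in>A'. m' \<le> c' \<bullet> a"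
        and mx: "\<forall>x\<in>usphere. \<exists>a\<in>A'. x \<bullet> a \<le> m'"
        unfolding c'_def[symmetric] by blast
      obtain a' where a': "a' \<in> A'" "c \<bullet> a' \<le> m'" using mx m(2) by blast
      obtain a where "a \<in> A" "norm (a' - a) < \<delta>" using A'(3)[OF a'(1)] by (metis norm_minus_commute)
      note a = a' this
      have "c \<bullet> a \<le> c \<bullet> a' + \<delta>" using close[OF _ a(4)] m(2) by simp
      then have lo: "m - \<delta> \<le> m'" using m(3)[OF a(3)] a(2) by simp
      have "c' \<notin> K"
      proof
        assume "c' \<in> K"
        then obtain b where b: "b \<in> A" "c' \<bullet> b \<le> k \<bullet> a0" using kmax by blast
        obtain b' where b': "b' \<in> A'" "norm (b - b') < \<delta>" using A'(2)[OF b(1)] by blast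
        have "c' \<bullet> b' \<le> c' \<bullet> b + \<delta>" using close[OF _ b'(2)] m'(1) by simp
        then have "m - \<delta> \<le> k \<bullet> a0 + \<delta>" using lo bspec[OF m'(2) b'(1)] b(2) by simp
        then show False using Mm by (simp add: \<delta>_def field_simps)
      qed
      then show "norm (circumcenter A' - circumcenter A) < e"
        using m'(1) by (simp add: K_def c_def c'_def dist_norm norm_minus_commute)
    qed
  qed
qed

section \<open>Differentials and Gauss maps\<close>

lemma diff_map_eq_dir_deriv: "diff_map f p w = dir_deriv w (f \<circ> tau) p"
  by (simp add: diff_map_def dir_deriv_def)

lemma smooth_maps_differentiable:
  assumes "f \<in> smooth_maps Y" "q \<in> off_axis"
  shows "(f \<circ> tau) differentiable at q"
proof -
  have "iter_deriv [] (f \<circ> tau) differentiable at q"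
    using assms unfolding smooth_maps_iff smooth_on_open_def by blast
  then show ?thesis by simp
qed

lemma has_derivative_off_axis:
  assumes "f \<in> smooth_maps Y" "q \<in> off_axis"
  shows "((f \<circ> tau) has_derivative (\<lambda>w. dir_deriv w (f \<circ> tau) q)) (at q)"
  by (rule has_derivative_dir_deriv[OF smooth_maps_differentiable[OF assms]])

lemma has_derivative_diff_map:
  assumes "f \<in> smooth_maps Y" "p \<in> equator"
  shows "((f \<circ> tau) has_derivative diff_map f p) (at p)"
  using has_derivative_off_axis[OF assms(1) subsetD[OF equator_subset_off_axis assms(2)]]
  by (simp add: diff_map_eq_dir_deriv[abs_def])

lemma smooth_maps_mapsto: "f \<in> smooth_maps Y \<Longrightarrow> p \<in> equator \<Longrightarrow> f p \<in> Y"
  by (auto simp: smooth_maps_def PiE_def Pi_def)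

lemma smooth_maps_extensional: "f \<in> smooth_maps Y \<Longrightarrow> f \<in> extensional equator"
  by (auto simp: smooth_maps_def PiE_def)

lemma equator_subset_usphere: "equator \<subseteq> usphere"
  by (auto simp: equator_def)

lemma smooth_maps_mono: "Y \<subseteq> Z \<Longrightarrow> smooth_maps Y \<subseteq> smooth_maps Z"
  by (auto simp: smooth_maps_def PiE_def Pi_def)

lemma derivative_zero_const_along:
  fixes F :: "'a::real_normed_vector \<Rightarrow> 'b::real_normed_vector"
  assumes "(F has_derivative F') (at p)" "\<And>s::real. \<bar>s\<bar> < 1 \<Longrightarrow> F (p + s *\<^sub>R v) = F p"
  shows "F' v = 0"
proof -
  have "((\<lambda>s::real. p + s *\<^sub>R v) has_derivative (\<lambda>s. s *\<^sub>R v)) (at 0)"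
    by (auto intro!: derivative_eq_intros)
  moreover have "(F has_derivative F') (at (p + 0 *\<^sub>R v))" using assms(1) by simp
  ultimately have 1: "((\<lambda>s::real. F (p + s *\<^sub>R v)) has_derivative (\<lambda>s. F' (s *\<^sub>R v))) (at 0)"
    by (rule has_derivative_compose[where f = "\<lambda>s::real. p + s *\<^sub>R v" and s = UNIV])
  have "((\<lambda>s::real. F p) has_derivative (\<lambda>s. 0)) (at 0)" by (rule has_derivative_const)
  then have 2: "((\<lambda>s::real. F (p + s *\<^sub>R v)) has_derivative (\<lambda>s. 0)) (at 0)"
    by (rule has_derivative_transform_open[of _ _ _ "{-1<..<1}"]) (auto simp: assms(2))
  from has_derivative_unique[OF 1 2] have "F' (1 *\<^sub>R v) = 0" by (rule fun_cong)
  then show ?thesis by simp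
qed

lemma horizontal_add: "horizontal (x + y) = horizontal x + horizontal y"
  by (simp add: horizontal_def inner_add_left algebra_simps)

lemma horizontal_scale: "horizontal (s *\<^sub>R x) = s *\<^sub>R horizontal x"
  by (simp add: horizontal_def algebra_simps)

lemma horizontal_e_last [simp]: "horizontal e_last = 0"
  by (simp add: horizontal_def)

lemma tau_ray:
  assumes "0 < s"
  shows "tau (s *\<^sub>R p + t *\<^sub>R e_last) = tau p"
  using assms by (simp add: tau_horizontal horizontal_add horizontal_scale)

text \<open>\<open>tau\<close> is constant along the ray through \<open>p\<close> and under
  translation by multiples of \<open>e_last\<close>.\<close>

lemma diff_map_normal:
  assumes "f \<in> smooth_maps Y" "p \<in> equator"
  shows "diff_map f p p = 0" "diff_map f p e_last = 0"
proof -
  have "(f \<circ> tau) (p + s *\<^sub>R p) = (f \<circ> tau) p" if "\<bar>s\<bar> < 1" for s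
    using tau_ray[of "1 + s" p 0] that by (simp add: algebra_simps)
  then show "diff_map f p p = 0"
    by (rule derivative_zero_const_along[OF has_derivative_diff_map[OF assms]])
  have "(f \<circ> tau) (p + s *\<^sub>R e_last) = (f \<circ> tau) p" for s
    using tau_ray[of 1 p s] by simp
  then show "diff_map f p e_last = 0"
    by (rule derivative_zero_const_along[OF has_derivative_diff_map[OF assms]])
qed

lemma derivative_const_inner:
  fixes F :: "'a::real_normed_vector \<Rightarrow> 'b::real_inner"
  assumes "(F has_derivative F') (at p)" "open U" "p \<in> U" "\<And>q. q \<in> U \<Longrightarrow> F q \<bullet> F q = 1"
  shows "F' w \<bullet> F p = 0"
proof -
  have 1: "((\<lambda>q. F q \<bullet> F q) has_derivative (\<lambda>w. F p \<bullet> F' w + F' w \<bullet> F p)) (at p)"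
    by (rule has_derivative_inner[OF assms(1,1)])
  have "((\<lambda>q. 1) has_derivative (\<lambda>w. 0)) (at p)" by (rule has_derivative_const)
  then have 2: "((\<lambda>q. F q \<bullet> F q) has_derivative (\<lambda>w. 0)) (at p)"
    by (rule has_derivative_transform_open[OF _ assms(2,3)]) (simp add: assms(4))
  from fun_cong[OF has_derivative_unique[OF 1 2], of w] show ?thesis
    by (simp add: inner_commute)
qed

lemma derivative_const_inner_left:
  fixes F :: "'a::real_normed_vector \<Rightarrow> 'b::real_inner"
  assumes "(F has_derivative F') (at p)" "open U" "p \<in> U" "\<And>q. q \<in> U \<Longrightarrow> F q \<bullet> c = 0"
  shows "F' w \<bullet> c = 0"
proof -
  have 1: "((\<lambda>q. F q \<bullet> c) has_derivative (\<lambda>w. F' w \<bullet> c)) (at p)"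
    by (rule has_derivative_inner_left[OF assms(1)])
  have "((\<lambda>q. 0) has_derivative (\<lambda>w. 0)) (at p)" by (rule has_derivative_const)
  then have 2: "((\<lambda>q. F q \<bullet> c) has_derivative (\<lambda>w. 0)) (at p)"
    by (rule has_derivative_transform_open[OF _ assms(2,3)]) (simp add: assms(4))
  from fun_cong[OF has_derivative_unique[OF 1 2], of w] show ?thesis by simp
qed

lemma tangent_map_diff_map:
  assumes "f \<in> smooth_maps usphere" "p \<in> equator"
  shows "tangent_map (diff_map f p) p (f p)"
  unfolding tangent_map_def
proof (intro conjI allI)
  show "linear (diff_map f p)" by (rule has_derivative_linear[OF has_derivative_diff_map[OF assms]])
  show "norm (f p) = 1" using smooth_maps_mapsto[OF assms] by simp
  fix w
  have "(f \<circ> tau) q \<bullet> (f \<circ> tau) q = 1" if "q \<in> off_axis" for q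
    using smooth_maps_mapsto[OF assms(1) tau_in_equator[OF that]] by (simp add: norm_eq_1)
  from derivative_const_inner[OF has_derivative_diff_map[OF assms] open_off_axis
      subsetD[OF equator_subset_off_axis assms(2)] this]
  show "diff_map f p w \<bullet> f p = 0" using tau_equator[OF assms(2)] by simp
qed (use assms(2) diff_map_normal[OF assms] in auto)

lemma diff_map_equator_inner_e_last:
  assumes "g \<in> smooth_maps equator" "p \<in> equator"
  shows "diff_map g p w \<bullet> e_last = 0"
proof -
  have "(g \<circ> tau) q \<bullet> e_last = 0" if "q \<in> off_axis" for q
    using equatorD(3)[OF smooth_maps_mapsto[OF assms(1) tau_in_equator[OF that]]] by simp
  from derivative_const_inner_left[OF has_derivative_diff_map[OF assms] open_off_axis
      subsetD[OF equator_subset_off_axis assms(2)] this]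
  show ?thesis .
qed

definition map_normal :: "('n pt \<Rightarrow> 'n pt) \<Rightarrow> 'n pt \<Rightarrow> ('n::{finite,wellorder}) pt"
  where "map_normal f p = normal_vec (diff_map f p) p (f p)"

text \<open>For a smooth map into the sphere, a nonzero value for some \<open>x\<close> means that
  \<open>f\<close> is immersed at \<open>p\<close>; the sign then tells on which side of the tangent
  hyperplane \<open>x\<close> lies, see \<open>gauss_map_inner\<close>.\<close>

definition map_det :: "('n pt \<Rightarrow> 'n pt) \<Rightarrow> 'n pt \<Rightarrow> ('n::{finite,wellorder}) pt \<Rightarrow> real"
  where "map_det f p x = frame_det (diff_map f p) p (f p) x"

lemma map_det_inner:
  assumes "f \<in> smooth_maps usphere" "p \<in> equator"
  shows "map_det f p x = map_normal f p \<bullet> x"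
  unfolding map_det_def map_normal_def by (rule frame_det_inner[OF tangent_map_diff_map[OF assms]])

lemma immersionsD:
  assumes "f \<in> immersions"
  shows "f \<in> smooth_maps usphere" "p \<in> equator \<Longrightarrow> inj_on (diff_map f p) (tangent_equator p)"
  using assms by (auto simp: immersions_def)

lemma map_normal_nonzero:
  assumes "f \<in> immersions" "p \<in> equator"
  shows "map_normal f p \<noteq> 0"
  unfolding map_normal_def
  using immersionsD[OF assms(1)] assms(2) by (intro normal_vec_nonzero tangent_map_diff_map)

text \<open>The defining property ranges over all positive orthonormal frames. By
  \<open>normal_frame_iff\<close> each of them gives the same vector, and the existence of one frame
  yields uniqueness.\<close>

lemma gauss_map_eq:
  fixes f :: "'n pt \<Rightarrow> ('n::{finite,wellorder}) pt"
  assumes "f \<in> immersions" "p \<in> equator" "CARD('n) > 2"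
  shows "gauss_map f p = - map_normal f p /\<^sub>R norm (map_normal f p)"
proof -
  have T: "tangent_map (diff_map f p) p (f p)" "inj_on (diff_map f p) (tangent_equator p)"
    using immersionsD[OF assms(1)] assms(2) tangent_map_diff_map by auto
  obtain us where us: "pos_frame_equator p us" "orthonormal_list (map (diff_map f p) us)"
    using orthonormal_pos_frame_exists[OF T assms(3)] .
  show ?thesis
    unfolding gauss_map_def map_normal_def
    by (rule the_equality) (use normal_frame_iff[OF T] us in blast)+
qed

lemma gauss_map_inner:
  fixes f :: "'n pt \<Rightarrow> ('n::{finite,wellorder}) pt"
  assumes "f \<in> immersions" "p \<in> equator" "CARD('n) > 2"
  shows "norm (gauss_map f p) = 1" "gauss_map f p \<bullet> x > 0 \<longleftrightarrow> map_det f p (- x) > 0"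
  using map_normal_nonzero[OF assms(1,2)]
  by (simp_all add: gauss_map_eq[OF assms] map_det_inner[OF immersionsD(1)[OF assms(1)] assms(2)]
      zero_less_mult_iff mult_less_0_iff)

lemma immersions_if_map_det:
  assumes "f \<in> smooth_maps usphere" "\<And>p. p \<in> equator \<Longrightarrow> \<exists>x. map_det f p x \<noteq> 0"
  shows "f \<in> immersions"
  using assms frame_det_nonzero_inj[OF tangent_map_diff_map[OF assms(1)]]
  unfolding immersions_def map_det_def by blast

section \<open>Continuity of the Gauss map\<close>

lemma continuous_map_det:
  fixes A :: "'z \<Rightarrow> real^'n^'n"
  assumes "\<And>i j. continuous_map Z euclideanreal (\<lambda>z. A z $ i $ j)"
  shows "continuous_map Z euclideanreal (\<lambda>z. det (A z))"
  unfolding det_def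
  by (intro continuous_map_sum continuous_map_real_mult continuous_map_prod assms
      continuous_map_const[THEN iffD2]) (auto simp: finite_permutations)

lemma continuous_map_inner_right:
  fixes f :: "'z \<Rightarrow> 'a::real_inner"
  assumes "continuous_map Z euclidean f" "continuous_map Z euclidean g"
  shows "continuous_map Z euclideanreal (\<lambda>z. f z \<bullet> g z)"
  by (rule continuous_map_bilinear[OF bounded_bilinear_inner assms])

lemma continuous_map_scaleR:
  fixes g :: "'z \<Rightarrow> 'a::real_normed_vector"
  assumes "continuous_map Z euclideanreal f" "continuous_map Z euclidean g"
  shows "continuous_map Z euclidean (\<lambda>z. f z *\<^sub>R g z)"
  by (rule continuous_map_bilinear[OF bounded_bilinear_scaleR assms])

lemma continuous_map_vec_nth:
  fixes f :: "'z \<Rightarrow> 'a::topological_space^'n"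
  assumes "continuous_map Z euclidean f"
  shows "continuous_map Z euclidean (\<lambda>z. f z $ i)"
  using continuous_map_euclidean_compose[OF assms, of UNIV "\<lambda>x. x $ i"]
  by (simp add: continuous_on_component)

lemma continuous_map_vec_lambda:
  fixes f :: "'z \<Rightarrow> 'n::finite \<Rightarrow> 'a::real_normed_vector"
  assumes "\<And>i. continuous_map Z euclidean (\<lambda>z. f z i)"
  shows "continuous_map Z euclidean (\<lambda>z. \<chi> i. f z i)"
proof (rule continuous_map_to_real_normedI)
  fix z and e :: real assume z: "z \<in> topspace Z" and "e > 0"
  \<comment> \<open>The sum of the componentwise differences is then at most \<open>e / 2\<close>,
    hence strictly below \<open>e\<close>.\<close>
  define d where "d = e / (2 * CARD('n))"
  have "d > 0" using \<open>e > 0\<close> by (simp add: d_def)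
  then have "\<exists>W. openin Z W \<and> z \<in> W \<and> (\<forall>y\<in>W. norm (f y i - f z i) < d)" for i
    using continuous_map_to_real_normedD[OF assms z] by blast
  then obtain W where W: "\<And>i. openin Z (W i)" "\<And>i. z \<in> W i"
    "\<And>i y. y \<in> W i \<Longrightarrow> norm (f y i - f z i) < d" by metis
  have "openin Z (\<Inter>i. W i)" using W(1) by (intro openin_INT2) auto
  moreover have "norm ((\<chi> i. f y i) - (\<chi> i. f z i)) < e" if "y \<in> (\<Inter>i. W i)" for y
  proof -
    have "norm ((\<chi> i. f y i) - (\<chi> i. f z i)) \<le> (\<Sum>i\<in>UNIV. norm (((\<chi> i. f y i) - (\<chi> i. f z i)) $ i))"
      by (simp only: norm_vec_def) (rule L2_set_le_sum, simp)
    also have "\<dots> \<le> (\<Sum>i\<in>(UNIV :: 'n set). d)"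
      using W(3) that by (intro sum_mono) (auto intro: less_imp_le)
    also have "\<dots> < e" using \<open>e > 0\<close> by (simp add: d_def)
    finally show ?thesis .
  qed
  ultimately show "\<exists>W. openin Z W \<and> z \<in> W \<and>
      (\<forall>y\<in>W. norm ((\<chi> i. f y i) - (\<chi> i. f z i)) < e)"
    using W(2) by blast
qed

text \<open>The entries of the normal are polynomials in the point, the value and the first
  derivatives, all of which depend continuously on map and point.\<close>

lemma jointly_cont_map_normal:
  "jointly_cont (smooth_topology usphere) equator
    (map_normal :: ('n pt \<Rightarrow> 'n pt) \<Rightarrow> 'n pt \<Rightarrow> ('n::{finite,wellorder}) pt)"
proof -
  let ?X = "smooth_topology usphere :: ('n pt \<Rightarrow> 'n pt) topology"
  let ?Z = "prod_topology ?X (top_of_set equator)"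
  note jc = smooth_family_smooth_topology[of usphere, unfolded smooth_family_iff_iter_deriv]
  have D: "continuous_map ?Z euclidean (\<lambda>z. diff_map (fst z) (snd z) w)" for w
  proof -
    have "jointly_cont ?X off_axis (\<lambda>f. iter_deriv [w] (f \<circ> tau))" using jc by blast
    from jointly_cont_subset[OF this equator_subset_off_axis]
    show ?thesis by (simp add: jointly_cont_def diff_map_def)
  qed
  have F: "continuous_map ?Z euclidean (\<lambda>z. (fst z) (snd z))"
  proof -
    have "jointly_cont ?X off_axis (\<lambda>f. iter_deriv [] (f \<circ> tau))" using jc by blast
    from jointly_cont_subset[OF this equator_subset_off_axis]
    have "jointly_cont ?X equator (\<lambda>f. f \<circ> tau)" by simp
    then have "jointly_cont ?X equator (\<lambda>f. f)"
      by (subst (asm) jointly_cont_cong[where \<psi> = "\<lambda>f. f"]) (simp_all add: tau_equator)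
    then show ?thesis by (simp add: jointly_cont_def)
  qed
  have S: "continuous_map ?Z euclidean (\<lambda>z. snd z)"
    using jointly_cont_of_snd[of equator "\<lambda>p. p" ?X] by (simp add: jointly_cont_def)
  have "continuous_map ?Z euclidean (\<lambda>z. frame_map (diff_map (fst z) (snd z)) (snd z) (fst z (snd z)) x w)"
    for x w
    unfolding frame_map_def
    by (intro continuous_map_add continuous_map_scaleR continuous_map_inner_right D F S
        continuous_map_const[THEN iffD2]) auto
  then have "continuous_map ?Z euclideanreal
      (\<lambda>z. frame_det (diff_map (fst z) (snd z)) (snd z) (fst z (snd z)) x)" for x
    unfolding frame_det_def matrix_def
    by (intro continuous_map_det) (simp add: continuous_map_vec_nth)
  then show ?thesis
    unfolding jointly_cont_def map_normal_def normal_vec_def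
    by (intro continuous_map_vec_lambda)
qed

definition immersion_top :: "('n pt \<Rightarrow> ('n::{finite,wellorder}) pt) topology"
  where "immersion_top = subtopology (smooth_topology usphere) immersions"

lemma topspace_immersion_top: "topspace immersion_top = immersions"
  by (auto simp: immersion_top_def dest: immersionsD)

lemma jointly_cont_gauss_map:
  assumes "CARD('n::{finite,wellorder}) > 2"
  shows "jointly_cont immersion_top equator
    (gauss_map :: ('n pt \<Rightarrow> 'n pt) \<Rightarrow> 'n pt \<Rightarrow> 'n pt)"
proof -
  have "continuous_map immersion_top (smooth_topology usphere) (\<lambda>f :: 'n pt \<Rightarrow> 'n pt. f)"
    unfolding immersion_top_def by (rule continuous_map_from_subtopology) (rule continuous_map_id[unfolded id_def])
  from jointly_cont_reparam[OF jointly_cont_map_normal this]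
  have N: "jointly_cont immersion_top equator (map_normal :: ('n pt \<Rightarrow> 'n pt) \<Rightarrow> 'n pt \<Rightarrow> 'n pt)" .
  have "jointly_cont immersion_top equator
      (\<lambda>(f :: 'n pt \<Rightarrow> 'n pt) p. - map_normal f p /\<^sub>R norm (map_normal f p))"
    by (rule jointly_cont_compose[OF N, of "-{0}" "\<lambda>x. - x /\<^sub>R norm x"])
      (auto intro!: continuous_intros simp: topspace_immersion_top map_normal_nonzero)
  then show ?thesis
    by (subst (asm) jointly_cont_cong[where \<psi> = gauss_map])
      (simp_all add: topspace_immersion_top gauss_map_eq assms)
qed

lemma equator_nonempty:
  assumes "CARD('n::{finite,wellorder}) > 2"
  shows "(equator :: ('n pt) set) \<noteq> {}"
proof -
  have "UNIV \<noteq> {Max UNIV :: 'n}"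
  proof
    assume U: "UNIV = {Max UNIV :: 'n}"
    have "card (UNIV :: 'n set) = 1" by (subst U) simp
    then show False using assms by simp
  qed
  then obtain i :: 'n where "i \<noteq> Max UNIV" by blast
  then have "axis i 1 \<in> (equator :: ('n pt) set)"
    by (simp add: equator_def e_last_def inner_axis_axis)
  then show ?thesis by blast
qed

lemma hemi_set_dual_image:
  fixes f :: "'n pt \<Rightarrow> ('n::{finite,wellorder}) pt"
  assumes "f \<in> hemi_immersions" "CARD('n) > 2"
  shows "hemi_set (dual_image f)"
proof -
  have f: "f \<in> immersions" using assms(1) by (simp add: hemi_immersions_def)
  have "continuous_map (top_of_set equator) (prod_topology immersion_top (top_of_set equator)) (\<lambda>p. (f, p))"
    using f by (intro continuous_map_pairedI) (auto simp: topspace_immersion_top)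
  from continuous_map_compose[OF this jointly_cont_gauss_map[OF assms(2), unfolded jointly_cont_def]]
  have "continuous_on equator (gauss_map f)" by (simp add: o_def)
  then have "compact (dual_image f)"
    unfolding dual_image_def by (rule compact_continuous_image[OF _ compact_equator])
  moreover have "dual_image f \<noteq> {}"
    using equator_nonempty[OF assms(2)] by (simp add: dual_image_def)
  moreover have "dual_image f \<subseteq> usphere"
    using gauss_map_inner(1)[OF f _ assms(2)] by (auto simp: dual_image_def)
  ultimately show ?thesis using assms(1) by (auto simp: hemi_set_def hemi_immersions_def)
qed

definition dual_center :: "('n pt \<Rightarrow> 'n pt) \<Rightarrow> ('n::{finite,wellorder}) pt"
  where "dual_center f = circumcenter (dual_image f)"

lemma dual_center_props:
  fixes f :: "'n pt \<Rightarrow> ('n::{finite,wellorder}) pt"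
  assumes "f \<in> hemi_immersions" "CARD('n) > 2"
  shows "norm (dual_center f) = 1" "p \<in> equator \<Longrightarrow> gauss_map f p \<bullet> dual_center f > 0"
proof -
  from circumcenter_props[OF hemi_set_dual_image[OF assms]] obtain m where m: "m > 0"
    "dual_center f \<in> usphere" "\<forall>a\<in>dual_image f. m \<le> dual_center f \<bullet> a"
    unfolding dual_center_def by blast
  show "norm (dual_center f) = 1" using m(2) by simp
  show "gauss_map f p \<bullet> dual_center f > 0" if "p \<in> equator"
  proof -
    have "m \<le> dual_center f \<bullet> gauss_map f p" using m(3) that by (simp add: dual_image_def)
    then show ?thesis using m(1) by (simp add: inner_commute)
  qed
qed

text \<open>Since the equator is compact, nearby maps have uniformly close Gauss maps; their dual
  images are then close in Hausdorff distance and \<open>circumcenter_continuous\<close>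
  applies.\<close>

lemma continuous_map_dual_center:
  assumes "CARD('n::{finite,wellorder}) > 2"
  shows "continuous_map hemi_top euclidean (dual_center :: ('n pt \<Rightarrow> 'n pt) \<Rightarrow> 'n pt)"
proof (rule continuous_map_to_real_normedI)
  fix f :: "'n pt \<Rightarrow> 'n pt" and e :: real
  assume f: "f \<in> topspace hemi_top" and e: "e > 0"
  then have f: "f \<in> hemi_immersions" by (simp add: hemi_top_def)
  then have fi: "f \<in> immersions" by (simp add: hemi_immersions_def)
  obtain \<delta> where \<delta>: "\<delta> > 0"
    "\<And>A'. hemi_set A' \<Longrightarrow> (\<And>a. a \<in> dual_image f \<Longrightarrow> \<exists>a'\<in>A'. norm (a - a') < \<delta>) \<Longrightarrow>
      (\<And>a'. a' \<in> A' \<Longrightarrow> \<exists>a\<in>dual_image f. norm (a - a') < \<delta>) \<Longrightarrow>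
      norm (circumcenter A' - circumcenter (dual_image f)) < e"
    by (rule circumcenter_continuous[OF hemi_set_dual_image[OF f assms] e]) blast
  have "continuous_map (top_of_set equator) (prod_topology immersion_top (top_of_set equator)) (\<lambda>p. (f, p))"
    using fi by (intro continuous_map_pairedI) (auto simp: topspace_immersion_top)
  from continuous_map_compose[OF this jointly_cont_gauss_map[OF assms, unfolded jointly_cont_def]]
  have cont: "continuous_on equator (gauss_map f)" by (simp add: o_def)
  have ft: "f \<in> topspace immersion_top" using fi by (simp add: topspace_immersion_top)
  obtain V where V: "openin immersion_top V" "f \<in> V"
    "\<And>h p. h \<in> V \<Longrightarrow> p \<in> equator \<Longrightarrow> norm (gauss_map h p - gauss_map f p) < \<delta>"
    by (rule jointly_cont_uniform[OF jointly_cont_gauss_map[OF assms] compact_equator ft cont, of \<delta>])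
      (use \<delta>(1) in auto)
  have "hemi_immersions \<subseteq> (immersions :: ('n pt \<Rightarrow> 'n pt) set)" by (auto simp: hemi_immersions_def)
  then have ht: "hemi_top = subtopology immersion_top (hemi_immersions :: ('n pt \<Rightarrow> 'n pt) set)"
    by (simp add: hemi_top_def immersion_top_def subtopology_subtopology Int_absorb1)
  have "openin hemi_top (V \<inter> hemi_immersions)"
    unfolding ht by (rule openin_subtopology_Int[OF V(1)])
  moreover have "norm (dual_center h - dual_center f) < e" if h: "h \<in> V \<inter> hemi_immersions" for h
    unfolding dual_center_def
  proof (rule \<delta>(2))
    show "hemi_set (dual_image h)" using h hemi_set_dual_image[OF _ assms] by blast
    show "\<exists>a'\<in>dual_image h. norm (a - a') < \<delta>" if a: "a \<in> dual_image f" for a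
    proof -
      obtain p where "p \<in> equator" "a = gauss_map f p" using a by (auto simp: dual_image_def)
      then show ?thesis using V(3)[of h p] h by (auto simp: dual_image_def norm_minus_commute)
    qed
    show "\<exists>a\<in>dual_image f. norm (a - a') < \<delta>" if a: "a' \<in> dual_image h" for a'
    proof -
      obtain p where "p \<in> equator" "a' = gauss_map h p" using a by (auto simp: dual_image_def)
      then show ?thesis using V(3)[of h p] h by (auto simp: dual_image_def norm_minus_commute)
    qed
  qed
  ultimately show "\<exists>W. openin hemi_top W \<and> f \<in> W \<and> (\<forall>h\<in>W. norm (dual_center h - dual_center f) < e)"
    using V(2) f by blast
qed

section \<open>Rotations\<close>

lemma SO_orthogonal_transformation: "Q \<in> SO \<Longrightarrow> orthogonal_transformation ((*v) Q)"
  by (simp add: SO_def orthogonal_transformation_matrix)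

lemma SO_inner: "Q \<in> SO \<Longrightarrow> (Q *v x) \<bullet> (Q *v y) = x \<bullet> y"
  using SO_orthogonal_transformation unfolding orthogonal_transformation_def by blast

lemma SO_norm: "Q \<in> SO \<Longrightarrow> norm (Q *v x) = norm x"
  by (simp add: norm_eq_sqrt_inner SO_inner)

lemma SO_transpose:
  assumes "Q \<in> SO"
  shows "transpose Q ** Q = mat 1" "Q ** transpose Q = mat 1" "transpose Q \<in> SO"
  using assms by (auto simp: SO_def orthogonal_matrix_def)

lemma SO_mult: "Q \<in> SO \<Longrightarrow> P \<in> SO \<Longrightarrow> Q ** P \<in> SO"
  by (simp add: SO_def orthogonal_matrix_mul det_mul)

lemma SO_matrix_inv:
  assumes "Q \<in> SO"
  shows "matrix_inv Q = transpose Q"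
proof -
  have "Q ** matrix_inv Q = mat 1 \<and> matrix_inv Q ** Q = mat 1"
    unfolding matrix_inv_def by (rule someI[of _ "transpose Q"]) (simp add: SO_transpose[OF assms])
  then have "matrix_inv Q ** (Q ** transpose Q) = transpose Q"
    by (simp add: matrix_mul_assoc)
  then show ?thesis by (simp add: SO_transpose(2)[OF assms])
qed

lemma SO_inverse:
  assumes "Q \<in> SO"
  shows "matrix_inv Q \<in> SO" "matrix_inv Q ** Q = mat 1" "Q ** matrix_inv Q = mat 1"
    "matrix_inv Q *v (Q *v x) = x" "Q *v (matrix_inv Q *v x) = x"
  using SO_transpose[OF assms]
  by (simp_all add: SO_matrix_inv[OF assms] matrix_vector_mul_assoc del: transpose_matrix_vector)

lemma SO_inner_inverse: "Q \<in> SO \<Longrightarrow> (matrix_inv Q *v x) \<bullet> y = x \<bullet> (Q *v y)"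
  using SO_inner[of Q "matrix_inv Q *v x" y] by (simp add: SO_inverse)

lemma matrix_vector_mult_neg: "(A :: real^'n^'m) *v (- x) = - (A *v x)"
  by (rule linear_neg[OF matrix_vector_mul_linear])

lemma SO_id: "mat 1 \<in> SO"
  by (simp add: SO_def orthogonal_matrix_def)

lemma bounded_bilinear_matrix_vector_mult:
  "bounded_bilinear ((*v) :: real^'n^'m \<Rightarrow> real^'n \<Rightarrow> real^'m)"
  unfolding bilinear_conv_bounded_bilinear[symmetric] bilinear_def
proof (intro conjI allI)
  show "linear ((*v) A)" for A :: "real^'n^'m" by (rule matrix_vector_mul_linear)
  show "linear (\<lambda>A :: real^'n^'m. A *v x)" for x
    by (rule linearI) (simp_all add: matrix_vector_mult_add_rdistrib scaleR_matrix_vector_assoc)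
qed

section \<open>Flattening a map along the direction of its center\<close>

definition flatten_vec :: "real \<Rightarrow> 'a \<Rightarrow> 'a \<Rightarrow> 'a::real_inner"
  where "flatten_vec t c y = y - (t * (y \<bullet> c)) *\<^sub>R c"

definition flatten_map ::
    "real \<Rightarrow> 'n pt \<Rightarrow> ('n pt \<Rightarrow> 'n pt) \<Rightarrow> 'n pt \<Rightarrow> ('n::{finite,wellorder}) pt"
  where "flatten_map t c f =
    restrict (\<lambda>p. flatten_vec t c (f p) /\<^sub>R norm (flatten_vec t c (f p))) equator"

text \<open>If the flattening vanished, \<open>y\<close> would be a multiple of \<open>c\<close>;
  pairing with \<open>N\<close>, which is orthogonal to \<open>y\<close> but not to
  \<open>c\<close>, excludes this. In the application \<open>N\<close> is the normal of the map at
  \<open>y\<close>.\<close>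

lemma flatten_vec_nonzero:
  assumes "norm y = 1" "norm c = 1" "N \<bullet> y = 0" "N \<bullet> c \<noteq> 0" "t \<in> {0..1}"
  shows "flatten_vec t c y \<noteq> 0"
proof
  assume "flatten_vec t c y = 0"
  then have y: "y = (t * (y \<bullet> c)) *\<^sub>R c" by (simp add: flatten_vec_def)
  then have "N \<bullet> y = (t * (y \<bullet> c)) * (N \<bullet> c)" by (metis inner_scaleR_right)
  then have "t * (y \<bullet> c) = 0" using assms(3,4) by simp
  then have "y = 0" using y by (metis scaleR_zero_left)
  then show False using assms(1) by simp
qed

text \<open>Time and center vary with the parameter, so the same statement serves a single
  flattening, its dependence on the map and the homotopy.\<close>

lemma smooth_family_flatten:
  fixes F :: "'x \<Rightarrow> 'n pt \<Rightarrow> ('n::{finite,wellorder}) pt"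
  assumes "open U" "K \<subseteq> U" "smooth_family X U K F" "continuous_map X euclideanreal t"
    "continuous_map X euclidean c"
    and "\<And>x q. x \<in> topspace X \<Longrightarrow> q \<in> U \<Longrightarrow> flatten_vec (t x) (c x) (F x q) \<noteq> 0"
  shows "smooth_family X U K
    (\<lambda>x q. flatten_vec (t x) (c x) (F x q) /\<^sub>R norm (flatten_vec (t x) (c x) (F x q)))"
proof -
  note tc = smooth_family_of_fst[OF assms(1,2,4)] smooth_family_of_fst[OF assms(1,2,5)]
  have "smooth_family X U K (\<lambda>x q. F x q \<bullet> c x)"
    by (rule smooth_family_bilinear[OF bounded_bilinear_inner assms(1,2,3) tc(2)])
  then have "smooth_family X U K (\<lambda>x q. t x * (F x q \<bullet> c x))"
    by (rule smooth_family_bilinear[OF bounded_bilinear_mult assms(1,2) tc(1)])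
  then have "smooth_family X U K (\<lambda>x q. (t x * (F x q \<bullet> c x)) *\<^sub>R c x)"
    by (rule smooth_family_bilinear[OF bounded_bilinear_scaleR assms(1,2) _ tc(2)])
  then have "smooth_family X U K (\<lambda>x q. flatten_vec (t x) (c x) (F x q))"
    unfolding flatten_vec_def by (rule smooth_family_diff[OF assms(1,2,3)])
  then show ?thesis by (rule smooth_family_normalize[OF assms(1,2)]) (rule assms(6))
qed

lemma map_det_pos_flatten_vec_nonzero:
  assumes "f \<in> smooth_maps usphere" "norm c = 1" "t \<in> {0..1}" "p \<in> equator" "map_det f p (- c) > 0"
  shows "flatten_vec t c (f p) \<noteq> 0"
proof (rule flatten_vec_nonzero[OF _ assms(2) _ _ assms(3)])
  show "norm (f p) = 1" using smooth_maps_mapsto[OF assms(1,4)] by simp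
  show "map_normal f p \<bullet> f p = 0"
    unfolding map_normal_def by (rule normal_vec_orthogonal(2)[OF tangent_map_diff_map[OF assms(1,4)]])
  show "map_normal f p \<bullet> c \<noteq> 0" using assms(5) by (auto simp: map_det_inner[OF assms(1,4)])
qed

lemma flatten_map_smooth:
  assumes "f \<in> smooth_maps usphere" "norm c = 1" "t \<in> {0..1}"
    and pos: "\<And>p. p \<in> equator \<Longrightarrow> map_det f p (- c) > 0"
  shows "flatten_map t c f \<in> smooth_maps usphere"
proof -
  have nz: "flatten_vec t c (f p) \<noteq> 0" if "p \<in> equator" for p
    by (rule map_det_pos_flatten_vec_nonzero[OF assms(1-3) that pos[OF that]])
  have "smooth_on_open off_axis (f \<circ> tau)" using assms(1) by (simp add: smooth_maps_iff)
  then have "smooth_family (top_of_set {0::real}) off_axis off_axis (\<lambda>_. f \<circ> tau)"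
    by (rule smooth_on_open_imp_smooth_family) simp
  then have "smooth_family (top_of_set {0::real}) off_axis off_axis
      (\<lambda>_ q. flatten_vec t c ((f \<circ> tau) q) /\<^sub>R norm (flatten_vec t c ((f \<circ> tau) q)))"
    by (rule smooth_family_flatten[OF open_off_axis order_refl]) (auto simp: tau_in_equator nz)
  then have "smooth_family (top_of_set {0::real}) off_axis off_axis (\<lambda>_. flatten_map t c f \<circ> tau)"
    by (subst (asm) smooth_family_cong[where \<psi> = "\<lambda>_. flatten_map t c f \<circ> tau"])
      (simp_all add: flatten_map_def tau_in_equator)
  then have "smooth_on_open off_axis (flatten_map t c f \<circ> tau)"
    by (rule smooth_family_imp_smooth_on_open[where x = 0]) simp
  then show ?thesis using nz by (auto simp: smooth_maps_iff flatten_map_def)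
qed

text \<open>The flattened map and its differential have the form required by
  \<open>frame_det_pos_shear\<close> with \<open>x = - c\<close>: flattening adds multiples of
  \<open>c\<close>, normalizing adds multiples of the position vector, and the rest is scaled by the
  positive factor \<open>s\<close>.\<close>

lemma flatten_map_det_pos:
  assumes "f \<in> smooth_maps usphere" "norm c = 1" "t \<in> {0..1}"
    and pos: "\<And>p. p \<in> equator \<Longrightarrow> map_det f p (- c) > 0" and p: "p \<in> equator"
  shows "map_det (flatten_map t c f) p (- c) > 0"
proof -
  have nz: "flatten_vec t c (f p) \<noteq> 0" if "p \<in> equator" for p
    by (rule map_det_pos_flatten_vec_nonzero[OF assms(1-3) that pos[OF that]])
  have fl: "flatten_map t c f \<in> smooth_maps usphere" by (rule flatten_map_smooth[OF assms(1-4)])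
  define D where "D = diff_map f p"
  define u where "u q = flatten_vec t c ((f \<circ> tau) q)" for q
  define U where "U w = D w - (t * (D w \<bullet> c)) *\<^sub>R c" for w
  have up: "u p = flatten_vec t c (f p)" by (simp add: u_def tau_equator[OF p])
  have u0: "u p \<noteq> 0" using nz[OF p] by (simp add: up)
  have dF: "((f \<circ> tau) has_derivative D) (at p)"
    unfolding D_def by (rule has_derivative_diff_map[OF assms(1) p])
  have du: "(u has_derivative U) (at p)"
    unfolding u_def[abs_def] U_def[abs_def] flatten_vec_def
    by (intro has_derivative_diff has_derivative_scaleR_left has_derivative_mult_right
        has_derivative_inner_left dF)
  \<comment> \<open>Differentiability of the normalizing factor suffices: its derivative enters as a
    multiple of \<open>u p\<close>, which is absorbed into the coefficients of \<open>f p\<close>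
    and \<open>- c\<close>.\<close>
  have "(\<lambda>q. inverse (norm (u q))) differentiable at p"
    using has_derivative_compose[OF du has_derivative_norm[OF u0]] u0
    by (intro differentiable_inverse) (auto simp: differentiable_def o_def)
  then obtain \<rho> where d\<rho>: "((\<lambda>q. inverse (norm (u q))) has_derivative \<rho>) (at p)"
    by (auto simp: differentiable_def)
  define s where "s = inverse (norm (u p))"
  have "((\<lambda>q. inverse (norm (u q)) *\<^sub>R u q) has_derivative (\<lambda>w. s *\<^sub>R U w + \<rho> w *\<^sub>R u p)) (at p)"
    unfolding s_def by (rule has_derivative_scaleR[OF d\<rho> du])
  then have "((flatten_map t c f \<circ> tau) has_derivative (\<lambda>w. s *\<^sub>R U w + \<rho> w *\<^sub>R u p)) (at p)"
    by (rule has_derivative_transform_open[OF _ open_off_axis subsetD[OF equator_subset_off_axis p]])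
      (simp add: flatten_map_def tau_in_equator u_def)
  then have D': "diff_map (flatten_map t c f) p w = s *\<^sub>R U w + \<rho> w *\<^sub>R u p" for w
    unfolding diff_map_eq_dir_deriv by (rule dir_deriv_eq)
  note T = tangent_mapD[OF tangent_map_diff_map[OF assms(1) p]]
  note T' = tangent_mapD[OF tangent_map_diff_map[OF fl p]]
  have flp: "flatten_map t c f p = s *\<^sub>R u p" using p by (simp add: flatten_map_def s_def up)
  have s0: "s > 0" using u0 by (simp add: s_def)
  show ?thesis
    unfolding map_det_def
  proof (rule frame_det_pos_shear[OF T(4,5,6) _ p T'(4,5,6)])
    show "frame_det (diff_map f p) p (f p) (- c) > 0" using pos[OF p] by (simp add: map_det_def)
    show "diff_map (flatten_map t c f) p w = s *\<^sub>R diff_map f p w + \<rho> w *\<^sub>R f p +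
        (s * t * (D w \<bullet> c) + \<rho> w * t * (f p \<bullet> c)) *\<^sub>R - c" for w
      unfolding D' up flatten_vec_def U_def D_def by (simp add: algebra_simps)
    show "flatten_map t c f p = s *\<^sub>R f p + (s * t * (f p \<bullet> c)) *\<^sub>R - c"
      unfolding flp up flatten_vec_def by (simp add: algebra_simps)
  qed (rule s0)+
qed

lemma hemi_immersions_map_det:
  fixes f :: "'n pt \<Rightarrow> ('n::{finite,wellorder}) pt"
  assumes "f \<in> hemi_immersions" "CARD('n) > 2" "p \<in> equator"
  shows "f \<in> immersions" "f \<in> smooth_maps usphere" "map_det f p (- dual_center f) > 0"
proof -
  show f: "f \<in> immersions" using assms(1) by (simp add: hemi_immersions_def)
  then show "f \<in> smooth_maps usphere" by (rule immersionsD)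
  show "map_det f p (- dual_center f) > 0"
    using gauss_map_inner(2)[OF f assms(3,2)] dual_center_props(2)[OF assms(1,2,3)] by simp
qed

lemma hemi_immersionsI:
  fixes f :: "'n pt \<Rightarrow> ('n::{finite,wellorder}) pt"
  assumes "f \<in> smooth_maps usphere" "norm c = 1" "CARD('n) > 2"
    and "\<And>p. p \<in> equator \<Longrightarrow> map_det f p (- c) > 0"
  shows "f \<in> hemi_immersions"
proof -
  have f: "f \<in> immersions"
    by (rule immersions_if_map_det[OF assms(1)]) (use assms(4) in \<open>blast dest: less_imp_neq[symmetric]\<close>)
  have "dual_image f \<subseteq> open_hemisphere c"
    using gauss_map_inner[OF f _ assms(3)] assms(4)
    by (auto simp: dual_image_def open_hemisphere_def)
  then show ?thesis using f assms(2) by (auto simp: hemi_immersions_def intro!: bexI[of _ c])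
qed

lemma flatten_map_hemi:
  fixes f :: "'n pt \<Rightarrow> ('n::{finite,wellorder}) pt"
  assumes "f \<in> hemi_immersions" "CARD('n) > 2" "t \<in> {0..1}"
  shows "flatten_map t (dual_center f) f \<in> hemi_immersions"
proof -
  note f = hemi_immersions_map_det[OF assms(1,2)]
  have sm: "f \<in> smooth_maps usphere" using assms(1) by (auto simp: hemi_immersions_def immersions_def)
  note c = dual_center_props(1)[OF assms(1,2)]
  show ?thesis
    by (rule hemi_immersionsI[OF flatten_map_smooth[OF sm c assms(3) f(3)] c assms(2)
        flatten_map_det_pos[OF sm c assms(3) f(3)]])
qed

lemma flatten_map_0:
  assumes "f \<in> smooth_maps usphere"
  shows "flatten_map 0 c f = f"
proof (rule extensionalityI[of _ equator])
  show "f \<in> extensional equator" by (rule smooth_maps_extensional[OF assms])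
  show "flatten_map 0 c f \<in> extensional equator" by (simp add: flatten_map_def)
  show "flatten_map 0 c f p = f p" if "p \<in> equator" for p
    using smooth_maps_mapsto[OF assms that] that by (simp add: flatten_map_def flatten_vec_def)
qed

section \<open>Composition with rotations\<close>

lemma compose_rotation_smooth:
  assumes "Q \<in> SO" "f \<in> smooth_maps usphere"
  shows "compose equator ((*v) Q) f \<in> smooth_maps usphere"
proof -
  have "smooth_on_open off_axis (f \<circ> tau)" using assms(2) by (simp add: smooth_maps_iff)
  then have "smooth_family (top_of_set {0::real}) off_axis off_axis (\<lambda>_. f \<circ> tau)"
    by (rule smooth_on_open_imp_smooth_family) simp
  from smooth_family_linear[OF matrix_vector_mul_bounded_linear open_off_axis order_refl this]
  have "smooth_family (top_of_set {0::real}) off_axis off_axis (\<lambda>_ q. Q *v (f \<circ> tau) q)" .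
  then have "smooth_family (top_of_set {0::real}) off_axis off_axis
      (\<lambda>_. compose equator ((*v) Q) f \<circ> tau)"
    by (subst (asm) smooth_family_cong[where \<psi> = "\<lambda>_. compose equator ((*v) Q) f \<circ> tau"])
      (simp_all add: compose_def tau_in_equator)
  then have "smooth_on_open off_axis (compose equator ((*v) Q) f \<circ> tau)"
    by (rule smooth_family_imp_smooth_on_open[where x = 0]) simp
  moreover have "norm (f p) = 1" if "p \<in> equator" for p
    using smooth_maps_mapsto[OF assms(2) that] by simp
  ultimately show ?thesis
    by (auto simp: smooth_maps_iff compose_def SO_norm[OF assms(1)])
qed

text \<open>Rotating multiplies the frame map from the left by \<open>Q\<close>, and
  \<open>det Q = 1\<close>.\<close>

lemma map_det_compose_rotation:
  assumes "Q \<in> SO" "f \<in> smooth_maps usphere" "p \<in> equator"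
  shows "map_det (compose equator ((*v) Q) f) p (Q *v x) = map_det f p x"
proof -
  have "((\<lambda>q. Q *v (f \<circ> tau) q) has_derivative (\<lambda>w. Q *v diff_map f p w)) (at p)"
    by (rule bounded_linear.has_derivative[OF matrix_vector_mul_bounded_linear
          has_derivative_diff_map[OF assms(2,3)]])
  then have "((compose equator ((*v) Q) f \<circ> tau) has_derivative (\<lambda>w. Q *v diff_map f p w)) (at p)"
    by (rule has_derivative_transform_open[OF _ open_off_axis subsetD[OF equator_subset_off_axis assms(3)]])
      (simp add: compose_def tau_in_equator)
  then have D: "diff_map (compose equator ((*v) Q) f) p w = Q *v diff_map f p w" for w
    unfolding diff_map_eq_dir_deriv by (rule dir_deriv_eq)
  have "frame_map (diff_map (compose equator ((*v) Q) f) p) p (compose equator ((*v) Q) f p) (Q *v x) =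
      (*v) Q \<circ> frame_map (diff_map f p) p (f p) x"
    unfolding fun_eq_iff frame_map_def D using assms(3)
    by (simp add: compose_def matrix_vector_right_distrib matrix_vector_mult_scaleR)
  moreover have "linear (frame_map (diff_map f p) p (f p) x)"
    by (rule linear_frame_map[OF tangent_mapD(4)[OF tangent_map_diff_map[OF assms(2,3)]]])
  ultimately show ?thesis
    using assms(1)
    by (simp add: map_det_def frame_det_def matrix_compose det_mul SO_def)
qed

section \<open>Rotated diffeomorphisms of the equator as immersions\<close>

lemma diff_plus_smooth: "g \<in> diff_plus \<Longrightarrow> g \<in> smooth_maps equator"
  "g \<in> diff_plus \<Longrightarrow> g \<in> smooth_maps usphere"
  using smooth_maps_mono[OF equator_subset_usphere] by (auto simp: diff_plus_def)

lemma pos_frame_equator_exists: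
  fixes p :: "('n::{finite,wellorder}) pt"
  assumes "p \<in> equator" "CARD('n) > 2"
  obtains us where "pos_frame_equator p us"
proof -
  \<comment> \<open>The orthogonal projection to the tangent space, which plays the part of the
    differential of the inclusion.\<close>
  define D where "D w = w - (w \<bullet> p) *\<^sub>R p - (w \<bullet> e_last) *\<^sub>R e_last" for w
  have "linear D"
    by (rule linearI) (simp_all add: D_def algebra_simps)
  then have "tangent_map D p p"
    using equatorD[OF assms(1)] assms(1) by (simp add: tangent_map_def D_def inner_diff_left)
  moreover have "inj_on D (tangent_equator p)"
    by (rule inj_onI) (simp add: D_def tangent_equator_def)
  ultimately show ?thesis using orthonormal_pos_frame_exists[OF _ _ assms(2)] that by blast
qed

text \<open>The orientation condition in \<open>diff_plus\<close> ranges over frames; the sign of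
  the determinant is read off from one positive frame, which exists by
  \<open>pos_frame_equator_exists\<close>.\<close>

lemma diff_plus_map_det:
  fixes g :: "'n pt \<Rightarrow> ('n::{finite,wellorder}) pt"
  assumes "g \<in> diff_plus" "p \<in> equator" "CARD('n) > 2"
  shows "map_det g p e_last > 0"
proof -
  obtain us where us: "pos_frame_equator p us"
    by (rule pos_frame_equator_exists[OF assms(2,3)])
  then have "pos_frame_equator (g p) (map (diff_map g p) us)"
    using assms(1,2) by (simp add: diff_plus_def)
  then have "det (rows_mat (map (diff_map g p) us @ [g p, e_last])) > 0"
    by (simp add: pos_frame_equator_def pos_oriented_iff)
  moreover have us': "set us \<subseteq> tangent_equator p" "length us + 2 = CARD('n)"
    "det (rows_mat (us @ [p, e_last])) > 0"
    using us by (auto simp: pos_frame_equator_def pos_oriented_iff)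
  ultimately show ?thesis
    using det_frame[OF tangent_map_diff_map[OF diff_plus_smooth(2)[OF assms(1)] assms(2)] us'(1,2)]
    by (simp add: map_det_def zero_less_mult_iff)
qed

lemma map_det_pos_frames:
  fixes g :: "'n pt \<Rightarrow> ('n::{finite,wellorder}) pt"
  assumes "g \<in> smooth_maps equator" "p \<in> equator" "map_det g p e_last > 0" "pos_frame_equator p us"
  shows "pos_frame_equator (g p) (map (diff_map g p) us)"
proof -
  have sm: "g \<in> smooth_maps usphere" using assms(1) smooth_maps_mono[OF equator_subset_usphere] by blast
  have us': "set us \<subseteq> tangent_equator p" "length us + 2 = CARD('n)"
    "det (rows_mat (us @ [p, e_last])) > 0"
    using assms(4) by (auto simp: pos_frame_equator_def pos_oriented_iff)
  have "det (rows_mat (map (diff_map g p) us @ [g p, e_last])) > 0"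
    using det_frame[OF tangent_map_diff_map[OF sm assms(2)] us'(1,2)] us'(3) assms(3)
    by (simp add: map_det_def)
  moreover have "diff_map g p u \<in> tangent_equator (g p)" for u
    using diff_map_equator_inner_e_last[OF assms(1,2)]
      tangent_mapD(7)[OF tangent_map_diff_map[OF sm assms(2)]]
    by (simp add: tangent_equator_def)
  ultimately show ?thesis using us'(2) by (auto simp: pos_frame_equator_def pos_oriented_iff)
qed

text \<open>The image lies in the great sphere orthogonal to \<open>Q *v e_last\<close>, so the
  Gauss map is constant and the dual image is a single point, its own center.\<close>

lemma rotated_diff_plus:
  fixes g :: "'n pt \<Rightarrow> ('n::{finite,wellorder}) pt"
  assumes "Q \<in> SO" "g \<in> diff_plus" "CARD('n) > 2"
  defines "f \<equiv> compose equator ((*v) Q) g"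
  shows "f \<in> hemi_immersions" "dual_center f = - (Q *v e_last)"
proof -
  define c where "c = Q *v e_last"
  have nc: "norm c = 1" by (simp add: c_def SO_norm[OF assms(1)])
  have sm: "f \<in> smooth_maps usphere"
    unfolding f_def by (rule compose_rotation_smooth[OF assms(1) diff_plus_smooth(2)[OF assms(2)]])
  have pos: "map_det f p c > 0" if "p \<in> equator" for p
    unfolding f_def c_def map_det_compose_rotation[OF assms(1) diff_plus_smooth(2)[OF assms(2)] that]
    by (rule diff_plus_map_det[OF assms(2) that assms(3)])
  have "norm (- c) = 1" using nc by simp
  then show hemi: "f \<in> hemi_immersions"
    by (rule hemi_immersionsI[OF sm _ assms(3)]) (simp add: pos)
  then have im: "f \<in> immersions" by (simp add: hemi_immersions_def)
  have fc: "(f \<circ> tau) q \<bullet> c = 0" if "q \<in> off_axis" for q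
    using equatorD(3)[OF smooth_maps_mapsto[OF diff_plus_smooth(1)[OF assms(2)] tau_in_equator[OF that]]]
    by (simp add: f_def c_def compose_def tau_in_equator[OF that] SO_inner[OF assms(1)])
  have "gauss_map f p = - c" if p: "p \<in> equator" for p
  proof -
    note off = subsetD[OF equator_subset_off_axis p]
    have T: "tangent_map (diff_map f p) p (f p)" by (rule tangent_map_diff_map[OF sm p])
    define N where "N = map_normal f p"
    have No: "N \<bullet> diff_map f p w = 0" "N \<bullet> f p = 0" for w
      unfolding N_def map_normal_def using normal_vec_orthogonal[OF T] by auto
    have co: "diff_map f p w \<bullet> c = 0" "f p \<bullet> c = 0" for w
      using derivative_const_inner_left[OF has_derivative_diff_map[OF sm p] open_off_axis off fc]
        fc[OF off] tau_equator[OF p] by auto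
    define L where "L = frame_map (diff_map f p) p (f p) c"
    have linL: "linear L" unfolding L_def by (rule linear_frame_map[OF tangent_mapD(4)[OF T]])
    have "det (matrix L) \<noteq> 0" using pos[OF p] by (simp add: map_det_def frame_det_def L_def)
    then have "surj L" using det_nz_iff_inj[OF linL] linear_injective_imp_surjective[OF linL] by blast
    \<comment> \<open>The part of \<open>N\<close> orthogonal to \<open>c\<close>. It is orthogonal
      to the range of the surjective frame map, hence 0.\<close>
    define z where "z = N - (N \<bullet> c) *\<^sub>R c"
    have co': "c \<bullet> diff_map f p w = 0" "c \<bullet> f p = 0" for w using co by (simp_all add: inner_commute)
    have cc: "c \<bullet> c = 1" using nc by (simp add: norm_eq_1)
    have "z \<bullet> L w = 0" for w
      unfolding z_def L_def frame_map_def
      by (simp add: inner_diff_left inner_add_right No co' cc)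
    moreover obtain w0 where "z = L w0" using surjD[OF \<open>surj L\<close>] by blast
    ultimately have "z \<bullet> z = 0" by simp
    then have N: "N = (N \<bullet> c) *\<^sub>R c" by (simp add: z_def)
    have "N \<bullet> c > 0" using pos[OF p] by (simp add: map_det_inner[OF sm p] N_def)
    with N obtain k where "k > 0" "N = k *\<^sub>R c" by blast
    then have "N /\<^sub>R norm N = c" using nc by simp
    then show ?thesis using gauss_map_eq[OF im p assms(3)] by (simp add: N_def)
  qed
  moreover have "(equator :: ('n pt) set) \<noteq> {}" by (rule equator_nonempty[OF assms(3)])
  ultimately have "dual_image f = {- c}" by (auto simp: dual_image_def)
  then show "dual_center f = - (Q *v e_last)"
    using circumcenter_singleton[of "- c"] nc by (simp add: dual_center_def c_def)
qed

section \<open>The projected map\<close>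

text \<open>\<open>Q\<close> carries the axis to the line of \<open>c\<close>, so deleting the last
  coordinate after rotating back is the same as deleting the component along \<open>c\<close>
  before. Hence the projected map is the completely flattened map up to rotation.\<close>

lemma horizontal_inverse_rotation:
  assumes "Q \<in> SO" "Q *v (- e_last) = c"
  shows "horizontal (matrix_inv Q *v y) = matrix_inv Q *v flatten_vec 1 c y"
proof -
  have Qe: "Q *v e_last = - c"
    using assms(2)[unfolded matrix_vector_mult_neg] by (metis minus_minus)
  then have "matrix_inv Q *v c = - e_last"
    using SO_inverse(4)[OF assms(1), of "- e_last"] assms(2) by simp
  then show ?thesis
    by (simp add: horizontal_def flatten_vec_def SO_inner_inverse[OF assms(1)] Qe
        matrix_vector_mult_diff_distrib matrix_vector_mult_scaleR)
qed

lemma projected_map_eq: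
  assumes "Q \<in> SO" "Q *v (- e_last) = c"
  shows "projected_map Q f = compose equator ((*v) (matrix_inv Q)) (flatten_map 1 c f)"
proof
  fix p
  show "projected_map Q f p = compose equator ((*v) (matrix_inv Q)) (flatten_map 1 c f) p"
    by (simp add: projected_map_def compose_def flatten_map_def tau_horizontal
        horizontal_inverse_rotation[OF assms] SO_norm[OF SO_inverse(1)[OF assms(1)]]
        matrix_vector_mult_scaleR)
qed

lemma projected_map_smooth:
  fixes f :: "'n pt \<Rightarrow> ('n::{finite,wellorder}) pt"
  assumes "f \<in> hemi_immersions" "CARD('n) > 2" "Q \<in> SO" "Q *v (- e_last) = dual_center f"
  shows "projected_map Q f \<in> smooth_maps equator"
    "p \<in> equator \<Longrightarrow> map_det (projected_map Q f) p e_last > 0"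
proof -
  define c where "c = dual_center f"
  have sm: "f \<in> smooth_maps usphere" using assms(1) by (auto simp: hemi_immersions_def immersions_def)
  have nc: "norm c = 1" unfolding c_def by (rule dual_center_props(1)[OF assms(1,2)])
  have pos: "map_det f p (- c) > 0" if "p \<in> equator" for p
    unfolding c_def by (rule hemi_immersions_map_det(3)[OF assms(1,2) that])
  have t1: "(1::real) \<in> {0..1}" by simp
  note fl = flatten_map_smooth[OF sm nc t1 pos]
  note Qi = SO_inverse[OF assms(3)]
  have Qc: "Q *v (- e_last) = c" using assms(4) by (simp add: c_def)
  have eq: "projected_map Q f = compose equator ((*v) (matrix_inv Q)) (flatten_map 1 c f)"
    by (rule projected_map_eq[OF assms(3) Qc])
  have us: "projected_map Q f \<in> smooth_maps usphere"
    unfolding eq by (rule compose_rotation_smooth[OF Qi(1) fl])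
  have "projected_map Q f p \<in> equator" if "p \<in> equator" for p
  proof -
    have "norm (flatten_vec 1 c (f p)) \<noteq> 0"
      using map_det_pos_flatten_vec_nonzero[OF sm nc t1 that pos[OF that]] by simp
    then have "matrix_inv Q *v f p \<in> off_axis"
      unfolding off_axis_def mem_Collect_eq horizontal_inverse_rotation[OF assms(3) Qc]
      using SO_norm[OF Qi(1), of "flatten_vec 1 c (f p)"] by (metis norm_zero)
    then show ?thesis using that by (simp add: projected_map_def tau_in_equator)
  qed
  then show "projected_map Q f \<in> smooth_maps equator"
    using us by (auto simp: smooth_maps_iff PiE_def)
  have "- c = Q *v e_last"
    using Qc[unfolded matrix_vector_mult_neg] by (metis minus_minus)
  \<comment> \<open>The two orientation conditions match: positivity with respect to
    \<open>- c\<close> becomes positivity with respect to \<open>e_last\<close>, the condition for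
    maps of the equator.\<close>
  then have e: "matrix_inv Q *v (- c) = e_last" using Qi(4) by simp
  show "map_det (projected_map Q f) p e_last > 0" if "p \<in> equator"
    using map_det_compose_rotation[OF Qi(1) fl that, of "- c"]
      flatten_map_det_pos[OF sm nc t1 pos that] by (simp add: eq e)
qed

section \<open>Local homeomorphisms of compact spaces\<close>

text \<open>Compactness makes the fibres finite and lets the sheets be shrunk until they are
  disjoint and exhaust the preimage of a neighbourhood. The image is open and closed in the
  connected \<open>T\<close>, hence all of it.\<close>

lemma local_homeo_compact_covering:
  fixes f :: "'a::metric_space \<Rightarrow> 'b::metric_space"
  assumes S: "compact S" "S \<noteq> {}" and T: "connected T"
    and cont: "continuous_on S f" and fST: "f ` S \<subseteq> T"
    and loc: "\<And>x. x \<in> S \<Longrightarrow> \<exists>U V q. x \<in> U \<and> openin (top_of_set S) U \<and>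
      openin (top_of_set T) V \<and> homeomorphism U V f q"
  shows "covering_space S f T"
proof
  obtain U V q where loc': "\<And>x. x \<in> S \<Longrightarrow> x \<in> U x \<and> openin (top_of_set S) (U x) \<and>
      openin (top_of_set T) (V x) \<and> homeomorphism (U x) (V x) f (q x)"
    using loc by metis
  have open_im: "openin (top_of_set T) (f ` W)"
    if "openin (top_of_set S) W" "W \<subseteq> U x" "x \<in> S" for W x
  proof -
    have "openin (top_of_set (U x)) W"
      using that openin_subset_trans[OF that(1,2)] loc'[OF that(3)] openin_imp_subset by blast
    then have "openin (top_of_set (V x)) (f ` W)"
      using homeomorphism_imp_open_map loc'[OF that(3)] by blast
    then show ?thesis using loc'[OF that(3)] openin_trans by blast
  qed
  show "f ` S = T"
  proof -
    have "f ` S = (\<Union>x\<in>S. f ` U x)"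
    proof
      show "f ` S \<subseteq> (\<Union>x\<in>S. f ` U x)" using loc' by blast
      show "(\<Union>x\<in>S. f ` U x) \<subseteq> f ` S" using loc' openin_imp_subset by blast
    qed
    moreover have "openin (top_of_set T) (\<Union>x\<in>S. f ` U x)"
      using open_im[OF _ order_refl] loc' by (intro openin_Union) blast
    ultimately have "openin (top_of_set T) (f ` S)" by simp
    moreover have "closedin (top_of_set T) (f ` S)"
      using compact_continuous_image[OF cont S(1)] fST by (simp add: closed_subset compact_imp_closed)
    ultimately show ?thesis using T S(2) unfolding connected_clopen by blast
  qed
  note im = this
  show "continuous_on S f" by (rule cont)
  fix y assume y: "y \<in> T"
  define F where "F = S \<inter> f -` {y}"
  have "compact F"
  proof -
    have "closedin (top_of_set S) F" unfolding F_def using continuous_closedin_preimage[OF cont closed_singleton] by blast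
    then show ?thesis using S(1) closedin_compact by blast
  qed
  have Fne: "F \<noteq> {}" using im y by (auto simp: F_def)
  \<comment> \<open>\<open>f\<close> is injective on each \<open>U x\<close>, so every point of the
    fibre is isolated; a compact set with this property is finite.\<close>
  have single: "U x \<inter> F \<subseteq> {x}" if "x \<in> F" for x
  proof
    fix z assume z: "z \<in> U x \<inter> F"
    have "x \<in> S" "f z = f x" using z that by (simp_all add: F_def)
    moreover have "z \<in> U x" using z by simp
    ultimately show "z \<in> {x}" using loc'[of x] homeomorphism_apply1 by (metis singletonI)
  qed
  have "finite F"
  proof -
    have "\<exists>G. open G \<and> U x = S \<inter> G" if "x \<in> S" for x
      using loc'[OF that] by (simp add: openin_open)
    then obtain G where G: "\<And>x. x \<in> S \<Longrightarrow> open (G x) \<and> U x = S \<inter> G x" by metis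
    have "F \<subseteq> S" by (auto simp: F_def)
    have "F \<subseteq> (\<Union>x\<in>F. G x)" using G loc' \<open>F \<subseteq> S\<close> by blast
    then obtain C where C: "C \<subseteq> F" "finite C" "F \<subseteq> (\<Union>x\<in>C. G x)"
      using compactE_image[OF \<open>compact F\<close>, of F G] G \<open>F \<subseteq> S\<close> by blast
    have "F \<subseteq> C"
    proof
      fix z assume "z \<in> F"
      then obtain x where x: "x \<in> C" "z \<in> G x" using C by blast
      then have "z \<in> U x \<inter> F" using G[of x] \<open>z \<in> F\<close> \<open>F \<subseteq> S\<close> C(1) by blast
      then show "z \<in> C" using single[of x] x(1) C(1) by blast
    qed
    then show ?thesis using C(2) finite_subset by blast
  qed
  \<comment> \<open>A positive lower bound for the distances in the finite fibre; balls of radius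
    \<open>d / 2\<close> around its points are disjoint.\<close>
  obtain d where d: "d > 0" "\<And>x z. x \<in> F \<Longrightarrow> z \<in> F \<Longrightarrow> x \<noteq> z \<Longrightarrow> d \<le> dist x z"
  proof -
    have "\<exists>d>0. \<forall>z\<in>F. z \<noteq> x \<longrightarrow> d \<le> dist x z" for x
      using finite_set_avoid[OF \<open>finite F\<close>] .
    then obtain D where D: "\<And>x. D x > 0" "\<And>x z. z \<in> F \<Longrightarrow> z \<noteq> x \<Longrightarrow> D x \<le> dist x z" by metis
    have "Min (D ` F) > 0" using \<open>finite F\<close> Fne D(1) by simp
    moreover have "Min (D ` F) \<le> dist x z" if "x \<in> F" "z \<in> F" "x \<noteq> z" for x z
    proof -
      have "Min (D ` F) \<le> D x" using \<open>finite F\<close> that(1) by (intro Min_le) auto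
      also have "\<dots> \<le> dist x z" using D(2)[of z x] that by blast
      finally show ?thesis .
    qed
    ultimately show ?thesis using that by blast
  qed
  define W where "W x = U x \<inter> ball x (d / 2)" for x
  have FS: "x \<in> S" if "x \<in> F" for x using that by (simp add: F_def)
  have W: "openin (top_of_set S) (W x)" "x \<in> W x" "W x \<subseteq> U x" "W x \<subseteq> S" if "x \<in> F" for x
    using loc'[OF FS[OF that]] d(1) openin_imp_subset
    by (auto simp: W_def intro: openin_Int_open)
  have disj: "W x \<inter> W z = {}" if "x \<in> F" "z \<in> F" "x \<noteq> z" for x z
  proof (rule ccontr)
    assume "W x \<inter> W z \<noteq> {}"
    then obtain w where "dist x w < d / 2" "dist z w < d / 2" by (auto simp: W_def)
    then have "dist x z < d" using dist_triangle_less_add[of x w "d/2" z "d/2"] by (simp add: dist_commute)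
    then show False using d(2)[OF that] by simp
  qed
  \<comment> \<open>Removing the image of the compact rest of \<open>S\<close> ensures that every
    preimage of a point of \<open>N\<close> lies in one of the chosen sheets.\<close>
  define N where "N = (\<Inter>x\<in>F. f ` W x) - f ` (S - (\<Union>x\<in>F. W x))"
  have NT: "openin (top_of_set T) N"
  proof -
    have "openin (top_of_set T) (\<Inter>x\<in>F. f ` W x)"
      using open_im[OF W(1,3) FS] \<open>finite F\<close> Fne by (intro openin_INT2) auto
    moreover have "closedin (top_of_set T) (f ` (S - (\<Union>x\<in>F. W x)))"
    proof -
      have "openin (top_of_set S) (\<Union>x\<in>F. W x)" using W(1) by (intro openin_Union) blast
      then have "closedin (top_of_set S) (S - (\<Union>x\<in>F. W x))"
        by (simp add: closedin_def openin_imp_subset Diff_Diff_Int inf.absorb2)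
      then have "compact (S - (\<Union>x\<in>F. W x))" using S(1) closedin_compact by blast
      then have "compact (f ` (S - (\<Union>x\<in>F. W x)))"
        using compact_continuous_image continuous_on_subset[OF cont] by blast
      then show ?thesis using fST by (intro closed_subset compact_imp_closed) auto
    qed
    ultimately show ?thesis unfolding N_def by (rule openin_diff)
  qed
  have yN: "y \<in> N"
  proof -
    have "y \<in> f ` W x" if "x \<in> F" for x using W(2)[OF that] that by (auto simp: F_def)
    moreover have "y \<notin> f ` (S - (\<Union>x\<in>F. W x))" using W(2) by (auto simp: F_def)
    ultimately show ?thesis by (simp add: N_def)
  qed
  define sheet where "sheet x = W x \<inter> f -` N" for x
  show "\<exists>T'. y \<in> T' \<and> openin (top_of_set T) T' \<and> (\<exists>v. \<Union> v = S \<inter> f -` T' \<and>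
      (\<forall>u\<in>v. openin (top_of_set S) u) \<and> pairwise disjnt v \<and> (\<forall>u\<in>v. \<exists>q. homeomorphism u T' f q))"
  proof (intro exI conjI)
    show "y \<in> N" "openin (top_of_set T) N" by (rule yN, rule NT)
    show "\<Union> (sheet ` F) = S \<inter> f -` N"
      using W(4) by (auto simp: sheet_def N_def)
    have "openin (top_of_set S) (S \<inter> f -` N)"
      using continuous_openin_preimage[OF cont _ NT] fST by blast
    then have "openin (top_of_set S) (W x \<inter> (S \<inter> f -` N))" if "x \<in> F" for x
      using openin_Int[OF W(1)[OF that]] by blast
    moreover have "W x \<inter> (S \<inter> f -` N) = sheet x" if "x \<in> F" for x
      using W(4)[OF that] by (auto simp: sheet_def)
    ultimately show "\<forall>u\<in>sheet ` F. openin (top_of_set S) u" by auto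
    show "pairwise disjnt (sheet ` F)"
      using disj unfolding pairwise_def disjnt_def sheet_def by blast
    have "homeomorphism (sheet x) N f (q x)" if x: "x \<in> F" for x
    proof (rule homeomorphism_of_subsets)
      show "homeomorphism (U x) (V x) f (q x)" using loc'[OF FS[OF x]] by blast
      show "sheet x \<subseteq> U x" using W(3)[OF x] by (auto simp: sheet_def)
      show "V x \<subseteq> V x" by (rule order_refl)
      have "N \<subseteq> f ` W x" using x by (auto simp: N_def)
      then show "f ` sheet x = N" unfolding sheet_def by blast
    qed
    then show "\<forall>u\<in>sheet ` F. \<exists>q. homeomorphism u N f q" by blast
  qed
qed

text \<open>A path between two points of a fibre projects to a loop, which contracts; by monodromy
  the path ends where the constant lift ends.\<close>

lemma covering_space_simply_connected_inj:
  fixes p :: "'a::real_normed_vector \<Rightarrow> 'b::real_normed_vector"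
  assumes cov: "covering_space C p S" and C: "path_connected C" and S: "simply_connected S"
  shows "inj_on p C"
proof (rule inj_onI)
  fix a b assume ab: "a \<in> C" "b \<in> C" "p a = p b"
  obtain h where h: "path h" "path_image h \<subseteq> C" "pathstart h = a" "pathfinish h = b"
    using C ab unfolding path_connected_def by blast
  have pC: "p ` C = S" by (rule covering_space_imp_surjective[OF cov])
  have cont: "continuous_on C p" by (rule covering_space_imp_continuous[OF cov])
  have ph: "path (p \<circ> h)" using h(1,2) cont path_continuous_image continuous_on_subset by blast
  have im: "path_image (p \<circ> h) \<subseteq> S" using h(2) pC by (auto simp: path_image_compose)
  have ends: "pathstart (p \<circ> h) = p a" "pathfinish (p \<circ> h) = p a"
    using h(3,4) ab(3) by (simp_all add: pathstart_compose pathfinish_compose)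
  have hom: "homotopic_paths S (p \<circ> h) (linepath (p a) (p a))"
  proof -
    have "path r \<and> path_image r \<subseteq> S \<and> pathfinish r = pathstart r \<longrightarrow>
        homotopic_paths S r (linepath (pathstart r) (pathstart r))" for r
      using S unfolding simply_connected_eq_contractible_path by blast
    from this[of "p \<circ> h"] show ?thesis using ph im unfolding ends by blast
  qed
  have "pathfinish h = pathfinish (linepath a a)"
  proof (rule covering_space_monodromy[OF cov ph im _ _ hom h(1,2)])
    show "path (linepath (p a) (p a))" by simp
    show "path_image (linepath (p a) (p a)) \<subseteq> S" using ab(1) pC by auto
    show "path_image (linepath a a) \<subseteq> C" using ab(1) by simp
    show "pathstart h = pathstart (linepath a a)" using h(3) by simp
  qed simp_all
  then show "a = b" using h(4) by simp
qed

section \<open>Simple connectivity of the equator\<close>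

lemma equator_eq_rel_frontier:
  "(equator :: (('n::{finite,wellorder}) pt) set) = rel_frontier (cball 0 1 \<inter> {x. e_last \<bullet> x = 0})"
proof -
  have "0 \<in> interior (cball (0 :: 'n pt) 1) \<inter> {x. e_last \<bullet> x = 0}" by simp
  then have ne: "interior (cball (0 :: 'n pt) 1) \<inter> {x. e_last \<bullet> x = 0} \<noteq> {}" by blast
  have "rel_frontier (cball (0 :: 'n pt) 1 \<inter> {x. e_last \<bullet> x = 0}) =
      frontier (cball 0 1) \<inter> {x. e_last \<bullet> x = 0}"
    by (rule convex_affine_rel_frontier_Int[OF convex_cball affine_hyperplane ne])
  also have "\<dots> = equator"
    unfolding equator_def frontier_cball by (auto simp: inner_commute)
  finally show ?thesis by (rule sym)
qed

lemma aff_dim_equator_disc: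
  "aff_dim (cball (0 :: ('n::{finite,wellorder}) pt) 1 \<inter> {x. e_last \<bullet> x = 0}) = int CARD('n) - 1"
proof -
  have "aff_dim ({x :: 'n pt. e_last \<bullet> x = 0} \<inter> cball 0 1) = aff_dim {x :: 'n pt. e_last \<bullet> x = 0}"
  proof (rule aff_dim_convex_Int_nonempty_interior[OF convex_hyperplane])
    have "0 \<in> {x :: 'n pt. e_last \<bullet> x = 0} \<inter> interior (cball 0 1)" by simp
    then show "{x :: 'n pt. e_last \<bullet> x = 0} \<inter> interior (cball 0 1) \<noteq> {}" by blast
  qed
  then show ?thesis by (simp add: Int_commute aff_dim_hyperplane)
qed

text \<open>The equator bounds a disc of affine dimension \<open>CARD('n) - 1\<close>, and the
  boundary of a disc is simply connected once this dimension is at least 3. Here the circle has to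
  be excluded.\<close>

lemma simply_connected_equator:
  assumes "CARD('n::{finite,wellorder}) > 3"
  shows "simply_connected (equator :: ('n pt) set)"
  unfolding equator_eq_rel_frontier
proof (rule simply_connected_sphere_gen)
  show "convex (cball (0 :: 'n pt) 1 \<inter> {x. e_last \<bullet> x = 0})"
    by (intro convex_Int convex_cball convex_hyperplane)
  show "bounded (cball (0 :: 'n pt) 1 \<inter> {x. e_last \<bullet> x = 0})"
    by (intro bounded_Int disjI1 bounded_cball)
  show "3 \<le> aff_dim (cball (0 :: 'n pt) 1 \<inter> {x. e_last \<bullet> x = 0})"
    unfolding aff_dim_equator_disc using assms by simp
qed

section \<open>Local diffeomorphisms of the equator\<close>

text \<open>
  Extending maps of the equator to an open subset of the ambient space makes the inverse function
  theorem for Euclidean spaces applicable.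
\<close>

definition cone_map :: "('n pt \<Rightarrow> 'n pt) \<Rightarrow> 'n pt \<Rightarrow> ('n::{finite,wellorder}) pt"
  where "cone_map g q = norm (horizontal q) *\<^sub>R g (tau q) + (q \<bullet> e_last) *\<^sub>R e_last"

lemma decomp_off_axis: "q \<in> off_axis \<Longrightarrow> norm (horizontal q) *\<^sub>R tau q + (q \<bullet> e_last) *\<^sub>R e_last = q"
  by (simp add: tau_horizontal off_axis_def) (simp add: horizontal_def)

text \<open>In terms of radius, direction and height, the cone map changes the direction
  only.\<close>

lemma cone_map_coords:
  assumes "g (tau q) \<in> equator" "q \<in> off_axis"
  shows "horizontal (cone_map g q) = norm (horizontal q) *\<^sub>R g (tau q)"
    "norm (horizontal (cone_map g q)) = norm (horizontal q)"
    "tau (cone_map g q) = g (tau q)" "cone_map g q \<bullet> e_last = q \<bullet> e_last" "cone_map g q \<in> off_axis"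
proof -
  have r: "norm (horizontal q) > 0" using assms(2) by (simp add: off_axis_def)
  show h: "horizontal (cone_map g q) = norm (horizontal q) *\<^sub>R g (tau q)"
    by (simp add: cone_map_def horizontal_add horizontal_scale horizontal_equator[OF assms(1)])
  show n: "norm (horizontal (cone_map g q)) = norm (horizontal q)"
    by (simp add: h equatorD(1)[OF assms(1)])
  show "tau (cone_map g q) = g (tau q)" using r by (simp add: tau_horizontal[of "cone_map g q"] h equatorD(1)[OF assms(1)])
  show "cone_map g q \<bullet> e_last = q \<bullet> e_last" by (simp add: cone_map_def inner_add_left equatorD(3)[OF assms(1)])
  show "cone_map g q \<in> off_axis" using r n by (auto simp: off_axis_def)
qed

lemma cone_map_inverse:
  assumes "g (tau q) \<in> equator" "h (g (tau q)) = tau q" "q \<in> off_axis"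
  shows "cone_map h (cone_map g q) = q"
  unfolding cone_map_def[of h] cone_map_coords(2-4)[of g q, OF assms(1,3)] assms(2) by (rule decomp_off_axis[OF assms(3)])

lemma cone_map_equator: "p \<in> equator \<Longrightarrow> cone_map g p = g p"
  by (simp add: cone_map_def horizontal_equator equatorD tau_equator)

lemma cone_map_affine:
  assumes "s > 0"
  shows "cone_map g (s *\<^sub>R x + t *\<^sub>R e_last) = s *\<^sub>R cone_map g x + t *\<^sub>R e_last"
  using assms by (simp add: cone_map_def tau_ray horizontal_add horizontal_scale inner_add_left algebra_simps)

lemma smooth_family_cone_map:
  fixes g :: "'n pt \<Rightarrow> ('n::{finite,wellorder}) pt"
  assumes "g \<in> smooth_maps Y"
  shows "smooth_family X off_axis off_axis (\<lambda>_. cone_map g)"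
proof -
  have "smooth_family X off_axis off_axis (\<lambda>_. g \<circ> tau)"
    using assms by (intro smooth_on_open_imp_smooth_family) (simp_all add: smooth_maps_iff)
  moreover have "smooth_family X off_axis off_axis (\<lambda>_ q. norm (horizontal q))"
    by (rule smooth_family_norm[OF open_off_axis order_refl
        smooth_family_linear_snd[OF bounded_linear_horizontal open_off_axis order_refl]])
      (simp add: off_axis_def)
  ultimately have "smooth_family X off_axis off_axis (\<lambda>_ q. norm (horizontal q) *\<^sub>R (g \<circ> tau) q)"
    by (intro smooth_family_bilinear[OF bounded_bilinear_scaleR open_off_axis order_refl])
  moreover have "bounded_linear (\<lambda>q :: 'n pt. (q \<bullet> e_last) *\<^sub>R (e_last :: 'n pt))"
    by (intro bounded_linear_scaleR_const bounded_linear_inner_left)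
  then have "smooth_family X off_axis off_axis (\<lambda>_ q :: 'n pt. (q \<bullet> e_last) *\<^sub>R (e_last :: 'n pt))"
    by (rule smooth_family_linear_snd[OF _ open_off_axis order_refl])
  ultimately have "smooth_family X off_axis off_axis
      (\<lambda>_ q. norm (horizontal q) *\<^sub>R (g \<circ> tau) q + (q \<bullet> e_last) *\<^sub>R e_last)"
    by (rule smooth_family_add[OF open_off_axis order_refl])
  then show ?thesis by (simp add: cone_map_def[abs_def])
qed

lemma smooth_family_dir_deriv:
  assumes "smooth_family X U K \<phi>"
  shows "smooth_family X U K (\<lambda>x. dir_deriv v (\<phi> x))"
  using assms unfolding smooth_family_def by (metis Ck_family.simps(2))

lemma smooth_family_differentiable:
  assumes "smooth_family X U K \<phi>" "x \<in> topspace X" "p \<in> U"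
  shows "\<phi> x differentiable at p"
  using assms unfolding smooth_family_def by (metis Ck_family.simps(2))

lemma cone_map_has_derivative:
  assumes "g \<in> smooth_maps Y" "q \<in> off_axis"
  shows "(cone_map g has_derivative (\<lambda>w. dir_deriv w (cone_map g) q)) (at q)"
  using smooth_family_differentiable[OF smooth_family_cone_map[OF assms(1), of euclideanreal] _ assms(2), of 0]
  by (intro has_derivative_dir_deriv) simp

text \<open>The derivative is the frame map with \<open>x = e_last\<close>, so its determinant is
  \<open>map_det g p e_last\<close>: the orientation determinant becomes the Jacobian for the
  inverse function theorem.\<close>

lemma dir_deriv_cone_equator:
  assumes "g \<in> smooth_maps Y" "p \<in> equator"
  shows "dir_deriv w (cone_map g) p = frame_map (diff_map g p) p (g p) e_last w"
proof -
  have hp: "horizontal p \<noteq> 0" using subsetD[OF equator_subset_off_axis assms(2)] by (simp add: off_axis_def)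
  have "((\<lambda>q. norm (horizontal q)) has_derivative (\<lambda>w. horizontal w \<bullet> sgn (horizontal p))) (at p)"
    using has_derivative_compose[OF bounded_linear_imp_has_derivative[OF bounded_linear_horizontal]
        has_derivative_norm[OF hp]] by (simp add: inner_commute)
  moreover have "horizontal w \<bullet> sgn (horizontal p) = w \<bullet> p" for w
    by (simp add: horizontal_equator[OF assms(2)] sgn_div_norm equatorD[OF assms(2)])
      (simp add: horizontal_def inner_diff_left equatorD[OF assms(2)])
  ultimately have n: "((\<lambda>q. norm (horizontal q)) has_derivative (\<lambda>w. w \<bullet> p)) (at p)" by simp
  have "bounded_linear (\<lambda>q. (q \<bullet> e_last) *\<^sub>R (e_last :: 'a pt))"
    by (intro bounded_linear_scaleR_const bounded_linear_inner_left)
  from has_derivative_add[OF has_derivative_scaleR[OF n has_derivative_diff_map[OF assms]]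
      bounded_linear_imp_has_derivative[OF this]]
  have "(cone_map g has_derivative (\<lambda>w. norm (horizontal p) *\<^sub>R diff_map g p w +
      (w \<bullet> p) *\<^sub>R (g \<circ> tau) p + (w \<bullet> e_last) *\<^sub>R e_last)) (at p)"
    by (simp add: cone_map_def[abs_def])
  from dir_deriv_eq[OF this] show ?thesis
    by (simp add: frame_map_def horizontal_equator[OF assms(2)] equatorD[OF assms(2)] tau_equator[OF assms(2)])
qed

lemma dir_deriv_cone_map:
  assumes "g \<in> smooth_maps Y" "q \<in> off_axis"
  shows "dir_deriv w (cone_map g) q = frame_map (diff_map g (tau q)) (tau q) (g (tau q)) e_last w"
proof -
  define s t where "s = norm (horizontal q)" and "t = q \<bullet> e_last"
  have s: "s > 0" using assms(2) by (simp add: s_def off_axis_def)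
  have q: "q = s *\<^sub>R tau q + t *\<^sub>R e_last" unfolding s_def t_def by (rule decomp_off_axis[OF assms(2), symmetric])
  \<comment> \<open>The similarity that carries \<open>q\<close> to \<open>tau q\<close>. The cone
    map commutes with it, so its derivative at \<open>q\<close> equals the one at a point of the
    equator.\<close>
  define B where "B x = (1 / s) *\<^sub>R (x - t *\<^sub>R e_last)" for x :: "'a pt"
  have Bq: "B q = tau q" unfolding B_def by (subst q) (use s in simp)
  have eq: "cone_map g x = s *\<^sub>R cone_map g (B x) + t *\<^sub>R e_last" for x
    using cone_map_affine[OF s, of g "B x" t] s by (simp add: B_def)
  have fe: "(\<lambda>x. s *\<^sub>R cone_map g (B x) + t *\<^sub>R e_last) = cone_map g"
    by (rule ext) (rule eq[symmetric])
  have dB: "(B has_derivative (\<lambda>w. (1 / s) *\<^sub>R w)) (at q)"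
    unfolding B_def[abs_def] by (auto intro!: derivative_eq_intros)
  have off: "tau q \<in> off_axis" using tau_in_equator[OF assms(2)] equator_subset_off_axis by blast
  have "(cone_map g has_derivative (\<lambda>w. dir_deriv w (cone_map g) (tau q))) (at (B q))"
    unfolding Bq by (rule cone_map_has_derivative[OF assms(1) off])
  from has_derivative_compose[OF dB this]
  have "((\<lambda>x. s *\<^sub>R cone_map g (B x) + t *\<^sub>R e_last) has_derivative
      (\<lambda>w. s *\<^sub>R dir_deriv ((1 / s) *\<^sub>R w) (cone_map g) (tau q) + 0)) (at q)"
    by (intro has_derivative_add has_derivative_scaleR_right has_derivative_const)
  then have "(cone_map g has_derivative (\<lambda>w. s *\<^sub>R dir_deriv ((1 / s) *\<^sub>R w) (cone_map g) (tau q))) (at q)"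
    unfolding fe by simp
  then have "dir_deriv w (cone_map g) q = s *\<^sub>R dir_deriv ((1 / s) *\<^sub>R w) (cone_map g) (tau q)"
    by (rule dir_deriv_eq)
  also have "\<dots> = dir_deriv w (cone_map g) (tau q)"
    using s linear_scale[OF has_derivative_linear[OF cone_map_has_derivative[OF assms(1) off]], of "1 / s" w]
    by simp
  finally show ?thesis by (simp add: dir_deriv_cone_equator[OF assms(1) tau_in_equator[OF assms(2)]])
qed


lemma smooth_family_continuous_on:
  assumes "smooth_family (top_of_set {0::real}) U K (\<lambda>_. h)"
  shows "continuous_on K h"
proof -
  have "jointly_cont (top_of_set {0::real}) K (\<lambda>_. h)"
    using assms Ck_family_jointly_cont unfolding smooth_family_def by blast
  moreover have "continuous_map (top_of_set K) (prod_topology (top_of_set {0::real}) (top_of_set K)) (\<lambda>p. (0, p))"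
    by (intro continuous_map_pairedI) auto
  ultimately have "continuous_map (top_of_set K) euclidean
      ((\<lambda>z. h (snd z)) \<circ> (\<lambda>p. (0::real, p)))"
    unfolding jointly_cont_def using continuous_map_compose by blast
  then show ?thesis by (simp add: o_def)
qed

lemma det_dir_deriv_cone_map:
  fixes g :: "'n pt \<Rightarrow> ('n::{finite,wellorder}) pt"
  assumes "g \<in> smooth_maps equator" "q \<in> off_axis"
    and "\<And>p. p \<in> equator \<Longrightarrow> map_det g p e_last > 0"
  shows "det (matrix (\<lambda>w. dir_deriv w (cone_map g) q)) \<noteq> 0"
proof -
  have "(\<lambda>w. dir_deriv w (cone_map g) q) = frame_map (diff_map g (tau q)) (tau q) (g (tau q)) e_last"
    by (rule ext) (rule dir_deriv_cone_map[OF assms(1,2)])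
  then show ?thesis
    using assms(3)[OF tau_in_equator[OF assms(2)]] by (simp add: map_det_def frame_det_def)
qed

lemma cone_map_local_homeo:
  fixes g :: "'n pt \<Rightarrow> ('n::{finite,wellorder}) pt"
  assumes "g \<in> smooth_maps equator" "p \<in> equator"
    and "\<And>p. p \<in> equator \<Longrightarrow> map_det g p e_last > 0"
  obtains U V h where "p \<in> U" "U \<subseteq> off_axis" "open U" "open V" "homeomorphism U V (cone_map g) h"
proof -
  define f' where "f' q = Blinfun (\<lambda>w. dir_deriv w (cone_map g) q)" for q
  have lin: "bounded_linear (\<lambda>w. dir_deriv w (cone_map g) q)" if "q \<in> off_axis" for q
    by (rule has_derivative_bounded_linear[OF cone_map_has_derivative[OF assms(1) that]])
  have f'_apply: "blinfun_apply (f' q) = (\<lambda>w. dir_deriv w (cone_map g) q)" if "q \<in> off_axis" for q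
    unfolding f'_def by (rule bounded_linear_Blinfun_apply[OF lin[OF that]])
  have der: "(cone_map g has_derivative blinfun_apply (f' q)) (at q)" if "q \<in> off_axis" for q
    unfolding f'_apply[OF that] by (rule cone_map_has_derivative[OF assms(1) that])
  have "continuous_on off_axis (\<lambda>q. dir_deriv w (cone_map g) q)" for w
    by (rule smooth_family_continuous_on[OF smooth_family_dir_deriv[OF smooth_family_cone_map[OF assms(1)]]])
  then have "continuous_on off_axis (\<lambda>q. blinfun_apply (f' q) w)" for w
    by (rule continuous_on_eq) (simp add: f'_apply)
  \<comment> \<open>In finite dimension, continuity of the derivative as an operator follows from
    continuity of its values on fixed vectors.\<close>
  then have cont: "continuous_on off_axis f'"
    by (intro continuous_on_blinfun_componentwise) blast
  have off: "p \<in> off_axis" using assms(2) equator_subset_off_axis by blast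
  have linp: "linear (\<lambda>w. dir_deriv w (cone_map g) p)" using lin[OF off] by (rule bounded_linear.linear)
  have "inj (\<lambda>w. dir_deriv w (cone_map g) p)"
    using det_nz_iff_inj[OF linp] det_dir_deriv_cone_map[OF assms(1) off assms(3)] by blast
  then obtain k where k: "linear k" "k \<circ> (\<lambda>w. dir_deriv w (cone_map g) p) = id"
    using linear_injective_left_inverse[OF linp] by blast
  have "Blinfun k o\<^sub>L f' p = id_blinfun"
  proof (rule blinfun_eqI)
    fix w
    have "blinfun_apply (Blinfun k) = k"
      by (rule bounded_linear_Blinfun_apply) (rule linear_linear[THEN iffD2, OF k(1)])
    then show "blinfun_apply (Blinfun k o\<^sub>L f' p) w = blinfun_apply id_blinfun w"
      using fun_cong[OF k(2), of w] by (simp add: f'_apply[OF off])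
  qed
  from inverse_function_theorem[OF open_off_axis der cont off this]
  show ?thesis using that by metis
qed

section \<open>From local to global homeomorphisms\<close>

lemma local_diffeo_bij:
  fixes g :: "'n pt \<Rightarrow> ('n::{finite,wellorder}) pt"
  assumes g: "g \<in> smooth_maps equator" and n: "CARD('n) > 3"
    and pos: "\<And>p. p \<in> equator \<Longrightarrow> map_det g p e_last > 0"
  shows "bij_betw g equator equator"
proof -
  have gE: "g p \<in> equator" if "p \<in> equator" for p by (rule smooth_maps_mapsto[OF g that])
  have "continuous_on off_axis (cone_map g)"
    by (rule smooth_family_continuous_on[OF smooth_family_cone_map[OF g]])
  then have "continuous_on equator (cone_map g)"
    by (rule continuous_on_subset[OF _ equator_subset_off_axis])
  then have cont: "continuous_on equator g"
    by (rule continuous_on_eq) (rule cone_map_equator)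
  have conn: "path_connected (equator :: ('n pt) set)"
    using simply_connected_equator[OF n] simply_connected_eq_contractible_path by blast
  have "covering_space equator g equator"
  proof (rule local_homeo_compact_covering[OF compact_equator equator_nonempty path_connected_imp_connected[OF conn] cont])
    show "CARD('n) > 2" using n by simp
    show "g ` equator \<subseteq> equator" using gE by blast
    fix p :: "'n pt" assume p: "p \<in> equator"
    obtain U V h where U: "p \<in> U" "U \<subseteq> off_axis" "open U" "open V" "homeomorphism U V (cone_map g) h"
      using cone_map_local_homeo[OF g p pos] by blast
    have "homeomorphism (U \<inter> equator) (V \<inter> equator) (cone_map g) h"
    proof (rule homeomorphism_of_subsets[OF U(5)])
      show "V \<subseteq> V" "U \<inter> equator \<subseteq> U" by auto
      show "cone_map g ` (U \<inter> equator) = V \<inter> equator"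
      proof
        show "cone_map g ` (U \<inter> equator) \<subseteq> V \<inter> equator"
        proof
          fix y assume "y \<in> cone_map g ` (U \<inter> equator)"
          then obtain x where "x \<in> U" "x \<in> equator" "y = cone_map g x" by blast
          note x = this
          have "cone_map g x \<in> V" using U(5) x(1) by (auto simp: homeomorphism_def)
          then show "y \<in> V \<inter> equator" using gE[OF x(2)] cone_map_equator[OF x(2), of g] x(3) by simp
        qed
        show "V \<inter> equator \<subseteq> cone_map g ` (U \<inter> equator)"
        proof
          \<comment> \<open>The cone map keeps radius and height, so a preimage of a point of the
            equator has radius 1 and height 0.\<close>
          fix y assume y: "y \<in> V \<inter> equator"
          then obtain x where x: "x \<in> U" "y = cone_map g x" using U(5) by (auto simp: homeomorphism_def)
          have xo: "x \<in> off_axis" using x(1) U(2) by blast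
          note co = cone_map_coords[of g x, OF gE[OF tau_in_equator[OF xo]] xo]
          have "norm (horizontal x) = 1" "x \<bullet> e_last = 0"
            using co(2,4) y x(2) by (auto simp: horizontal_equator equatorD)
          then have "x = tau x" using decomp_off_axis[OF xo] by simp
          then have "x \<in> equator" using tau_in_equator[OF xo] by simp
          then show "y \<in> cone_map g ` (U \<inter> equator)" using x by blast
        qed
      qed
    qed
    then have "homeomorphism (U \<inter> equator) (V \<inter> equator) g h"
      by (rule homeomorphism_cong) (simp_all add: cone_map_equator)
    then show "\<exists>U V q. p \<in> U \<and> openin (top_of_set equator) U \<and> openin (top_of_set equator) V \<and>
        homeomorphism U V g q"
      using U(1,3,4) p by (metis IntI Int_commute openin_open_Int)
  qed
  from covering_space_simply_connected_inj[OF this conn simply_connected_equator[OF n]]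
    covering_space_imp_surjective[OF this]
  show ?thesis by (simp add: bij_betw_def)
qed

section \<open>Smoothness of inverse maps\<close>

lemma Ck_family_det:
  fixes A :: "'x \<Rightarrow> 'a::real_normed_vector \<Rightarrow> real^'n^'n"
  assumes "open U" "K \<subseteq> U" "\<And>i j. Ck_family k X U K (\<lambda>x p. A x p $ i $ j)"
  shows "Ck_family k X U K (\<lambda>x p. det (A x p))"
proof -
  have "Ck_family k X U K (\<lambda>x p. \<Prod>i\<in>UNIV. A x p $ i $ \<pi> i)" for \<pi>
    by (rule Ck_family_prod[OF assms(1,2)]) (auto intro: assms(3))
  moreover have "Ck_family k X U K (\<lambda>x p. of_int (sign \<pi>))" for \<pi> :: "'n \<Rightarrow> 'n"
    by (rule Ck_family_of_fst[OF assms(1,2)]) simp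
  ultimately have "Ck_family k X U K (\<lambda>x p. of_int (sign \<pi>) * (\<Prod>i\<in>UNIV. A x p $ i $ \<pi> i))" for \<pi>
    using Ck_family_bilinear[OF bounded_bilinear_mult assms(1,2)] by blast
  then show ?thesis
    unfolding det_def by (intro Ck_family_sum[OF assms(1,2)]) (auto simp: finite_permutations)
qed

text \<open>
  By Cramer's rule the derivative of the inverse is a rational expression in the derivatives of the
  map at the inverse, so each order of differentiability of the inverse yields the next.
\<close>

lemma smooth_family_inverse_map:
  fixes F H :: "real^'n \<Rightarrow> real^'n"
  assumes U: "open U" and F: "smooth_family (top_of_set {0::real}) U U (\<lambda>_. F)"
    and FU: "\<And>x. x \<in> U \<Longrightarrow> F x \<in> U" and HU: "\<And>y. y \<in> U \<Longrightarrow> H y \<in> U"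
    and HF: "\<And>x. x \<in> U \<Longrightarrow> H (F x) = x" and FH: "\<And>y. y \<in> U \<Longrightarrow> F (H y) = y"
    and det: "\<And>x. x \<in> U \<Longrightarrow> det (matrix (\<lambda>w. dir_deriv w F x)) \<noteq> 0"
  shows "smooth_family (top_of_set {0::real}) U U (\<lambda>_. H)"
proof -
  let ?X = "top_of_set {0::real}"
  have dF: "(F has_derivative (\<lambda>w. dir_deriv w F x)) (at x)" if "x \<in> U" for x
    using smooth_family_differentiable[OF F, of 0] that by (intro has_derivative_dir_deriv) simp
  have contF: "continuous_on U F" by (rule smooth_family_continuous_on[OF F])
  have dH: "\<exists>h. (H has_derivative h) (at y) \<and> (\<forall>w. dir_deriv (h w) F (H y) = w)" if y: "y \<in> U" for y
  proof -
    have lin: "linear (\<lambda>w. dir_deriv w F (H y))" by (rule has_derivative_linear[OF dF[OF HU[OF y]]])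
    have "inj (\<lambda>w. dir_deriv w F (H y))" using det_nz_iff_inj[OF lin] det[OF HU[OF y]] by blast
    then have "surj (\<lambda>w. dir_deriv w F (H y))" using linear_injective_imp_surjective[OF lin] by blast
    then obtain h where h: "linear h" "(\<lambda>w. dir_deriv w F (H y)) \<circ> h = id"
      using linear_surjective_right_inverse[OF lin] by blast
    have "(H has_derivative h) (at (F (H y)))"
      by (rule has_derivative_inverse_strong[OF U HU[OF y] contF HF dF[OF HU[OF y]] h(2)])
    then show ?thesis using FH[OF y] fun_cong[OF h(2)] by (auto simp: o_def)
  qed
  define A where "A y = matrix (\<lambda>w. dir_deriv w F (H y))" for y
  \<comment> \<open>Column \<open>k\<close> of the derivative replaced by \<open>v\<close>: the
    numerator in Cramer's rule.\<close>
  define Av where "Av v y k = (\<chi> i j. if j = k then v $ i else A y $ i $ j)" for v :: "real^'n" and y and k :: 'n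
  have formula: "dir_deriv v H y = (\<Sum>k\<in>UNIV. (det (Av v y k) * inverse (det (A y))) *\<^sub>R axis k 1)"
    if y: "y \<in> U" for v y
  proof -
    obtain h where h: "(H has_derivative h) (at y)" "\<And>w. dir_deriv (h w) F (H y) = w"
      using dH[OF y] by blast
    have lin: "linear (\<lambda>w. dir_deriv w F (H y))" by (rule has_derivative_linear[OF dF[OF HU[OF y]]])
    have "A y *v h v = v" unfolding A_def using lin h(2)[of v] by (simp add: matrix_works)
    then have "h v = (\<chi> k. det (Av v y k) / det (A y))"
      unfolding Av_def using cramer[of "A y" "h v" v] det[OF HU[OF y]] by (simp add: A_def)
    also have "\<dots> = (\<Sum>k\<in>UNIV. (det (Av v y k) * inverse (det (A y))) *\<^sub>R axis k 1)"
      using basis_expansion[of "\<chi> k. det (Av v y k) / det (A y)"]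
      by (simp add: scalar_mult_eq_scaleR divide_inverse)
    finally show ?thesis using dir_deriv_eq[OF h(1)] by simp
  qed
  have "Ck_family k ?X U U (\<lambda>_. H)" for k
  proof (induction k)
    case 0
    have "H differentiable at y" if "y \<in> U" for y using dH[OF that] by (auto simp: differentiable_def)
    then have "continuous_on U H"
      by (intro differentiable_imp_continuous_on) (auto simp: differentiable_on_def intro: differentiable_at_withinI)
    then show ?case by (simp add: jointly_cont_of_snd)
  next
    case (Suc k)
    \<comment> \<open>The induction hypothesis gives \<open>H\<close> at order \<open>k\<close>;
      composing it with a derivative of \<open>F\<close>, which is smooth to all orders, keeps that
      order.\<close>
    have ent: "Ck_family k ?X U U (\<lambda>_ y. A y $ i $ j)" for i j
    proof -
      have "Ck_family k ?X U U (\<lambda>_ y. dir_deriv (axis j 1) F (H y))"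
        by (rule Ck_family_compose[OF U order_refl, where U' = U and K' = U and \<psi> = "\<lambda>_. H"])
          (use HU Suc.IH smooth_family_dir_deriv[OF F] in \<open>auto simp: smooth_family_def\<close>)
      from Ck_family_linear[OF bounded_linear_vec_nth U order_refl this]
      show ?thesis by (simp add: A_def matrix_def)
    qed
    have entv: "Ck_family k ?X U U (\<lambda>_ y. Av v y l $ i $ j)" for v l i j
      using ent[of i j] Ck_family_of_fst[OF U order_refl, of ?X "\<lambda>_. v $ i" k]
      by (cases "j = l") (simp_all add: Av_def)
    have "Ck_family k ?X U U (\<lambda>_ y. inverse (det (A y)))"
      by (rule Ck_family_inverse[OF U order_refl _ Ck_family_det[OF U order_refl ent]])
        (use det HU in \<open>simp add: A_def\<close>)
    then have "Ck_family k ?X U U (\<lambda>_ y. det (Av v y l) * inverse (det (A y)))" for v l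
      by (rule Ck_family_bilinear[OF bounded_bilinear_mult U order_refl Ck_family_det[OF U order_refl entv]])
    then have "Ck_family k ?X U U (\<lambda>_ y. (det (Av v y l) * inverse (det (A y))) *\<^sub>R axis l (1::real))" for v l
      by (rule Ck_family_linear[OF bounded_linear_scaleR_left U order_refl])
    then have sum: "Ck_family k ?X U U
        (\<lambda>_ y. \<Sum>l\<in>UNIV. (det (Av v y l) * inverse (det (A y))) *\<^sub>R axis l (1::real))" for v
      by (intro Ck_family_sum[OF U order_refl]) auto
    have "Ck_family k ?X U U (\<lambda>_. dir_deriv v H)" for v
      by (rule Ck_family_cong[OF U order_refl, THEN iffD2, OF _ sum[of v]]) (rule formula)
    moreover have "H differentiable at y" if "y \<in> U" for y
      using dH[OF that] by (auto simp: differentiable_def)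
    ultimately show ?case using Ck_family_jointly_cont[OF Suc.IH] by simp
  qed
  then show ?thesis by (simp add: smooth_family_def)
qed

text \<open>The inverse of the cone map of \<open>g\<close> is the cone map of the inverse of
  \<open>g\<close>, so smoothness of inverses in Euclidean space applies; composing with
  \<open>tau\<close> recovers the inverse on the equator.\<close>

lemma local_diffeo_diff_plus:
  fixes g :: "'n pt \<Rightarrow> ('n::{finite,wellorder}) pt"
  assumes g: "g \<in> smooth_maps equator" and n: "CARD('n) > 3"
    and pos: "\<And>p. p \<in> equator \<Longrightarrow> map_det g p e_last > 0"
  shows "g \<in> diff_plus"
proof -
  have bij: "bij_betw g equator equator" by (rule local_diffeo_bij[OF g n pos])
  define k where "k = inv_into equator g"
  have gE: "g p \<in> equator" "k (g p) = p" if "p \<in> equator" for p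
    using bij that by (auto simp: k_def bij_betw_inv_into_left dest: bij_betwE)
  have kE: "k p \<in> equator" "g (k p) = p" if "p \<in> equator" for p
    using bij that by (auto simp: k_def bij_betw_inv_into_right dest: bij_betwE[OF bij_betw_inv_into])
  have gt: "g (tau q) \<in> equator" and kt: "k (tau q) \<in> equator" if "q \<in> off_axis" for q
    using gE(1) kE(1) tau_in_equator[OF that] by blast+
  have sm: "smooth_family (top_of_set {0::real}) off_axis off_axis (\<lambda>_. cone_map k)"
  proof (rule smooth_family_inverse_map[OF open_off_axis smooth_family_cone_map[OF g]])
    fix x :: "'n pt" assume x: "x \<in> off_axis"
    show "cone_map g x \<in> off_axis" by (rule cone_map_coords(5)[of g x, OF gt[OF x] x])
    show "cone_map k x \<in> off_axis" by (rule cone_map_coords(5)[of k x, OF kt[OF x] x])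
    show "cone_map k (cone_map g x) = x"
      by (rule cone_map_inverse[of g x k, OF gt[OF x] gE(2)[OF tau_in_equator[OF x]] x])
    show "cone_map g (cone_map k x) = x"
      by (rule cone_map_inverse[of k x g, OF kt[OF x] kE(2)[OF tau_in_equator[OF x]] x])
    show "det (matrix (\<lambda>w. dir_deriv w (cone_map g) x)) \<noteq> 0"
      by (rule det_dir_deriv_cone_map[OF g x pos])
  qed
  have "smooth_family (top_of_set {0::real}) off_axis off_axis (\<lambda>_ q. tau (cone_map k q))"
    by (rule smooth_family_compose[OF smooth_family_tau[OF order_refl] sm open_off_axis order_refl])
      (rule cone_map_coords(5)[of k, OF kt], assumption+)+
  then have "smooth_family (top_of_set {0::real}) off_axis off_axis (\<lambda>_. k \<circ> tau)"
    by (subst (asm) smooth_family_cong[where \<psi> = "\<lambda>_. k \<circ> tau"])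
      (simp_all add: cone_map_coords(3)[of k, OF kt])
  then have "smooth_map_on equator k"
    unfolding smooth_map_on_equator_iff by (rule smooth_family_imp_smooth_on_open[where x = 0]) simp
  then show ?thesis
    unfolding diff_plus_def mem_Collect_eq k_def[symmetric]
    using g bij map_det_pos_frames[OF g _ pos] by blast
qed

section \<open>The twisted product\<close>

lemma compose_rotations:
  "compose equator ((*v) A) (compose equator ((*v) B) g) = compose equator ((*v) (A ** B)) g"
  by (rule ext) (simp add: compose_def matrix_vector_mul_assoc)

lemma compose_rotation_id: "g \<in> extensional equator \<Longrightarrow> compose equator ((*v) (mat 1)) g = g"
  by (rule ext) (simp add: compose_def extensional_def)

lemma SO_sub_inverse:
  assumes "P \<in> SO_sub"
  shows "P \<in> SO" "matrix_inv P \<in> SO_sub" "matrix_inv P *v e_last = e_last"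
proof -
  show P: "P \<in> SO" using assms by (simp add: SO_sub_def)
  show "matrix_inv P *v e_last = e_last"
    using SO_inverse(4)[OF P, of e_last] assms by (simp add: SO_sub_def)
  then show "matrix_inv P \<in> SO_sub" using SO_inverse(1)[OF P] by (simp add: SO_sub_def)
qed

lemma SO_matrix_inv_inverse: "P \<in> SO \<Longrightarrow> matrix_inv (matrix_inv P) = P"
  by (simp add: SO_matrix_inv SO_transpose(3))

lemma SO_matrix_inv_mult: "P \<in> SO \<Longrightarrow> Q \<in> SO \<Longrightarrow> matrix_inv (P ** Q) = matrix_inv Q ** matrix_inv P"
  by (simp add: SO_matrix_inv SO_mult matrix_transpose_mul)

lemma SO_sub_mult: "P \<in> SO_sub \<Longrightarrow> Q \<in> SO_sub \<Longrightarrow> P ** Q \<in> SO_sub"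
  by (simp add: SO_sub_def SO_mult matrix_vector_mul_assoc[symmetric])

lemma twisted_rel_iff:
  "((Q, g), (Q', g')) \<in> twisted_rel \<longleftrightarrow> Q \<in> SO \<and> g \<in> diff_plus \<and> Q' \<in> SO \<and> g' \<in> diff_plus \<and>
     (\<exists>P\<in>SO_sub. Q' = Q ** P \<and> g' = compose equator ((*v) (matrix_inv P)) g)"
  by (simp add: twisted_rel_def)

lemma diff_plus_extensional: "g \<in> diff_plus \<Longrightarrow> g \<in> extensional equator"
  by (rule smooth_maps_extensional[OF diff_plus_smooth(1)])

lemma equiv_twisted_rel:
  "equiv (SO \<times> diff_plus) (twisted_rel ::
    (('n mat \<times> ('n pt \<Rightarrow> 'n pt)) \<times> ('n mat \<times> ('n pt \<Rightarrow> ('n::{finite,wellorder}) pt))) set)"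
proof (rule equivI)
  show sub: "twisted_rel \<subseteq> (SO \<times> diff_plus) \<times> (SO \<times> (diff_plus :: ('n pt \<Rightarrow> 'n pt) set))"
    by (auto simp: twisted_rel_def)
  have id: "mat 1 \<in> (SO_sub :: ('n mat) set)" by (simp add: SO_sub_def SO_id)
  have inv1: "matrix_inv (mat 1 :: 'n mat) = mat 1" by (simp add: SO_matrix_inv[OF SO_id])
  show "refl_on (SO \<times> (diff_plus :: ('n pt \<Rightarrow> 'n pt) set)) twisted_rel"
  proof (rule refl_onI)
    fix x :: "'n mat \<times> ('n pt \<Rightarrow> 'n pt)" assume "x \<in> SO \<times> diff_plus"
    then obtain Q g where x: "x = (Q, g)" "Q \<in> SO" "g \<in> diff_plus" by auto
    have "Q = Q ** mat 1 \<and> g = compose equator ((*v) (matrix_inv (mat 1))) g"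
      by (simp add: inv1 compose_rotation_id diff_plus_extensional[OF x(3)])
    then show "(x, x) \<in> twisted_rel" unfolding x(1) twisted_rel_iff using x(2,3) id by blast
  qed
  show "sym (twisted_rel :: (('n mat \<times> ('n pt \<Rightarrow> 'n pt)) \<times> ('n mat \<times> ('n pt \<Rightarrow> 'n pt))) set)"
  proof (rule symI)
    fix x y :: "'n mat \<times> ('n pt \<Rightarrow> 'n pt)" assume xy: "(x, y) \<in> twisted_rel"
    obtain Q g Q' g' where e: "x = (Q, g)" "y = (Q', g')" by (metis surj_pair)
    then obtain P where P: "P \<in> SO_sub" "Q' = Q ** P" "g' = compose equator ((*v) (matrix_inv P)) g"
      and m: "Q \<in> SO" "g \<in> diff_plus" "Q' \<in> SO" "g' \<in> diff_plus"
      using xy unfolding e twisted_rel_iff by blast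
    note Pi = SO_sub_inverse[OF P(1)]
    have "Q = Q' ** matrix_inv P"
      using SO_inverse(3)[OF Pi(1)] by (simp add: P(2) matrix_mul_assoc[symmetric])
    moreover have "g = compose equator ((*v) (matrix_inv (matrix_inv P))) g'"
      by (simp add: P(3) SO_matrix_inv_inverse[OF Pi(1)] compose_rotations SO_inverse(3)[OF Pi(1)]
          compose_rotation_id diff_plus_extensional[OF m(2)])
    ultimately show "(y, x) \<in> twisted_rel" unfolding e twisted_rel_iff using m Pi(2) by blast
  qed
  show "trans (twisted_rel :: (('n mat \<times> ('n pt \<Rightarrow> 'n pt)) \<times> ('n mat \<times> ('n pt \<Rightarrow> 'n pt))) set)"
  proof (rule transI)
    fix x y z :: "'n mat \<times> ('n pt \<Rightarrow> 'n pt)" assume xyz: "(x, y) \<in> twisted_rel" "(y, z) \<in> twisted_rel"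
    obtain Q g Q' g' Q'' g'' where e: "x = (Q, g)" "y = (Q', g')" "z = (Q'', g'')" by (metis surj_pair)
    obtain P where P: "P \<in> SO_sub" "Q' = Q ** P" "g' = compose equator ((*v) (matrix_inv P)) g"
      and m: "Q \<in> SO" "g \<in> diff_plus"
      using xyz(1) unfolding e twisted_rel_iff by blast
    obtain P' where P': "P' \<in> SO_sub" "Q'' = Q' ** P'" "g'' = compose equator ((*v) (matrix_inv P')) g'"
      and m': "Q'' \<in> SO" "g'' \<in> diff_plus"
      using xyz(2) unfolding e twisted_rel_iff by blast
    have "Q'' = Q ** (P ** P')" by (simp add: P(2) P'(2) matrix_mul_assoc)
    moreover have "g'' = compose equator ((*v) (matrix_inv (P ** P'))) g"
      by (simp add: P(3) P'(3) compose_rotations SO_matrix_inv_mult SO_sub_inverse(1)[OF P(1)]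
          SO_sub_inverse(1)[OF P'(1)])
    ultimately show "(x, z) \<in> twisted_rel"
      unfolding e twisted_rel_iff using m m' SO_sub_mult[OF P(1) P'(1)] by blast
  qed
qed

section \<open>Values of the two maps on classes and on immersions\<close>

lemma twisted_class_self: "Q \<in> SO \<Longrightarrow> g \<in> diff_plus \<Longrightarrow> (Q, g) \<in> twisted_class Q g"
  unfolding twisted_class_def by (rule equiv_class_self[OF equiv_twisted_rel]) simp

text \<open>The factors \<open>P\<close> and \<open>matrix_inv P\<close> cancel, so all
  representatives give the same map and \<open>the_elem\<close> meets a singleton.\<close>

lemma Psi_bar_twisted_class:
  assumes "Q \<in> SO" "g \<in> diff_plus"
  shows "Psi_bar (twisted_class Q g) = compose equator ((*v) Q) g"
proof -
  have "compose equator ((*v) Q') g' = compose equator ((*v) Q) g"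
    if "(Q', g') \<in> twisted_class Q g" for Q' g'
  proof -
    have "((Q, g), (Q', g')) \<in> twisted_rel" using that by (simp add: twisted_class_def)
    then obtain P where P: "P \<in> SO_sub" "Q' = Q ** P" "g' = compose equator ((*v) (matrix_inv P)) g"
      unfolding twisted_rel_iff by blast
    have "Q ** P ** matrix_inv P = Q"
      using SO_inverse(3)[OF SO_sub_inverse(1)[OF P(1)]] by (simp add: matrix_mul_assoc[symmetric])
    then show ?thesis by (simp add: P(2,3) compose_rotations)
  qed
  then have "(\<lambda>(Q, g). compose equator ((*v) Q) g) ` twisted_class Q g \<subseteq> {compose equator ((*v) Q) g}"
    by (simp add: image_subset_iff split_beta)
  moreover have "compose equator ((*v) Q) g \<in> (\<lambda>(Q, g). compose equator ((*v) Q) g) ` twisted_class Q g"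
    by (rule image_eqI[OF _ twisted_class_self[OF assms]]) simp
  ultimately have "(\<lambda>(Q, g). compose equator ((*v) Q) g) ` twisted_class Q g = {compose equator ((*v) Q) g}"
    by blast
  then show ?thesis by (simp add: Psi_bar_def)
qed

lemma center_rotations_iff: "Q \<in> center_rotations f \<longleftrightarrow> Q \<in> SO \<and> Q *v (- e_last) = dual_center f"
  by (simp add: center_rotations_def dual_center_def)

lemma center_rotations_nonempty:
  fixes f :: "'n pt \<Rightarrow> ('n::{finite,wellorder}) pt"
  assumes "f \<in> hemi_immersions" "CARD('n) > 2"
  shows "center_rotations f \<noteq> {}"
proof -
  have "2 \<le> CARD('n)" "norm (- e_last :: 'n pt) = 1" using assms(2) by auto
  then obtain F where F: "orthogonal_transformation F" "det (matrix F) = 1"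
    "F (- e_last) = dual_center f"
    by (rule rotation_exists_1[OF _ _ dual_center_props(1)[OF assms]])
  have "linear F" using F(1) by (rule orthogonal_transformation_linear)
  then have "matrix F *v x = F x" for x by (simp add: matrix_works)
  then have "matrix F \<in> center_rotations f"
    using F orthogonal_transformation_matrix[of F] by (auto simp: center_rotations_iff SO_def)
  then show ?thesis by blast
qed

lemma projected_map_diff_plus:
  fixes f :: "'n pt \<Rightarrow> ('n::{finite,wellorder}) pt"
  assumes "f \<in> hemi_immersions" "CARD('n) > 3" "Q \<in> center_rotations f"
  shows "projected_map Q f \<in> diff_plus"
proof -
  have n2: "CARD('n) > 2" using assms(2) by simp
  have Q: "Q \<in> SO" "Q *v (- e_last) = dual_center f" using assms(3) by (auto simp: center_rotations_iff)
  show ?thesis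
    by (rule local_diffeo_diff_plus[OF projected_map_smooth(1)[OF assms(1) n2 Q] assms(2)
        projected_map_smooth(2)[OF assms(1) n2 Q]])
qed

text \<open>Two admissible rotations send \<open>- e_last\<close> to the same center, so they differ
  by an element of its stabilizer, which is what the relation of the twisted product
  identifies.\<close>

lemma twisted_class_projected_map:
  fixes f :: "'n pt \<Rightarrow> ('n::{finite,wellorder}) pt"
  assumes "f \<in> hemi_immersions" "CARD('n) > 3" "Q \<in> center_rotations f" "Q' \<in> center_rotations f"
  shows "twisted_class Q' (projected_map Q' f) = twisted_class Q (projected_map Q f)"
proof -
  define P where "P = matrix_inv Q ** Q'"
  have Q: "Q \<in> SO" "Q *v (- e_last) = dual_center f" and Q': "Q' \<in> SO" "Q' *v (- e_last) = dual_center f"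
    using assms(3,4) by (auto simp: center_rotations_iff)
  note Qi = SO_inverse[OF Q(1)]
  have PSO: "P \<in> SO" unfolding P_def by (rule SO_mult[OF Qi(1) Q'(1)])
  have "P *v (- e_last) = matrix_inv Q *v (Q' *v (- e_last))"
    unfolding P_def by (rule matrix_vector_mul_assoc[symmetric])
  also have "\<dots> = - e_last" unfolding Q'(2) Q(2)[symmetric] by (rule Qi(4))
  finally have "P *v e_last = e_last" by (simp add: matrix_vector_mult_neg)
  then have P: "P \<in> SO_sub" using PSO by (simp add: SO_sub_def)
  have QP: "Q' = Q ** P" by (simp add: P_def matrix_mul_assoc Qi(3))
  have "projected_map Q' f = compose equator ((*v) (matrix_inv P)) (projected_map Q f)"
    unfolding projected_map_eq[OF Q] projected_map_eq[OF Q'] compose_rotations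
    by (simp add: QP SO_matrix_inv_mult[OF Q(1) PSO])
  then have "((Q, projected_map Q f), (Q', projected_map Q' f)) \<in> twisted_rel"
    unfolding twisted_rel_iff
    using Q(1) Q'(1) projected_map_diff_plus[OF assms(1,2)] assms(3,4) P QP by blast
  then show ?thesis
    unfolding twisted_class_def using equiv_class_eq[OF equiv_twisted_rel] by metis
qed

lemma Phi_bar_eq:
  fixes f :: "'n pt \<Rightarrow> ('n::{finite,wellorder}) pt"
  assumes "f \<in> hemi_immersions" "CARD('n) > 3" "Q \<in> center_rotations f"
  shows "Phi_bar f = twisted_class Q (projected_map Q f)"
proof -
  have "(\<lambda>Q. twisted_class Q (projected_map Q f)) ` center_rotations f = {twisted_class Q (projected_map Q f)}"
    using twisted_class_projected_map[OF assms] assms(3) by blast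
  then show ?thesis by (simp add: Phi_bar_def)
qed

lemma Psi_bar_Phi_bar:
  fixes f :: "'n pt \<Rightarrow> ('n::{finite,wellorder}) pt"
  assumes "f \<in> hemi_immersions" "CARD('n) > 3"
  shows "Psi_bar (Phi_bar f) = flatten_map 1 (dual_center f) f"
proof -
  have "CARD('n) > 2" using assms(2) by simp
  then obtain Q where Qf: "Q \<in> center_rotations f"
    using center_rotations_nonempty[OF assms(1)] by blast
  then have Q: "Q \<in> SO" "Q *v (- e_last) = dual_center f" by (auto simp: center_rotations_iff)
  have "flatten_map 1 (dual_center f) f \<in> extensional equator" by (simp add: flatten_map_def)
  then show ?thesis
    unfolding Phi_bar_eq[OF assms Qf] Psi_bar_twisted_class[OF Q(1) projected_map_diff_plus[OF assms Qf]]
    by (simp add: projected_map_eq[OF Q] compose_rotations SO_inverse(3)[OF Q(1)] compose_rotation_id)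
qed

text \<open>\<open>Q\<close> itself is an admissible rotation by \<open>rotated_diff_plus\<close>,
  and \<open>tau\<close> fixes the values of \<open>g\<close>, so the class is recovered
  exactly.\<close>

lemma Phi_bar_rotated:
  fixes g :: "'n pt \<Rightarrow> ('n::{finite,wellorder}) pt"
  assumes "Q \<in> SO" "g \<in> diff_plus" "CARD('n) > 3"
  shows "Phi_bar (compose equator ((*v) Q) g) = twisted_class Q g"
proof -
  define f where "f = compose equator ((*v) Q) g"
  have n2: "CARD('n) > 2" using assms(3) by simp
  note f = rotated_diff_plus[OF assms(1,2) n2, folded f_def]
  have Qf: "Q \<in> center_rotations f"
    using assms(1) f(2) by (simp add: center_rotations_iff matrix_vector_mult_neg)
  have "projected_map Q f = g"
  proof (rule extensionalityI[of _ equator])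
    show "g \<in> extensional equator" by (rule diff_plus_extensional[OF assms(2)])
    show "projected_map Q f \<in> extensional equator" by (simp add: projected_map_def)
    show "projected_map Q f p = g p" if "p \<in> equator" for p
      using that tau_equator[OF smooth_maps_mapsto[OF diff_plus_smooth(1)[OF assms(2)] that]]
      by (simp add: projected_map_def f_def compose_def SO_inverse(4)[OF assms(1)])
  qed
  then show ?thesis using Phi_bar_eq[OF f(1) assms(3) Qf] by (simp add: f_def)
qed

section \<open>Continuity\<close>

lemma topspace_hemi_top: "topspace hemi_top = hemi_immersions"
  by (auto simp: hemi_top_def hemi_immersions_def dest: immersionsD)

lemma topspace_diff_plus_top: "topspace diff_plus_top = diff_plus"
  by (auto simp: diff_plus_top_def dest: diff_plus_smooth)

lemma topspace_twisted_top: "topspace twisted_top = (SO \<times> diff_plus) // twisted_rel"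
  by (simp add: twisted_top_def topspace_quotient_topology topspace_diff_plus_top)

lemma smooth_family_hemi_top: "smooth_family hemi_top off_axis off_axis (\<lambda>f. f \<circ> tau)"
proof -
  have "continuous_map hemi_top (smooth_topology usphere) (\<lambda>f. f)"
    unfolding hemi_top_def by (rule continuous_map_from_subtopology) (rule continuous_map_id[unfolded id_def])
  from smooth_family_reparam[OF smooth_family_smooth_topology this] show ?thesis .
qed

lemma smooth_family_diff_plus_top: "smooth_family diff_plus_top off_axis off_axis (\<lambda>f. f \<circ> tau)"
proof -
  have "continuous_map diff_plus_top (smooth_topology equator) (\<lambda>f. f)"
    unfolding diff_plus_top_def by (rule continuous_map_from_subtopology) (rule continuous_map_id[unfolded id_def])
  from smooth_family_reparam[OF smooth_family_smooth_topology this] show ?thesis .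
qed

lemma continuous_map_compose_rotation:
  fixes X :: "'x topology" and F :: "'x \<Rightarrow> 'n pt \<Rightarrow> ('n::{finite,wellorder}) pt"
  assumes Q: "continuous_map X euclidean Q"
    and F: "smooth_family X off_axis off_axis (\<lambda>x. F x \<circ> tau)"
    and Y: "\<And>x. x \<in> topspace X \<Longrightarrow> compose equator ((*v) (Q x)) (F x) \<in> smooth_maps Y"
  shows "continuous_map X (smooth_topology Y) (\<lambda>x. compose equator ((*v) (Q x)) (F x))"
proof (rule continuous_map_smooth_topologyI[OF Y])
  have "smooth_family X off_axis off_axis (\<lambda>x q. Q x *v (F x \<circ> tau) q)"
    by (rule smooth_family_bilinear[OF bounded_bilinear_matrix_vector_mult open_off_axis order_refl
        smooth_family_of_fst[OF open_off_axis order_refl Q] F])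
  then have "smooth_family X off_axis off_axis (\<lambda>x. compose equator ((*v) (Q x)) (F x) \<circ> tau)"
    by (subst (asm) smooth_family_cong[where \<psi> = "\<lambda>x. compose equator ((*v) (Q x)) (F x) \<circ> tau"])
      (simp_all add: compose_def tau_in_equator)
  then show "smooth_family X off_axis equator (\<lambda>x. compose equator ((*v) (Q x)) (F x) \<circ> tau)"
    by (rule smooth_family_subset[OF _ order_refl equator_subset_off_axis])
qed

text \<open>By the universal property of the quotient, continuity is checked on pairs, where the
  composite is the bilinear action of rotations on maps.\<close>

lemma continuous_map_Psi_bar:
  assumes "CARD('n::{finite,wellorder}) > 3"
  shows "continuous_map twisted_top hemi_top
    (Psi_bar :: ('n mat \<times> ('n pt \<Rightarrow> 'n pt)) set \<Rightarrow> 'n pt \<Rightarrow> 'n pt)"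
proof -
  let ?X = "prod_topology (top_of_set SO) diff_plus_top :: ('n mat \<times> ('n pt \<Rightarrow> 'n pt)) topology"
  have n2: "CARD('n) > 2" using assms by simp
  have tX: "topspace ?X = SO \<times> diff_plus" by (simp add: topspace_diff_plus_top)
  have c1: "continuous_map ?X euclidean fst"
    using continuous_map_fst[of "top_of_set SO" diff_plus_top] by (rule continuous_map_into_fulltopology)
  have c2: "smooth_family ?X off_axis off_axis (\<lambda>x. snd x \<circ> tau)"
    by (rule smooth_family_reparam[OF smooth_family_diff_plus_top continuous_map_snd])
  have hemi: "compose equator ((*v) (fst x)) (snd x) \<in> hemi_immersions" if "x \<in> topspace ?X" for x
    using that rotated_diff_plus(1)[OF _ _ n2] unfolding tX by auto
  then have sm: "compose equator ((*v) (fst x)) (snd x) \<in> smooth_maps usphere" if "x \<in> topspace ?X" for x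
    using that by (auto simp: hemi_immersions_def immersions_def)
  have "continuous_map ?X hemi_top (\<lambda>x. compose equator ((*v) (fst x)) (snd x))"
    unfolding hemi_top_def
    by (rule continuous_map_into_subtopology[OF continuous_map_compose_rotation[OF c1 c2 sm]])
      (use hemi in auto)
  then have "continuous_map ?X hemi_top (Psi_bar \<circ> (\<lambda>x. twisted_rel `` {x}))"
    by (rule continuous_map_eq) (auto simp: topspace_diff_plus_top Psi_bar_twisted_class[unfolded twisted_class_def])
  then show ?thesis
    unfolding twisted_top_def by (rule continuous_compose_quotient_map[OF quotient_map_quotient_topology])
qed

text \<open>Adapted to \<open>Phi_bar\<close>, whose rotation is chosen continuously only near a
  given map.\<close>

lemma continuous_map_locally:
  assumes "\<And>x. x \<in> topspace X \<Longrightarrow> \<exists>W. openin X W \<and> x \<in> W \<and> continuous_map (subtopology X W) Y f"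
  shows "continuous_map X Y f"
  unfolding continuous_map_def
proof (intro conjI allI impI)
  show "f \<in> topspace X \<rightarrow> topspace Y"
  proof
    fix x assume x: "x \<in> topspace X"
    then obtain W where "x \<in> W" "continuous_map (subtopology X W) Y f" using assms by blast
    then show "f x \<in> topspace Y" using x by (auto simp: continuous_map_def Pi_iff)
  qed
  fix U assume U: "openin Y U"
  show "openin X {x \<in> topspace X. f x \<in> U}"
  proof (subst openin_subopen, intro ballI)
    fix x assume x: "x \<in> {x \<in> topspace X. f x \<in> U}"
    then obtain W where W: "openin X W" "x \<in> W" "continuous_map (subtopology X W) Y f" using assms by blast
    have "openin (subtopology X W) {x \<in> topspace (subtopology X W). f x \<in> U}"
      using W(3) U by (simp add: continuous_map_def)
    then have "openin X {x \<in> topspace (subtopology X W). f x \<in> U}"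
      using W(1) openin_trans_full by blast
    then show "\<exists>T. openin X T \<and> x \<in> T \<and> T \<subseteq> {x \<in> topspace X. f x \<in> U}"
      using x W(2) by (intro exI[of _ "{x \<in> topspace (subtopology X W). f x \<in> U}"]) auto
  qed
qed

text \<open>For unit vectors \<open>b \<noteq> - a\<close>, the rotation in the plane of \<open>a\<close> and \<open>b\<close> that maps \<open>a\<close> to \<open>b\<close>.\<close>

definition plane_rotation :: "'a \<Rightarrow> 'a \<Rightarrow> 'a \<Rightarrow> 'a::real_inner"
  where "plane_rotation a b x =
    x - (((a + b) \<bullet> x) / (1 + a \<bullet> b)) *\<^sub>R (a + b) + (2 * (a \<bullet> x)) *\<^sub>R b"

lemma linear_plane_rotation: "linear (plane_rotation a b)"
  by (rule linearI) (simp_all add: plane_rotation_def inner_add_right algebra_simps add_divide_distrib)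

lemma plane_rotation_maps:
  assumes "norm a = 1" "a \<bullet> b \<noteq> - 1"
  shows "plane_rotation a b a = b"
proof -
  have aa: "a \<bullet> a = 1" using assms(1) by (simp add: norm_eq_1)
  have "1 + a \<bullet> b \<noteq> 0" using assms(2) by (simp add: add_eq_0_iff)
  moreover have "(a + b) \<bullet> a = 1 + a \<bullet> b" by (simp add: inner_add_left aa inner_commute[of b a])
  ultimately have "((a + b) \<bullet> a) / (1 + a \<bullet> b) = 1" by simp
  then show ?thesis unfolding plane_rotation_def by (simp only: aa) (simp add: scaleR_2)
qed

lemma plane_rotation_norm:
  assumes "norm a = 1" "norm b = 1" "a \<bullet> b \<noteq> - 1"
  shows "norm (plane_rotation a b x) = norm x"
proof -
  define k \<alpha> \<beta> where "k = 1 + a \<bullet> b" and "\<alpha> = a \<bullet> x" and "\<beta> = b \<bullet> x"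
  define r where "r = (\<alpha> + \<beta>) / k"
  have aa: "a \<bullet> a = 1" "b \<bullet> b = 1" using assms by (simp_all add: norm_eq_1)
  have k: "k \<noteq> 0" using assms(3) by (simp add: k_def add_eq_0_iff)
  have rk: "r * k = \<alpha> + \<beta>" using k by (simp add: r_def)
  have P: "plane_rotation a b x = x - r *\<^sub>R (a + b) + (2 * \<alpha>) *\<^sub>R b"
    by (simp add: plane_rotation_def r_def k_def \<alpha>_def \<beta>_def inner_add_left)
  have ab: "a \<bullet> b = k - 1" "b \<bullet> a = k - 1" by (simp_all add: k_def inner_commute)
  have xa: "x \<bullet> a = \<alpha>" "x \<bullet> b = \<beta>" "a \<bullet> x = \<alpha>" "b \<bullet> x = \<beta>"
    by (simp_all add: \<alpha>_def \<beta>_def inner_commute)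
  have "plane_rotation a b x \<bullet> plane_rotation a b x =
      x \<bullet> x - 2 * r * (\<alpha> + \<beta>) + 2 * r * (r * k) + 4 * \<alpha> * \<beta> - 4 * \<alpha> * (r * k) + 4 * \<alpha> * \<alpha>"
    unfolding P by (simp add: inner_add_left inner_add_right inner_diff_left inner_diff_right aa ab xa)
      (simp add: algebra_simps)
  also have "\<dots> = x \<bullet> x" unfolding rk by (simp add: algebra_simps)
  finally show ?thesis by (simp add: norm_eq_sqrt_inner)
qed

text \<open>An isometry has determinant 1 or -1, and the segment from the identity excludes -1. As
  norms are preserved, that segment can be singular only at its midpoint, where a kernel vector
  would be mapped to its negative.\<close>

lemma plane_rotation_SO:
  fixes a b :: "real^'n"
  assumes "norm a = 1" "norm b = 1" "a \<bullet> b \<noteq> - 1"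
  shows "matrix (plane_rotation a b) \<in> SO"
proof -
  let ?R = "plane_rotation a b"
  have ort: "orthogonal_transformation ?R"
    unfolding orthogonal_transformation using linear_plane_rotation plane_rotation_norm[OF assms] by blast
  have om: "orthogonal_matrix (matrix ?R)" using ort by (simp add: orthogonal_transformation_matrix)
  have aa: "a \<bullet> a = 1" "b \<bullet> b = 1" using assms by (simp_all add: norm_eq_1)
  have k: "1 + a \<bullet> b \<noteq> 0" using assms(3) by (simp add: add_eq_0_iff)
  have "det (matrix ?R) > 0"
  proof (rule det_pos_path[OF linear_id linear_plane_rotation])
    show "det (matrix (id :: real^'n \<Rightarrow> real^'n)) > 0" by simp
    fix t :: real and w :: "real^'n"
    assume t: "t \<in> {0..1}" and 0: "(1 - t) *\<^sub>R id w + t *\<^sub>R ?R w = 0"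
    then have "(1 - t) *\<^sub>R w = - (t *\<^sub>R ?R w)" by (simp add: eq_neg_iff_add_eq_0)
    then have "norm ((1 - t) *\<^sub>R w) = norm (t *\<^sub>R ?R w)" by simp
    then have "(1 - t) * norm w = t * norm w" using t plane_rotation_norm[OF assms, of w] by simp
    then have "w = 0 \<or> t = 1 / 2" by auto
    moreover have "w = 0" if "t = 1 / 2"
    proof -
      have R: "w + ?R w = 0" using 0 that by (simp add: scaleR_add_right[symmetric])
      define r where "r = ((a + b) \<bullet> w) / (1 + a \<bullet> b)"
      have rk: "r * (1 + a \<bullet> b) = a \<bullet> w + b \<bullet> w" using k by (simp add: r_def inner_add_left)
      have w2: "2 *\<^sub>R w - r *\<^sub>R (a + b) + (2 * (a \<bullet> w)) *\<^sub>R b = 0"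
        using R unfolding plane_rotation_def r_def[symmetric] by (simp add: scaleR_2 algebra_simps)
      \<comment> \<open>Pairing with \<open>a + b\<close> yields \<open>a \<bullet> w = 0\<close>,
        and then pairing with \<open>a\<close> yields \<open>r = 0\<close>; together they leave
        \<open>w = 0\<close>.\<close>
      have "0 = (a + b) \<bullet> (2 *\<^sub>R w - r *\<^sub>R (a + b) + (2 * (a \<bullet> w)) *\<^sub>R b)" by (simp only: w2 inner_zero_right)
      also have "\<dots> = 2 * (a \<bullet> w + b \<bullet> w) - 2 * (r * (1 + a \<bullet> b)) + 2 * (a \<bullet> w) * (1 + a \<bullet> b)"
        by (simp add: inner_add_left inner_add_right inner_diff_right aa inner_commute[of b a] algebra_simps)
      finally have "2 * (a \<bullet> w) * (1 + a \<bullet> b) = 0" unfolding rk by simp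
      then have aw: "a \<bullet> w = 0" using k by simp
      have "0 = a \<bullet> (2 *\<^sub>R w - r *\<^sub>R (a + b) + (2 * (a \<bullet> w)) *\<^sub>R b)" by (simp only: w2 inner_zero_right)
      also have "\<dots> = - (r * (1 + a \<bullet> b))"
        by (simp add: inner_add_left inner_add_right inner_diff_right aa aw algebra_simps)
      finally have "r = 0" using k by simp
      then show "w = 0" using w2 aw by simp
    qed
    ultimately show "w = 0" by blast
  qed
  moreover have "det (matrix ?R) = 1 \<or> det (matrix ?R) = - 1" by (rule det_orthogonal_matrix[OF om])
  ultimately show ?thesis using om by (auto simp: SO_def)
qed

section \<open>Continuous choice of rotations and of flattened maps\<close>

lemma continuous_map_matrix_mult:
  fixes A B :: "'z \<Rightarrow> real^'n^'n"
  assumes "continuous_map Z euclidean A" "continuous_map Z euclidean B"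
  shows "continuous_map Z euclidean (\<lambda>z. A z ** B z)"
  unfolding matrix_matrix_mult_def
  by (intro continuous_map_vec_lambda continuous_map_sum continuous_map_real_mult continuous_map_vec_nth
      assms finite)


lemma continuous_map_plane_rotation:
  fixes a :: "real^'n" and b :: "'z \<Rightarrow> real^'n"
  assumes "continuous_map Z euclidean b" "\<And>z. z \<in> topspace Z \<Longrightarrow> a \<bullet> b z \<noteq> - 1"
  shows "continuous_map Z euclidean (\<lambda>z. matrix (plane_rotation a (b z)))"
proof -
  have "continuous_on {y. a \<bullet> y \<noteq> - 1} (\<lambda>y. plane_rotation a y x)" for x
    unfolding plane_rotation_def
    by (intro continuous_intros) (simp add: add_eq_0_iff)
  from continuous_map_euclidean_compose[OF assms(1) this]
  have "continuous_map Z euclidean (\<lambda>z. plane_rotation a (b z) x)" for x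
    using assms(2) by simp
  then show ?thesis
    unfolding matrix_def by (intro continuous_map_vec_lambda continuous_map_vec_nth)
qed

lemma continuous_map_transpose:
  fixes A :: "'z \<Rightarrow> real^'n^'n"
  assumes "continuous_map Z euclidean A"
  shows "continuous_map Z euclidean (\<lambda>z. transpose (A z))"
  unfolding transpose_def by (intro continuous_map_vec_lambda continuous_map_vec_nth assms)

lemma smooth_family_flatten_map:
  fixes X :: "'x topology" and F :: "'x \<Rightarrow> 'n pt \<Rightarrow> ('n::{finite,wellorder}) pt"
  assumes F: "continuous_map X hemi_top F" and t: "continuous_map X euclideanreal t"
    and t01: "\<And>x. x \<in> topspace X \<Longrightarrow> t x \<in> {0..1}" and n: "CARD('n) > 2"
  shows "smooth_family X off_axis off_axis (\<lambda>x. flatten_map (t x) (dual_center (F x)) (F x) \<circ> tau)"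
proof -
  have FH: "F x \<in> hemi_immersions" if "x \<in> topspace X" for x
    using F that by (auto simp: continuous_map_def topspace_hemi_top)
  have c: "continuous_map X euclidean (\<lambda>x. dual_center (F x))"
    using continuous_map_compose[OF F continuous_map_dual_center[OF n]] by (simp add: o_def)
  have nz: "flatten_vec (t x) (dual_center (F x)) ((F x \<circ> tau) q) \<noteq> 0"
    if "x \<in> topspace X" "q \<in> off_axis" for x q
  proof -
    note p = tau_in_equator[OF that(2)]
    show ?thesis
      using map_det_pos_flatten_vec_nonzero[OF hemi_immersions_map_det(2)[OF FH[OF that(1)] n p]
          dual_center_props(1)[OF FH[OF that(1)] n] t01[OF that(1)] p
          hemi_immersions_map_det(3)[OF FH[OF that(1)] n p]] by simp
  qed
  have "smooth_family X off_axis off_axis (\<lambda>x q.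
      flatten_vec (t x) (dual_center (F x)) ((F x \<circ> tau) q) /\<^sub>R
        norm (flatten_vec (t x) (dual_center (F x)) ((F x \<circ> tau) q)))"
    by (rule smooth_family_flatten[OF open_off_axis order_refl
        smooth_family_reparam[OF smooth_family_hemi_top F] t c nz])
  then show ?thesis
    by (subst (asm) smooth_family_cong[where
          \<psi> = "\<lambda>x. flatten_map (t x) (dual_center (F x)) (F x) \<circ> tau"])
      (simp_all add: flatten_map_def tau_in_equator)
qed

lemma continuous_map_Phi_bar:
  assumes n: "CARD('n::{finite,wellorder}) > 3"
  shows "continuous_map hemi_top twisted_top
    (Phi_bar :: ('n pt \<Rightarrow> 'n pt) \<Rightarrow> ('n mat \<times> ('n pt \<Rightarrow> 'n pt)) set)"
proof (rule continuous_map_locally)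
  fix f0 :: "'n pt \<Rightarrow> 'n pt" assume "f0 \<in> topspace hemi_top"
  then have f0: "f0 \<in> hemi_immersions" by (simp add: topspace_hemi_top)
  have n2: "CARD('n) > 2" using n by simp
  define c0 where "c0 = dual_center f0"
  have nc0: "norm c0 = 1" unfolding c0_def by (rule dual_center_props(1)[OF f0 n2])
  obtain Q0 where "Q0 \<in> center_rotations f0" using center_rotations_nonempty[OF f0 n2] by blast
  then have Q0: "Q0 \<in> SO" "Q0 *v (- e_last) = c0" by (auto simp: center_rotations_iff c0_def)
  \<comment> \<open>The neighbourhood on which the center is not antipodal to \<open>c0\<close>, so
    that the plane rotation from \<open>c0\<close> to the center exists and varies
    continuously.\<close>
  define W where "W = {f \<in> topspace hemi_top. dual_center f \<in> {y :: 'n pt. c0 \<bullet> y > - 1}}"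
  have "open {y :: 'n pt. c0 \<bullet> y > - 1}" by (rule open_halfspace_gt)
  then have "openin hemi_top W"
    unfolding W_def by (intro openin_continuous_map_preimage[OF continuous_map_dual_center[OF n2]]) simp
  moreover have "f0 \<in> W"
    using f0 nc0 by (simp add: W_def topspace_hemi_top c0_def norm_eq_1)
  moreover have "continuous_map (subtopology hemi_top W) twisted_top Phi_bar"
  proof -
    let ?X = "subtopology hemi_top W"
    have tX: "topspace ?X = W" by (auto simp: W_def)
    have WH: "f \<in> hemi_immersions" "c0 \<bullet> dual_center f \<noteq> - 1" "norm (dual_center f) = 1" if "f \<in> W" for f
      using that dual_center_props(1)[OF _ n2] by (auto simp: W_def topspace_hemi_top)
    \<comment> \<open>A fixed rotation takes \<open>- e_last\<close> to \<open>c0\<close>, and the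
      plane rotation carries \<open>c0\<close> on to the center of \<open>f\<close>.\<close>
    define Q where "Q f = matrix (plane_rotation c0 (dual_center f)) ** Q0" for f :: "'n pt \<Rightarrow> 'n pt"
    have Qc: "Q f \<in> center_rotations f" if "f \<in> W" for f
    proof -
      have "Q f \<in> SO"
        unfolding Q_def by (rule SO_mult[OF plane_rotation_SO[OF nc0 WH(3)[OF that] WH(2)[OF that]] Q0(1)])
      moreover have "Q f *v (- e_last) = plane_rotation c0 (dual_center f) c0"
        unfolding Q_def matrix_vector_mul_assoc[symmetric] Q0(2)
        using linear_plane_rotation[of c0 "dual_center f"] by (simp add: matrix_works)
      ultimately show ?thesis
        by (simp add: center_rotations_iff plane_rotation_maps[OF nc0 WH(2)[OF that]])
    qed
    then have QSO: "Q f \<in> SO" "Q f *v (- e_last) = dual_center f" if "f \<in> W" for f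
      using that by (auto simp: center_rotations_iff)
    have idc: "continuous_map ?X hemi_top (\<lambda>f. f)"
      by (rule continuous_map_from_subtopology) (rule continuous_map_id[unfolded id_def])
    have cc: "continuous_map ?X euclidean dual_center"
      by (rule continuous_map_from_subtopology[OF continuous_map_dual_center[OF n2]])
    have cQ: "continuous_map ?X euclidean Q"
      unfolding Q_def[abs_def]
      by (rule continuous_map_matrix_mult[OF continuous_map_plane_rotation[OF cc]])
        (use WH(2) tX in auto)
    \<comment> \<open>For rotations the inverse is the transpose, whose entries depend continuously
      on \<open>Q f\<close>.\<close>
    have proj: "projected_map (Q f) f =
        compose equator ((*v) (transpose (Q f))) (flatten_map 1 (dual_center f) f)" if "f \<in> W" for f
      using projected_map_eq[OF QSO[OF that]] SO_matrix_inv[OF QSO(1)[OF that]] by simp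
    have pdp: "projected_map (Q f) f \<in> diff_plus" if "f \<in> W" for f
      by (rule projected_map_diff_plus[OF WH(1)[OF that] n Qc[OF that]])
    have fl: "smooth_family ?X off_axis off_axis (\<lambda>f. flatten_map 1 (dual_center f) f \<circ> tau)"
      by (rule smooth_family_flatten_map[OF idc _ _ n2]) simp_all
    have "continuous_map ?X (smooth_topology equator)
        (\<lambda>f. compose equator ((*v) (transpose (Q f))) (flatten_map 1 (dual_center f) f))"
      by (rule continuous_map_compose_rotation[OF continuous_map_transpose[OF cQ] fl])
        (use pdp proj diff_plus_smooth(1) tX in metis)
    then have "continuous_map ?X (smooth_topology equator) (\<lambda>f. projected_map (Q f) f)"
      by (rule continuous_map_eq) (use proj tX in auto)
    then have cg: "continuous_map ?X diff_plus_top (\<lambda>f. projected_map (Q f) f)"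
      unfolding diff_plus_top_def by (rule continuous_map_into_subtopology) (use pdp tX in auto)
    have "continuous_map ?X (top_of_set SO) Q"
      by (rule continuous_map_into_subtopology[OF cQ]) (use QSO(1) tX in auto)
    then have "continuous_map ?X (prod_topology (top_of_set SO) diff_plus_top)
        (\<lambda>f. (Q f, projected_map (Q f) f))"
      using cg by (rule continuous_map_pairedI)
    from continuous_map_compose[OF this quotient_imp_continuous_map[OF
          quotient_map_quotient_topology[where R = twisted_rel]]]
    have "continuous_map ?X twisted_top (\<lambda>f. twisted_class (Q f) (projected_map (Q f) f))"
      by (simp add: twisted_top_def twisted_class_def o_def)
    then show ?thesis
      by (rule continuous_map_eq) (use Phi_bar_eq[OF WH(1) n Qc] tX in auto)
  qed
  ultimately show "\<exists>W. openin hemi_top W \<and> f0 \<in> W \<and>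
      continuous_map (subtopology hemi_top W) twisted_top
        (Phi_bar :: ('n pt \<Rightarrow> 'n pt) \<Rightarrow> ('n mat \<times> ('n pt \<Rightarrow> 'n pt)) set)" by blast
qed

section \<open>The two homotopies\<close>

lemma homotopic_Psi_bar_Phi_bar:
  assumes n: "CARD('n::{finite,wellorder}) > 3"
  shows "homotopic_with (\<lambda>_. True) hemi_top hemi_top
    ((Psi_bar :: ('n mat \<times> ('n pt \<Rightarrow> 'n pt)) set \<Rightarrow> 'n pt \<Rightarrow> 'n pt) \<circ> Phi_bar) id"
proof -
  let ?X = "prod_topology (top_of_set {0..1}) hemi_top :: (real \<times> ('n pt \<Rightarrow> 'n pt)) topology"
  have n2: "CARD('n) > 2" using n by simp
  have tX: "topspace ?X = {0..1} \<times> hemi_immersions" by (simp add: topspace_hemi_top)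
  \<comment> \<open>Time runs backwards: at 0 the map is completely flattened, which is the
    composite, and at 1 it is unchanged.\<close>
  define h where "h x = flatten_map (1 - fst x) (dual_center (snd x)) (snd x)"
    for x :: "real \<times> ('n pt \<Rightarrow> 'n pt)"
  have hH: "h x \<in> hemi_immersions" if "x \<in> topspace ?X" for x
    using that flatten_map_hemi[OF _ n2, of "snd x" "1 - fst x"] by (auto simp: topspace_hemi_top h_def)
  then have hs: "h x \<in> smooth_maps usphere" if "x \<in> topspace ?X" for x
    using that by (auto simp: hemi_immersions_def immersions_def)
  have c1: "continuous_map ?X euclideanreal (\<lambda>x. 1 - fst x)"
    using continuous_map_fst[of "top_of_set {0..1::real}" hemi_top]
    by (intro continuous_map_diff) (auto intro: continuous_map_into_fulltopology)
  have "smooth_family ?X off_axis off_axis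
      (\<lambda>x. flatten_map (1 - fst x) (dual_center (snd x)) (snd x) \<circ> tau)"
    by (rule smooth_family_flatten_map[OF continuous_map_snd c1 _ n2]) auto
  then have sf: "smooth_family ?X off_axis equator (\<lambda>x. h x \<circ> tau)"
    unfolding h_def by (rule smooth_family_subset[OF _ order_refl equator_subset_off_axis])
  have "continuous_map ?X (smooth_topology usphere) h"
    by (rule continuous_map_smooth_topologyI[OF hs sf])
  then have "continuous_map ?X hemi_top h"
    unfolding hemi_top_def[where 'n = 'n]
    by (rule continuous_map_into_subtopology) (use hH in \<open>auto simp: hemi_top_def\<close>)
  moreover have "h (0, f) = (Psi_bar \<circ> Phi_bar) f" if "f \<in> topspace hemi_top" for f
    using that Psi_bar_Phi_bar[OF _ n] by (simp add: h_def topspace_hemi_top)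
  moreover have "h (1, f) = id f" if "f \<in> topspace hemi_top" for f
    using that flatten_map_0[of f] by (auto simp: h_def topspace_hemi_top hemi_immersions_def immersions_def)
  ultimately show ?thesis by (subst homotopic_with) auto
qed

lemma homotopic_Phi_bar_Psi_bar:
  assumes n: "CARD('n::{finite,wellorder}) > 3"
  shows "homotopic_with (\<lambda>_. True) twisted_top twisted_top
    (Phi_bar \<circ> (Psi_bar :: ('n mat \<times> ('n pt \<Rightarrow> 'n pt)) set \<Rightarrow> 'n pt \<Rightarrow> 'n pt)) id"
proof (rule homotopic_with_equal)
  show "continuous_map twisted_top twisted_top
      (Phi_bar \<circ> (Psi_bar :: ('n mat \<times> ('n pt \<Rightarrow> 'n pt)) set \<Rightarrow> 'n pt \<Rightarrow> 'n pt))"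
    by (rule continuous_map_compose[OF continuous_map_Psi_bar[OF n] continuous_map_Phi_bar[OF n]])
  fix C :: "('n mat \<times> ('n pt \<Rightarrow> 'n pt)) set" assume "C \<in> topspace twisted_top"
  then obtain Q g where C: "Q \<in> SO" "g \<in> diff_plus" "C = twisted_class Q g"
    by (auto simp: topspace_twisted_top twisted_class_def elim!: quotientE)
  show "(Phi_bar \<circ> Psi_bar) C = id C"
    by (simp add: C(3) Psi_bar_twisted_class[OF C(1,2)] Phi_bar_rotated[OF C(1,2) n])
qed auto

theorem theorem0p12:
  fixes n :: nat
  assumes "n \<ge> 2" and "CARD('n::{finite,wellorder}) = n + 2"
  shows "(\<forall>(Q::'n mat)\<in>SO. \<forall>g\<in>diff_plus.
            Psi_bar (twisted_class Q g) = compose equator ((*v) Q) g)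
    \<and> homotopy_equivalence_map twisted_top hemi_top
         (Psi_bar :: ('n mat \<times> ('n pt \<Rightarrow> 'n pt)) set \<Rightarrow> 'n pt \<Rightarrow> 'n pt)
    \<and> (\<forall>f\<in>hemi_immersions. center_rotations f \<noteq> ({} :: ('n mat) set) \<and>
         (\<forall>Q\<in>center_rotations f. projected_map Q f \<in> diff_plus \<and>
            Phi_bar f = twisted_class Q (projected_map Q f)))
    \<and> homotopy_inverse twisted_top hemi_top
         (Psi_bar :: ('n mat \<times> ('n pt \<Rightarrow> 'n pt)) set \<Rightarrow> 'n pt \<Rightarrow> 'n pt) Phi_bar"
proof -
  \<comment> \<open>The larger bound carries the simple connectivity of the equator; the smaller one
    is what frames and Gauss maps ask for.\<close>
  have n: "CARD('n) > 3" "CARD('n) > 2" using assms by auto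
  have inv: "homotopy_inverse twisted_top hemi_top
      (Psi_bar :: ('n mat \<times> ('n pt \<Rightarrow> 'n pt)) set \<Rightarrow> 'n pt \<Rightarrow> 'n pt) Phi_bar"
    unfolding homotopy_inverse_def
    using continuous_map_Psi_bar[OF n(1)] continuous_map_Phi_bar[OF n(1)]
      homotopic_Phi_bar_Psi_bar[OF n(1)] homotopic_Psi_bar_Phi_bar[OF n(1)] by blast
  show ?thesis
  proof (intro conjI ballI)
    show "Psi_bar (twisted_class Q g) = compose equator ((*v) Q) g"
      if "Q \<in> SO" "g \<in> diff_plus" for Q :: "'n mat" and g
      by (rule Psi_bar_twisted_class[OF that])
    show "homotopy_equivalence_map twisted_top hemi_top
        (Psi_bar :: ('n mat \<times> ('n pt \<Rightarrow> 'n pt)) set \<Rightarrow> 'n pt \<Rightarrow> 'n pt)"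
      unfolding homotopy_equivalence_map_def using inv by blast
    fix f :: "'n pt \<Rightarrow> 'n pt" assume f: "f \<in> hemi_immersions"
    show "center_rotations f \<noteq> {}" by (rule center_rotations_nonempty[OF f n(2)])
    fix Q assume Q: "Q \<in> center_rotations f"
    show "projected_map Q f \<in> diff_plus" by (rule projected_map_diff_plus[OF f n(1) Q])
    show "Phi_bar f = twisted_class Q (projected_map Q f)" by (rule Phi_bar_eq[OF f n(1) Q])
  qed (rule inv)
qed

end
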